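(* (i) Let $I=J^p$ for some $p>0$ and some Banach ideal $J$. Then $I=\bigcup\{L\in\Delta_{1/2}\mathscr{PL}\mid L\subset I\}$. (ii) If $I$ is a Banach ideal, then $I$ is am-stable if and only if $I=\bigcup\{L\in\mathscr{SPL}\mid L\subset I\}$. (iii) If $I$ is a Banach ideal, then $I$ is am-$\infty$ stable if and only if $I=\bigcup\{L\in\mathscr{S_\infty PL}\mid L\subset I\}$.
   Context: $H$ is a separable infinite-dimensional complex Hilbert space. "Ideal" means a two-sided ideal of $B(H)$ contained in the compact operators; all ideals considered are nonzero. $c_o^*$ is the set of nonnegative monotone nonincreasing sequences converging to $0$, and $(\ell^1)^*$ the set of summable sequences in $c_o^*$. $\Sigma(I):=\{s(X)\mid X\in I\}\subset c_o^*$, where $s(X)$ is the sequence of s-numbers (singular values) of $X$; an ideal is determined by $\Sigma(I)$. For $\xi\in c_o^*$, $(\xi)$ is the principal ideal generated by $\mathrm{diag}\,\xi$; every principal ideal has this form, and $\eta\in\Sigma((\xi))$ iff $\eta=O(D_m\xi)$ for some $m\in\mathbb N$, where $(D_m\xi)_n:=\xi_{\lceil n/m\rceil}$. A Banach ideal is an ideal that is complete with respect to a symmetric norm, i.e., a norm with $\|AXB\|\le\|A\|_{B(H)}\|X\|\|B\|_{B(H)}$ for $X$ in the ideal and $A,B\in B(H)$. For $p>0$, $J^p$ is the ideal with $\Sigma(J^p)=\{\xi^p\mid\xi\in\Sigma(J)\}$ (termwise powers). An ideal $I$ is am-stable if $I={}_aI$, where $\Sigma({}_aI)=\{\xi\in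 c_o^*\mid \xi_a\in\Sigma(I)\}$ and $(\xi_a)_n:=\frac1n\sum_{j=1}^n\xi_j$. $I$ is am-$\infty$ stable if $I={}_{a_\infty}I$, where $\Sigma({}_{a_\infty}I)=\{\xi\in(\ell^1)^*\mid\xi_{a_\infty}\in\Sigma(I)\}$ and $(\xi_{a_\infty})_n:=\frac1n\sum_{j=n+1}^\infty\xi_j$. $\Delta_{1/2}\mathscr{PL}$: all nonzero principal ideals having a generator $\xi\in c_o^*$ with $D_2\xi=O(\xi)$. $\mathscr{SPL}$: all nonzero am-stable principal ideals (equivalently $(\xi)$ with $\xi_a=O(\xi)$). $\mathscr{S_\infty PL}$: all nonzero am-$\infty$ stable principal ideals (equivalently $(\xi)$ with $\xi$ summable and $\xi_{a_\infty}=O(\xi)$). *)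

theory Defs
  imports "HOL-Analysis.Analysis" "HOL-Library.Landau_Symbols"
begin

section \<open>Complex Hilbert spaces and their bounded operators\<close>

text \<open>HOL-Analysis only has real inner products. The inner product below is linear in its first
  argument and induces the given norm; completeness comes from \<^class>\<open>banach\<close>.\<close>

class complex_hilbert = banach +
  fixes scaleC :: "complex \<Rightarrow> 'a \<Rightarrow> 'a" (infixr "*\<^sub>C" 75)
    and cinner :: "'a \<Rightarrow> 'a \<Rightarrow> complex"
  assumes scaleC_add_right: "a *\<^sub>C (x + y) = a *\<^sub>C x + a *\<^sub>C y"
    and scaleC_add_left: "(a + b) *\<^sub>C x = a *\<^sub>C x + b *\<^sub>C x"
    and scaleC_scaleC: "a *\<^sub>C (b *\<^sub>C x) = (a * b) *\<^sub>C x"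
    and scaleC_one: "1 *\<^sub>C x = x"
    and scaleC_of_real: "complex_of_real r *\<^sub>C x = r *\<^sub>R x"
    and cinner_commute: "cinner x y = cnj (cinner y x)"
    and cinner_add_left: "cinner (x + y) z = cinner x z + cinner y z"
    and cinner_scaleC_left: "cinner (a *\<^sub>C x) y = a * cinner x y"
    and cinner_self: "cinner x x = complex_of_real ((norm x)\<^sup>2)"

interpretation complex_vector: vector_space "scaleC :: complex \<Rightarrow> 'a \<Rightarrow> 'a::complex_hilbert"
  by unfold_locales
    (simp_all add: scaleC_add_right scaleC_add_left scaleC_scaleC scaleC_one)

text \<open>The type \<^typ>\<open>'h \<Rightarrow>\<^sub>L 'h\<close> consists of the bounded real-linear maps, with the operator norm;
  $B(H)$ is the set of those that are complex-linear.\<close>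

definition BH :: "('h::complex_hilbert \<Rightarrow>\<^sub>L 'h) set" where
  "BH = {A. \<forall>c x. blinfun_apply A (c *\<^sub>C x) = c *\<^sub>C blinfun_apply A x}"

definition scalar_op :: "complex \<Rightarrow> ('h::complex_hilbert \<Rightarrow>\<^sub>L 'h)" where
  "scalar_op c = Blinfun (\<lambda>x. c *\<^sub>C x)"

definition compact_ops :: "('h::complex_hilbert \<Rightarrow>\<^sub>L 'h) set" where
  "compact_ops = {A \<in> BH. compact (closure (blinfun_apply A ` cball 0 1))}"

definition adj :: "('h::complex_hilbert \<Rightarrow>\<^sub>L 'h) \<Rightarrow> ('h \<Rightarrow>\<^sub>L 'h)" where
  "adj X = (THE Y. Y \<in> BH \<and>
     (\<forall>x y. cinner (blinfun_apply X x) y = cinner x (blinfun_apply Y y)))"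

definition orthonormal_basis :: "(nat \<Rightarrow> 'h::complex_hilbert) \<Rightarrow> bool" where
  "orthonormal_basis e \<longleftrightarrow>
     (\<forall>m n. cinner (e m) (e n) = (if m = n then 1 else 0)) \<and>
     closure (complex_vector.span (range e)) = UNIV"

text \<open>The diagonal operator with diagonal \<open>\<xi>\<close>, with respect to a fixed orthonormal basis.\<close>

definition std_basis :: "nat \<Rightarrow> 'h::complex_hilbert" where
  "std_basis = (SOME e. orthonormal_basis e)"

definition diag :: "(nat \<Rightarrow> real) \<Rightarrow> ('h::complex_hilbert \<Rightarrow>\<^sub>L 'h)" where
  "diag \<xi> = Blinfun (\<lambda>x. \<Sum>n. \<xi> n *\<^sub>R (cinner x (std_basis n) *\<^sub>C std_basis n))"


section \<open>Sequences\<close>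

text \<open>Sequences are indexed from \<open>0\<close>: the term \<open>\<xi> k\<close> is the mathematical $\xi_{k+1}$. Accordingly
  $\lceil n/m \rceil$ with $n = k+1$ becomes \<open>k div m\<close>, and the averages at \<open>k\<close> have
  denominator \<open>k + 1\<close>.\<close>

definition c0_star :: "(nat \<Rightarrow> real) set" where
  "c0_star = {\<xi>. (\<forall>n. 0 \<le> \<xi> n) \<and> decseq \<xi> \<and> \<xi> \<longlonglongrightarrow> 0}"

definition l1_star :: "(nat \<Rightarrow> real) set" where
  "l1_star = {\<xi> \<in> c0_star. summable \<xi>}"

definition ampliation :: "nat \<Rightarrow> (nat \<Rightarrow> real) \<Rightarrow> (nat \<Rightarrow> real)" where
  "ampliation m \<xi> = (\<lambda>k. \<xi> (k div m))"

definition arith_mean :: "(nat \<Rightarrow> real) \<Rightarrow> (nat \<Rightarrow> real)" where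
  "arith_mean \<xi> = (\<lambda>k. (\<Sum>j\<le>k. \<xi> j) / real (k + 1))"

definition arith_mean_inf :: "(nat \<Rightarrow> real) \<Rightarrow> (nat \<Rightarrow> real)" where
  "arith_mean_inf \<xi> = (\<lambda>k. (\<Sum>j. \<xi> (j + (k + 1))) / real (k + 1))"


section \<open>Singular values\<close>

text \<open>The singular values of a compact \<open>X\<close> are the square roots of the eigenvalues of $X^* X$,
  repeated according to multiplicity, in nonincreasing order, and padded with zeros when \<open>X\<close> has
  finite rank. A sequence in \<^const>\<open>c0_star\<close> is determined by how often it takes each positive
  value.\<close>

definition is_singular_values :: "('h::complex_hilbert \<Rightarrow>\<^sub>L 'h) \<Rightarrow> (nat \<Rightarrow> real) \<Rightarrow> bool" where
  "is_singular_values X s \<longleftrightarrow> s \<in> c0_star \<and>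
     (\<forall>t>0. card {n. s n = t} =
        complex_vector.dim {v. blinfun_apply (adj X o\<^sub>L X) v = complex_of_real (t\<^sup>2) *\<^sub>C v})"

definition singular_values :: "('h::complex_hilbert \<Rightarrow>\<^sub>L 'h) \<Rightarrow> (nat \<Rightarrow> real)" where
  "singular_values X = (THE s. is_singular_values X s)"


section \<open>Operator ideals\<close>

text \<open>Closure under complex scalars follows by multiplying with \<^term>\<open>scalar_op c\<close>.\<close>

definition op_ideal :: "('h::complex_hilbert \<Rightarrow>\<^sub>L 'h) set \<Rightarrow> bool" where
  "op_ideal I \<longleftrightarrow> I \<subseteq> compact_ops \<and> 0 \<in> I \<and> (\<forall>X\<in>I. \<forall>Y\<in>I. X + Y \<in> I) \<and>
     (\<forall>A\<in>BH. \<forall>X\<in>I. A o\<^sub>L X \<in> I \<and> X o\<^sub>L A \<in> I)"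

definition Sigma_ideal :: "('h::complex_hilbert \<Rightarrow>\<^sub>L 'h) set \<Rightarrow> (nat \<Rightarrow> real) set" where
  "Sigma_ideal I = singular_values ` I"

text \<open>\<open>I\<close> is the ideal with $\Sigma(I) = S$; an ideal is determined by its $\Sigma$.\<close>

definition is_ideal_with_Sigma ::
    "('h::complex_hilbert \<Rightarrow>\<^sub>L 'h) set \<Rightarrow> (nat \<Rightarrow> real) set \<Rightarrow> bool" where
  "is_ideal_with_Sigma I S \<longleftrightarrow> op_ideal I \<and> Sigma_ideal I = S"

definition ideal_gen :: "('h::complex_hilbert \<Rightarrow>\<^sub>L 'h) \<Rightarrow> ('h \<Rightarrow>\<^sub>L 'h) set" where
  "ideal_gen X = \<Inter>{J. op_ideal J \<and> X \<in> J}"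

definition principal_ideal :: "('h::complex_hilbert \<Rightarrow>\<^sub>L 'h) set \<Rightarrow> bool" where
  "principal_ideal L \<longleftrightarrow> (\<exists>X\<in>compact_ops. L = ideal_gen X)"

text \<open>\<open>N\<close> is a norm on the complex vector space \<open>I\<close> (nonnegativity follows from the axioms),
  symmetric, and \<open>I\<close> is complete for it.\<close>

definition symmetric_norm_on ::
    "('h::complex_hilbert \<Rightarrow>\<^sub>L 'h) set \<Rightarrow> (('h \<Rightarrow>\<^sub>L 'h) \<Rightarrow> real) \<Rightarrow> bool" where
  "symmetric_norm_on I N \<longleftrightarrow>
     (\<forall>X\<in>I. N X = 0 \<longleftrightarrow> X = 0) \<and>
     (\<forall>X\<in>I. \<forall>Y\<in>I. N (X + Y) \<le> N X + N Y) \<and>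
     (\<forall>c. \<forall>X\<in>I. N (scalar_op c o\<^sub>L X) = cmod c * N X) \<and>
     (\<forall>A\<in>BH. \<forall>B\<in>BH. \<forall>X\<in>I. N (A o\<^sub>L X o\<^sub>L B) \<le> norm A * N X * norm B)"

definition complete_on ::
    "('h::complex_hilbert \<Rightarrow>\<^sub>L 'h) set \<Rightarrow> (('h \<Rightarrow>\<^sub>L 'h) \<Rightarrow> real) \<Rightarrow> bool" where
  "complete_on I N \<longleftrightarrow>
     (\<forall>X :: nat \<Rightarrow> ('h \<Rightarrow>\<^sub>L 'h). (\<forall>n. X n \<in> I) \<and>
        (\<forall>\<epsilon>>0. \<exists>M. \<forall>m\<ge>M. \<forall>n\<ge>M. N (X m - X n) < \<epsilon>) \<longrightarrow>
        (\<exists>Y\<in>I. (\<lambda>n. N (X n - Y)) \<longlonglongrightarrow> 0))"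

definition banach_ideal :: "('h::complex_hilbert \<Rightarrow>\<^sub>L 'h) set \<Rightarrow> bool" where
  "banach_ideal I \<longleftrightarrow> op_ideal I \<and> (\<exists>N. symmetric_norm_on I N \<and> complete_on I N)"

text \<open>\<open>I\<close> is the power $J^p$.\<close>

definition is_ideal_power ::
    "('h::complex_hilbert \<Rightarrow>\<^sub>L 'h) set \<Rightarrow> ('h \<Rightarrow>\<^sub>L 'h) set \<Rightarrow> real \<Rightarrow> bool" where
  "is_ideal_power I J p \<longleftrightarrow>
     is_ideal_with_Sigma I ((\<lambda>\<xi> n. \<xi> n powr p) ` Sigma_ideal J)"

text \<open>\<open>I\<close> is equal to its arithmetic mean ideal ${}_aI$, respectively ${}_{a_\infty}I$.\<close>

definition am_stable :: "('h::complex_hilbert \<Rightarrow>\<^sub>L 'h) set \<Rightarrow> bool" where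
  "am_stable I \<longleftrightarrow> is_ideal_with_Sigma I {\<xi> \<in> c0_star. arith_mean \<xi> \<in> Sigma_ideal I}"

definition am_inf_stable :: "('h::complex_hilbert \<Rightarrow>\<^sub>L 'h) set \<Rightarrow> bool" where
  "am_inf_stable I \<longleftrightarrow> is_ideal_with_Sigma I {\<xi> \<in> l1_star. arith_mean_inf \<xi> \<in> Sigma_ideal I}"

definition Delta_half_PL :: "('h::complex_hilbert \<Rightarrow>\<^sub>L 'h) set set" where
  "Delta_half_PL =
     {L. L \<noteq> {0} \<and> (\<exists>\<xi>\<in>c0_star. L = ideal_gen (diag \<xi>) \<and> ampliation 2 \<xi> \<in> O(\<xi>))}"

definition SPL :: "('h::complex_hilbert \<Rightarrow>\<^sub>L 'h) set set" where
  "SPL = {L. L \<noteq> {0} \<and> principal_ideal L \<and> am_stable L}"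

definition S_inf_PL :: "('h::complex_hilbert \<Rightarrow>\<^sub>L 'h) set set" where
  "S_inf_PL = {L. L \<noteq> {0} \<and> principal_ideal L \<and> am_inf_stable L}"

end

theory Submission
  imports Defs
begin

text \<open>The Schmidt decomposition identifies an ideal \<open>I\<close> with the sequences \<open>\<xi>\<close> for which \<open>diag \<xi>\<close> lies
  in \<open>I\<close>. Let \<open>T\<close> be one of the operations \<open>D\<^sub>2\<close>, \<open>D\<^sub>2 + (\<cdot>)\<^sub>a\<close>, \<open>D\<^sub>2 + (\<cdot>)\<^sub>a\<^sub>\<infinity>\<close>. If \<open>\<Sigma>(I)\<close> is closed
  under \<open>T\<close>, completeness makes \<open>T\<close> bounded for the symmetric norm, with a constant \<open>C\<close> say, and then
  \<open>\<xi> = \<Sum>k. (2 C)\<^sup>-\<^sup>k T\<^sup>k \<eta>\<close> converges in \<open>I\<close>, majorises \<open>\<eta>\<close> and satisfies \<open>T \<xi> \<le> 2 C \<xi>\<close>. Including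
  \<open>D\<^sub>2\<close> in \<open>T\<close> makes the principal ideal of \<open>\<xi>\<close> explicit: its sequences are exactly those that are
  \<open>O(\<xi>)\<close>, because \<open>B(H) diag \<xi> B(H)\<close> is already closed under addition.\<close>

section \<open>Complex Hilbert spaces\<close>

text \<open>The obstacle is that the sequences of I do not form a vector space and carry no topology
  of their own: the norm \<open>N\<close> only sees operators. Two facts bridge the gap. Compression
  to rank one bounds each matrix entry of X by a multiple of \<open>N X\<close>, so an
  \<open>N\<close>-convergent series of diagonal operators converges entrywise, to a diagonal
  operator. Conversely, a dominated diagonal has a smaller norm. Boundedness of T is then a gliding
  hump argument for a monotone map, and countable subadditivity of T is enough for the majorant;
  this weak property also survives the addition of D_2. In (i) the power J^p need not be a Banach
  ideal, so the majorant is built in J and raised to the power p afterwards. In all three parts the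
  sequence (1, 0, 0, ...) is added before majorising, so that the principal ideal obtained is
  nonzero. The converses in (ii) and (iii) need no norm estimate: each sequence of I already lies in
  a single stable principal ideal contained in I.\<close>

lemma cinner_add_right: "cinner x (y + z) = cinner x y + cinner (x::'h::complex_hilbert) z"
  by (metis cinner_commute cinner_add_left complex_cnj_add)

lemma cinner_scaleC_right: "cinner x (a *\<^sub>C y) = cnj a * cinner (x::'h::complex_hilbert) y"
  by (metis cinner_commute cinner_scaleC_left complex_cnj_mult)

lemma cinner_scaleR_left: "cinner (r *\<^sub>R x) y = of_real r * cinner (x::'h::complex_hilbert) y"
  by (metis scaleC_of_real cinner_scaleC_left)

lemma cinner_scaleR_right: "cinner x (r *\<^sub>R y) = of_real r * cinner (x::'h::complex_hilbert) y"
  by (metis scaleC_of_real cinner_scaleC_right complex_cnj_complex_of_real)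

lemma cinner_zero [simp]: "cinner 0 (x::'h::complex_hilbert) = 0" "cinner (x::'h) 0 = 0"
  using cinner_scaleR_left[of 0 0 x] cinner_scaleR_right[of x 0 0] by simp_all

lemma cinner_minus:
  "cinner (- x) (y::'h::complex_hilbert) = - cinner x y" "cinner (x::'h) (- y) = - cinner x y"
  using cinner_scaleR_left[of "-1" x y] cinner_scaleR_right[of x "-1" y] by simp_all

lemma cinner_diff:
  "cinner (x - y) (z::'h::complex_hilbert) = cinner x z - cinner y z"
  "cinner (x::'h) (y - z) = cinner x y - cinner x z"
  using cinner_add_left[of x "-y" z] cinner_add_right[of x y "-z"] by (simp_all add: cinner_minus)

lemma cinner_sum_left: "cinner (\<Sum>i\<in>A. f i) (y::'h::complex_hilbert) = (\<Sum>i\<in>A. cinner (f i) y)"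
  by (induction A rule: infinite_finite_induct) (auto simp: cinner_add_left)

lemma cinner_sum_right: "cinner (y::'h::complex_hilbert) (\<Sum>i\<in>A. f i) = (\<Sum>i\<in>A. cinner y (f i))"
  by (induction A rule: infinite_finite_induct) (auto simp: cinner_add_right)

lemma cinner_self_eq_0: "cinner x x = 0 \<longleftrightarrow> (x::'h::complex_hilbert) = 0"
  by (simp add: cinner_self)

lemma cinner_eq_0_commute: "cinner x y = 0 \<longleftrightarrow> cinner y (x::'h::complex_hilbert) = 0"
  by (metis cinner_commute complex_cnj_zero)

lemma norm_scaleC [simp]: "norm (a *\<^sub>C (x::'h::complex_hilbert)) = cmod a * norm x"
proof -
  have "complex_of_real ((norm (a *\<^sub>C x))\<^sup>2) = complex_of_real ((cmod a * norm x)\<^sup>2)"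
    unfolding cinner_self[symmetric, of "a *\<^sub>C x"] cinner_scaleC_left cinner_scaleC_right
      power_mult_distrib of_real_mult complex_norm_square by (simp add: cinner_self)
  then show ?thesis
    by (simp only: of_real_eq_iff) (simp add: power2_eq_iff_nonneg)
qed

lemma norm_add_square:
  "(norm (x + y))\<^sup>2 = (norm x)\<^sup>2 + (norm y)\<^sup>2 + 2 * Re (cinner x (y::'h::complex_hilbert))"
proof -
  have "complex_of_real ((norm (x + y))\<^sup>2) = cinner x x + cinner y y + (cinner x y + cnj (cinner x y))"
    by (subst cinner_self[symmetric])
      (simp add: cinner_add_left cinner_add_right cinner_commute[of y x])
  also have "\<dots> = complex_of_real ((norm x)\<^sup>2 + (norm y)\<^sup>2 + 2 * Re (cinner x y))"
    by (simp add: cinner_self complex_add_cnj)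
  finally show ?thesis
    by (simp only: of_real_eq_iff)
qed

lemma norm_add_orth:
  assumes "cinner x y = 0"
  shows "(norm (x + y))\<^sup>2 = (norm x)\<^sup>2 + (norm (y::'h::complex_hilbert))\<^sup>2"
  using norm_add_square[of x y] assms by simp

lemma norm_diff_orth:
  assumes "cinner x y = 0"
  shows "(norm (x - y))\<^sup>2 = (norm x)\<^sup>2 + (norm (y::'h::complex_hilbert))\<^sup>2"
  using norm_add_orth[of x "-y"] assms by (simp add: cinner_minus)

lemma parallelogram:
  "(norm (x - y))\<^sup>2 = 2 * (norm x)\<^sup>2 + 2 * (norm y)\<^sup>2 - (norm (x + (y::'h::complex_hilbert)))\<^sup>2"
  using norm_add_square[of x y] norm_add_square[of x "-y"] by (simp add: cinner_minus)

lemma cinner_cauchy_schwarz: "cmod (cinner x y) \<le> norm x * norm (y::'h::complex_hilbert)"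
proof (cases "y = 0")
  case False
  \<comment> \<open>\<open>c *\<^sub>C y\<close> is the orthogonal projection of x onto the line of
    y; Pythagoras then gives the bound.\<close>
  define c where "c = cinner x y / of_real ((norm y)\<^sup>2)"
  have ny: "norm y \<noteq> 0"
    using False by simp
  have "cinner (x - c *\<^sub>C y) (c *\<^sub>C y) = 0"
    using ny by (simp add: c_def cinner_diff cinner_scaleC_left cinner_scaleC_right cinner_self)
  then have "(norm x)\<^sup>2 = (norm (x - c *\<^sub>C y))\<^sup>2 + (norm (c *\<^sub>C y))\<^sup>2"
    using norm_add_orth[of "x - c *\<^sub>C y" "c *\<^sub>C y"] by simp
  then have "(cmod c * norm y)\<^sup>2 \<le> (norm x)\<^sup>2"
    by simp
  then have "cmod c * norm y \<le> norm x"
    by (rule power2_le_imp_le) simp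
  moreover have "cmod c * norm y = cmod (cinner x y) / norm y"
    using ny unfolding c_def norm_divide norm_of_real by (simp add: power2_eq_square)
  ultimately show ?thesis
    using ny by (simp add: field_simps)
qed simp

lemma bounded_linear_cinner_left: "bounded_linear (\<lambda>x. cinner x (y::'h::complex_hilbert))"
  by (rule bounded_linear_intro[where K="norm y"])
    (auto simp: cinner_add_left cinner_scaleR_left scaleR_conv_of_real cinner_cauchy_schwarz)

lemma scaleC_scaleR_commute: "c *\<^sub>C (r *\<^sub>R x) = r *\<^sub>R (c *\<^sub>C (x::'h::complex_hilbert))"
  by (simp add: scaleC_of_real[symmetric] scaleC_scaleC mult.commute)

lemma bounded_linear_scaleC: "bounded_linear (\<lambda>x. c *\<^sub>C (x::'h::complex_hilbert))"
  by (rule bounded_linear_intro[where K="cmod c"])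
    (auto simp: scaleC_add_right scaleC_scaleR_commute)

lemmas cinner_left_sums = bounded_linear.sums[OF bounded_linear_cinner_left]

section \<open>Bounded complex-linear operators\<close>

lemma BH_scaleC: "A \<in> BH \<Longrightarrow> blinfun_apply A (c *\<^sub>C x) = c *\<^sub>C blinfun_apply A x"
  by (simp add: BH_def)

lemma BH_intro: "(\<And>c x. blinfun_apply A (c *\<^sub>C x) = c *\<^sub>C blinfun_apply A x) \<Longrightarrow> A \<in> BH"
  by (simp add: BH_def)

lemma BH_compose: "A \<in> BH \<Longrightarrow> B \<in> BH \<Longrightarrow> A o\<^sub>L B \<in> BH"
  by (simp add: BH_def)

lemma BH_add: "A \<in> BH \<Longrightarrow> B \<in> BH \<Longrightarrow> A + B \<in> BH"
  by (simp add: BH_def blinfun.add_left scaleC_add_right)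

lemma BH_id: "id_blinfun \<in> BH"
  by (simp add: BH_def)

lemma blinfun_compose_assoc: "(A o\<^sub>L B) o\<^sub>L C = A o\<^sub>L (B o\<^sub>L C)"
  by (rule blinfun_eqI) simp

lemma scalar_op_apply [simp]: "blinfun_apply (scalar_op c) x = c *\<^sub>C x"
  by (simp add: scalar_op_def bounded_linear_Blinfun_apply bounded_linear_scaleC)

lemma scalar_op_BH: "scalar_op c \<in> BH"
  by (rule BH_intro) (simp add: scaleC_scaleC mult.commute)

lemma scalar_op_of_real: "scalar_op (of_real r) o\<^sub>L X = r *\<^sub>R X"
  by (rule blinfun_eqI) (simp add: scaleC_of_real blinfun.scaleR_left)

section \<open>Orthogonal systems\<close>

text \<open>Vectors shorter than 1, in particular 0, are allowed because the range vectors in the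
  Schmidt decomposition of a finite rank operator vanish from some index on.\<close>

definition orthosys :: "(nat \<Rightarrow> 'h::complex_hilbert) \<Rightarrow> bool" where
  "orthosys f \<longleftrightarrow> (\<forall>m n. m \<noteq> n \<longrightarrow> cinner (f m) (f n) = 0) \<and> (\<forall>n. norm (f n) \<le> 1)"

definition orthonormal :: "(nat \<Rightarrow> 'h::complex_hilbert) \<Rightarrow> bool" where
  "orthonormal f \<longleftrightarrow> (\<forall>m n. cinner (f m) (f n) = (if m = n then 1 else 0))"

lemma orthonormal_cinner: "orthonormal f \<Longrightarrow> cinner (f m) (f n) = (if m = n then 1 else 0)"
  by (simp add: orthonormal_def)

lemma orthonormal_norm: "orthonormal f \<Longrightarrow> norm (f n) = 1"
  using cinner_self[of "f n"] by (simp add: orthonormal_def)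
    (metis norm_ge_zero of_real_eq_1_iff of_real_power power2_eq_1_iff not_one_le_zero neg_0_le_iff_le)

lemma orthonormal_imp_orthosys: "orthonormal f \<Longrightarrow> orthosys f"
  by (simp add: orthosys_def orthonormal_cinner orthonormal_norm)

lemma orthonormal_comp: "orthonormal f \<Longrightarrow> inj \<phi> \<Longrightarrow> orthonormal (\<lambda>n. f (\<phi> n))"
  by (simp add: orthonormal_def inj_eq)

lemma orthosys_norm: "orthosys f \<Longrightarrow> norm (f n) \<le> 1"
  by (simp add: orthosys_def)

lemma orthosys_cinner: "orthosys f \<Longrightarrow> m \<noteq> n \<Longrightarrow> cinner (f m) (f n) = 0"
  by (simp add: orthosys_def)

lemma norm_sum_orthosys:
  assumes "orthosys f" "finite A"
  shows "(norm (\<Sum>n\<in>A. c n *\<^sub>C f n))\<^sup>2 = (\<Sum>n\<in>A. (cmod (c n))\<^sup>2 * (norm (f n))\<^sup>2)"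
  using assms(2)
proof (induction A rule: finite_induct)
  case (insert x A)
  have "cinner (c x *\<^sub>C f x) (\<Sum>n\<in>A. c n *\<^sub>C f n) = 0"
    unfolding cinner_sum_right using insert.hyps
    by (intro sum.neutral) (auto simp: cinner_scaleC_left cinner_scaleC_right
        intro!: orthosys_cinner[OF assms(1)])
  then show ?case
    using insert by (simp add: norm_add_orth power_mult_distrib)
qed simp

lemma norm_sum_orthosys_le:
  assumes "orthosys f" "finite A"
  shows "(norm (\<Sum>n\<in>A. c n *\<^sub>C f n))\<^sup>2 \<le> (\<Sum>n\<in>A. (cmod (c n))\<^sup>2)"
  unfolding norm_sum_orthosys[OF assms]
  using orthosys_norm[OF assms(1)] by (intro sum_mono mult_right_le_one_le) (auto simp: power_le_one)

text \<open>Expand the square of \<open>norm (v - p)\<close>, where p is the sum of the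
  \<open>cinner v (f n) *\<^sub>C f n\<close>. As the \<open>f n\<close> may be shorter than 1, p
  need not be a projection of v; the inequality for \<open>norm p\<close> replaces the usual
  equality.\<close>

lemma bessel_finite:
  assumes "orthosys f" "finite A"
  shows "(\<Sum>n\<in>A. (cmod (cinner v (f n)))\<^sup>2) \<le> (norm v)\<^sup>2"
proof -
  let ?p = "\<Sum>n\<in>A. cinner v (f n) *\<^sub>C f n"
  let ?s = "\<Sum>n\<in>A. (cmod (cinner v (f n)))\<^sup>2"
  have "cinner v ?p = of_real ?s"
    by (simp add: cinner_sum_right cinner_scaleC_right mult.commute[of "cnj _"] complex_norm_square
        del: of_real_power)
  then have "(norm (v - ?p))\<^sup>2 = (norm v)\<^sup>2 + (norm ?p)\<^sup>2 - 2 * ?s"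
    using norm_add_square[of v "- ?p"] by (simp add: cinner_minus)
  moreover have "(norm ?p)\<^sup>2 \<le> ?s"
    by (rule norm_sum_orthosys_le[OF assms])
  ultimately show ?thesis
    by (smt (verit) zero_le_power2)
qed

lemma bessel_summable: "orthosys f \<Longrightarrow> summable (\<lambda>n. (cmod (cinner v (f n)))\<^sup>2)"
  by (rule summableI_nonneg_bounded[where x="(norm v)\<^sup>2"]) (auto simp: bessel_finite)

text \<open>Pythagoras bounds each block of the series by the corresponding block of squared
  coefficients, so the Cauchy criterion carries over.\<close>

lemma summable_orthosys:
  assumes "orthosys g" "summable (\<lambda>n. (cmod (c n))\<^sup>2)"
  shows "summable (\<lambda>n. c n *\<^sub>C g n)"
  unfolding summable_Cauchy
proof (intro allI impI)
  fix \<epsilon> :: real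
  assume "0 < \<epsilon>"
  then have "\<epsilon>\<^sup>2 > 0"
    by simp
  then obtain N where N: "\<And>m n. m \<ge> N \<Longrightarrow> norm (\<Sum>k=m..<n. (cmod (c k))\<^sup>2) < \<epsilon>\<^sup>2"
    using assms(2) unfolding summable_Cauchy by blast
  show "\<exists>N. \<forall>m\<ge>N. \<forall>n. norm (\<Sum>k=m..<n. c k *\<^sub>C g k) < \<epsilon>"
  proof (intro exI[of _ N] allI impI)
    fix m n assume "m \<ge> N"
    have "(norm (\<Sum>k=m..<n. c k *\<^sub>C g k))\<^sup>2 \<le> (\<Sum>k=m..<n. (cmod (c k))\<^sup>2)"
      by (rule norm_sum_orthosys_le[OF assms(1)]) simp
    also have "\<dots> < \<epsilon>\<^sup>2"
      using N[OF \<open>m \<ge> N\<close>, of n] by simp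
    finally show "norm (\<Sum>k=m..<n. c k *\<^sub>C g k) < \<epsilon>"
      by (rule power2_less_imp_less) (use \<open>0 < \<epsilon>\<close> in simp)
  qed
qed

section \<open>Schmidt series\<close>

text \<open>One formula covers all operators built here: diagonal operators, the isometries between
  subsequences of the basis, and the partial isometries that carry one orthogonal system to another.
  Composition and adjoint are then computed once.\<close>

definition schmidt ::
    "(nat \<Rightarrow> real) \<Rightarrow> (nat \<Rightarrow> 'h::complex_hilbert) \<Rightarrow> (nat \<Rightarrow> 'h) \<Rightarrow> ('h \<Rightarrow>\<^sub>L 'h)" where
  "schmidt a f g = Blinfun (\<lambda>x. \<Sum>n. a n *\<^sub>R (cinner x (f n) *\<^sub>C g n))"

lemma diag_eq_schmidt: "diag \<xi> = schmidt \<xi> std_basis std_basis"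
  by (simp add: diag_def schmidt_def)

lemma
  assumes f: "orthosys f" and g: "orthosys g" and a: "\<forall>n. \<bar>a n\<bar> \<le> K"
  shows schmidt_summable: "summable (\<lambda>n. a n *\<^sub>R (cinner x (f n) *\<^sub>C g n))"
    and schmidt_norm_suminf: "norm (\<Sum>n. a n *\<^sub>R (cinner x (f n) *\<^sub>C g n)) \<le> K * norm x"
proof -
  let ?c = "\<lambda>n. of_real (a n) * cinner x (f n)"
  have K: "K \<ge> 0"
    using a[rule_format, of 0] by simp
  have eq: "a n *\<^sub>R (cinner x (f n) *\<^sub>C g n) = ?c n *\<^sub>C g n" for n
    by (simp add: scaleC_of_real[symmetric] scaleC_scaleC)
  have le: "(cmod (?c n))\<^sup>2 \<le> K\<^sup>2 * (cmod (cinner x (f n)))\<^sup>2" for n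
    using a[rule_format, of n] by (simp add: norm_mult power_mult_distrib mult_right_mono abs_le_square_iff[symmetric])
  show sm: "summable (\<lambda>n. a n *\<^sub>R (cinner x (f n) *\<^sub>C g n))"
    unfolding eq
  proof (rule summable_orthosys[OF g], rule summable_comparison_test'[where N=0])
    show "summable (\<lambda>n. K\<^sup>2 * (cmod (cinner x (f n)))\<^sup>2)"
      by (intro summable_mult bessel_summable[OF f])
  qed (use le in auto)
  have "norm (\<Sum>n<k. ?c n *\<^sub>C g n) \<le> K * norm x" for k
  proof -
    have "(norm (\<Sum>n<k. ?c n *\<^sub>C g n))\<^sup>2 \<le> (\<Sum>n<k. (cmod (?c n))\<^sup>2)"
      by (rule norm_sum_orthosys_le[OF g]) simp
    also have "\<dots> \<le> K\<^sup>2 * (\<Sum>n<k. (cmod (cinner x (f n)))\<^sup>2)"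
      unfolding sum_distrib_left by (intro sum_mono le)
    also have "\<dots> \<le> (K * norm x)\<^sup>2"
      using bessel_finite[OF f, of "{..<k}" x] by (simp add: power_mult_distrib mult_left_mono)
    finally show ?thesis
      by (rule power2_le_imp_le) (simp add: K)
  qed
  moreover have "(\<lambda>k. \<Sum>n<k. ?c n *\<^sub>C g n) \<longlonglongrightarrow> (\<Sum>n. ?c n *\<^sub>C g n)"
    using sm unfolding eq by (rule summable_LIMSEQ)
  ultimately show "norm (\<Sum>n. a n *\<^sub>R (cinner x (f n) *\<^sub>C g n)) \<le> K * norm x"
    unfolding eq by (intro Lim_bounded[OF tendsto_norm]) auto
qed

context
  fixes a :: "nat \<Rightarrow> real" and f g :: "nat \<Rightarrow> 'h::complex_hilbert" and K :: real
  assumes f: "orthosys f" and g: "orthosys g" and a: "\<forall>n. \<bar>a n\<bar> \<le> K"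
begin

lemma schmidt_apply:
  "blinfun_apply (schmidt a f g) x = (\<Sum>n. a n *\<^sub>R (cinner x (f n) *\<^sub>C g n))"
proof -
  note sm = schmidt_summable[OF f g a]
  have "bounded_linear (\<lambda>x. \<Sum>n. a n *\<^sub>R (cinner x (f n) *\<^sub>C g n))"
  proof (rule bounded_linear_intro[where K=K])
    fix x y
    show "(\<Sum>n. a n *\<^sub>R (cinner (x + y) (f n) *\<^sub>C g n)) =
        (\<Sum>n. a n *\<^sub>R (cinner x (f n) *\<^sub>C g n)) + (\<Sum>n. a n *\<^sub>R (cinner y (f n) *\<^sub>C g n))"
      by (subst suminf_add[OF sm sm]) (simp add: cinner_add_left scaleC_add_left scaleR_add_right)
  next
    fix r x
    show "(\<Sum>n. a n *\<^sub>R (cinner (r *\<^sub>R x) (f n) *\<^sub>C g n)) =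
        r *\<^sub>R (\<Sum>n. a n *\<^sub>R (cinner x (f n) *\<^sub>C g n))"
      unfolding cinner_scaleR_left scaleC_scaleC[symmetric] scaleC_of_real
        suminf_scaleR_right[OF sm] by (simp add: mult.commute)
  next
    fix x
    show "norm (\<Sum>n. a n *\<^sub>R (cinner x (f n) *\<^sub>C g n)) \<le> norm x * K"
      using schmidt_norm_suminf[OF f g a] by (simp add: mult.commute)
  qed
  then show ?thesis
    by (simp add: schmidt_def bounded_linear_Blinfun_apply)
qed

lemma schmidt_sums:
  "(\<lambda>n. a n *\<^sub>R (cinner x (f n) *\<^sub>C g n)) sums blinfun_apply (schmidt a f g) x"
  unfolding schmidt_apply using schmidt_summable[OF f g a] by (rule summable_sums)

lemma schmidt_norm_le: "norm (schmidt a f g) \<le> K"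
  using a[rule_format, of 0] by (intro norm_blinfun_bound) (auto simp: schmidt_apply schmidt_norm_suminf[OF f g a])

lemma schmidt_BH: "schmidt a f g \<in> BH"
proof (rule BH_intro)
  fix c x
  have "(\<lambda>n. c *\<^sub>C (a n *\<^sub>R (cinner x (f n) *\<^sub>C g n))) sums (c *\<^sub>C blinfun_apply (schmidt a f g) x)"
    by (rule bounded_linear.sums[OF bounded_linear_scaleC schmidt_sums])
  then have "(\<lambda>n. a n *\<^sub>R (cinner (c *\<^sub>C x) (f n) *\<^sub>C g n)) sums (c *\<^sub>C blinfun_apply (schmidt a f g) x)"
    unfolding cinner_scaleC_left scaleC_scaleC[symmetric] scaleC_scaleR_commute .
  with schmidt_sums[of "c *\<^sub>C x"] show "blinfun_apply (schmidt a f g) (c *\<^sub>C x) = c *\<^sub>C blinfun_apply (schmidt a f g) x"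
    by (rule sums_unique2)
qed

lemma schmidt_cinner_sums:
  "(\<lambda>n. a n *\<^sub>R (cinner x (f n) * cinner (g n) y)) sums cinner (blinfun_apply (schmidt a f g) x) y"
  using cinner_left_sums[OF schmidt_sums[of x], where y=y]
  by (simp add: cinner_scaleR_left cinner_scaleC_left scaleR_conv_of_real)

lemma schmidt_cinner_range:
  "cinner (blinfun_apply (schmidt a f g) x) (g m) = (a m * (norm (g m))\<^sup>2) *\<^sub>R cinner x (f m)"
proof -
  have "(\<lambda>n. a n *\<^sub>R (cinner x (f n) * cinner (g n) (g m))) sums
      (a m *\<^sub>R (cinner x (f m) * cinner (g m) (g m)))"
    using sums_finite[of "{m}" "\<lambda>n. a n *\<^sub>R (cinner x (f n) * cinner (g n) (g m))"]
    by (simp add: orthosys_cinner[OF g])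
  with schmidt_cinner_sums have "cinner (blinfun_apply (schmidt a f g) x) (g m) =
      a m *\<^sub>R (cinner x (f m) * cinner (g m) (g m))"
    by (rule sums_unique2)
  then show ?thesis
    by (simp add: cinner_self scaleR_conv_of_real)
qed

lemma schmidt_domain:
  "blinfun_apply (schmidt a f g) (f m) = (a m * (norm (f m))\<^sup>2) *\<^sub>R g m"
proof -
  have "(\<lambda>n. a n *\<^sub>R (cinner (f m) (f n) *\<^sub>C g n)) sums (a m *\<^sub>R (cinner (f m) (f m) *\<^sub>C g m))"
    using sums_finite[of "{m}" "\<lambda>n. a n *\<^sub>R (cinner (f m) (f n) *\<^sub>C g n)"]
    by (simp add: orthosys_cinner[OF f])
  with schmidt_sums have "blinfun_apply (schmidt a f g) (f m) = a m *\<^sub>R (cinner (f m) (f m) *\<^sub>C g m)"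
    by (rule sums_unique2)
  then show ?thesis
    by (simp add: cinner_self scaleC_of_real del: of_real_power)
qed

end

text \<open>The weights are real, so conjugating the series term by term only exchanges the two
  systems.\<close>

lemma schmidt_adjoint:
  assumes "orthosys f" "orthosys g" "\<forall>n. \<bar>a n\<bar> \<le> K"
  shows "cinner (blinfun_apply (schmidt a f g) x) y = cinner x (blinfun_apply (schmidt a g f) y)"
proof -
  have "(\<lambda>n. cnj (a n *\<^sub>R (cinner y (g n) * cinner (f n) x))) sums
      cnj (cinner (blinfun_apply (schmidt a g f) y) x)"
    using schmidt_cinner_sums[OF assms(2,1,3), where x=y and y=x] by (simp only: sums_cnj)
  then have "(\<lambda>n. a n *\<^sub>R (cinner x (f n) * cinner (g n) y)) sums
      cinner x (blinfun_apply (schmidt a g f) y)"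
    unfolding complex_cnj_scaleR complex_cnj_mult cinner_commute[symmetric]
    by (simp only: mult.commute)
  with schmidt_cinner_sums[OF assms, where x=x and y=y] show ?thesis
    by (rule sums_unique2)
qed

text \<open>The squared norm accounts for short vectors in the middle system. Since \<open>c\<close>
  is constrained only by this equation, callers may take the plain product of the weights even if
  some \<open>h n\<close> is 0, as long as a weight vanishes there.\<close>

lemma schmidt_compose:
  assumes f: "orthosys f" and h: "orthosys h" and k: "orthosys k"
    and a: "\<forall>n. \<bar>a n\<bar> \<le> K" and b: "\<forall>n. \<bar>b n\<bar> \<le> K'"
    and c: "\<And>n. a n * b n * (norm (h n))\<^sup>2 = c n"
  shows "schmidt a h k o\<^sub>L schmidt b f h = schmidt c f k"
proof (rule blinfun_eqI)
  fix x
  have "\<bar>a n * b n * (norm (h n))\<^sup>2\<bar> \<le> K * K' * 1" for n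
    unfolding abs_mult using a[rule_format, of n] b[rule_format, of n]
    by (intro mult_mono) (auto simp: orthosys_norm[OF h] power_le_one)
  then have cK: "\<forall>n. \<bar>c n\<bar> \<le> K * K'"
    by (metis c mult.right_neutral)
  note cs = schmidt_sums[OF f k cK, where x=x]
  have "(\<lambda>n. a n *\<^sub>R (cinner (blinfun_apply (schmidt b f h) x) (h n) *\<^sub>C k n)) =
      (\<lambda>n. c n *\<^sub>R (cinner x (f n) *\<^sub>C k n))"
    unfolding schmidt_cinner_range[OF f h b] c[symmetric]
    by (simp add: scaleC_of_real[symmetric] scaleC_scaleC scaleR_conv_of_real mult.assoc)
  with schmidt_sums[OF h k a, where x="blinfun_apply (schmidt b f h) x"] cs
  show "blinfun_apply (schmidt a h k o\<^sub>L schmidt b f h) x = blinfun_apply (schmidt c f k) x"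
    by (simp add: sums_unique2)
qed

section \<open>Singular values\<close>

lemma c0_star_nonneg: "\<xi> \<in> c0_star \<Longrightarrow> 0 \<le> \<xi> n"
  by (simp add: c0_star_def)

lemma c0_star_antimono: "\<xi> \<in> c0_star \<Longrightarrow> m \<le> n \<Longrightarrow> \<xi> n \<le> \<xi> m"
  by (simp add: c0_star_def decseq_def)

lemma c0_star_abs_le: "\<xi> \<in> c0_star \<Longrightarrow> \<forall>n. \<bar>\<xi> n\<bar> \<le> \<xi> 0"
  by (simp add: c0_star_nonneg c0_star_antimono)

lemma c0_starI:
  assumes "\<And>n. 0 \<le> \<xi> n" "\<And>n. \<xi> (Suc n) \<le> \<xi> n" "\<xi> \<longlonglongrightarrow> 0"
  shows "\<xi> \<in> c0_star"
  using assms by (simp add: c0_star_def decseq_Suc_iff)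

lemma c0_star_finite_ge:
  assumes "\<xi> \<in> c0_star" "t > 0"
  shows "finite {n. t \<le> \<xi> n}"
proof -
  have "\<xi> \<longlonglongrightarrow> 0"
    using assms(1) by (simp add: c0_star_def)
  then have "\<forall>\<^sub>F n in sequentially. \<xi> n < t"
    using assms(2) by (rule order_tendstoD)
  then obtain N where N: "\<And>n. n \<ge> N \<Longrightarrow> \<xi> n < t"
    by (auto simp: eventually_sequentially)
  have "{n. t \<le> \<xi> n} \<subseteq> {..<N}"
    using N by (auto simp: not_less[symmetric])
  then show ?thesis
    by (rule finite_subset) simp
qed

section \<open>Level sets of decreasing null sequences\<close>

lemma initial_segment_eq_lessThan_card:
  fixes A :: "nat set"
  assumes "finite A" "\<And>m n. n \<in> A \<Longrightarrow> m \<le> n \<Longrightarrow> m \<in> A"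
  shows "A = {..<card A}"
proof -
  define k where "k = (LEAST k. k \<notin> A)"
  have "k \<notin> A"
    unfolding k_def by (rule LeastI_ex) (rule ex_new_if_finite[OF infinite_UNIV_nat assms(1)])
  moreover have "m \<in> A" if "m < k" for m
    using not_less_Least[OF that[unfolded k_def]] by simp
  ultimately have "A = {..<k}"
    using assms(2) by (auto simp: not_le[symmetric])
  then show ?thesis
    by simp
qed

text \<open>Upper level sets of a decreasing sequence are initial segments, so the sequence can be
  recovered from their cardinalities.\<close>

lemma c0_star_ge_iff:
  assumes "\<xi> \<in> c0_star" "t > 0"
  shows "t \<le> \<xi> n \<longleftrightarrow> n < card {n. t \<le> \<xi> n}"
proof -
  have "{n. t \<le> \<xi> n} = {..<card {n. t \<le> \<xi> n}}"
    by (intro initial_segment_eq_lessThan_card c0_star_finite_ge[OF assms])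
      (use c0_star_antimono[OF assms(1)] in \<open>force intro: order_trans\<close>)
  then show ?thesis
    by blast
qed

text \<open>This justifies the definite description in \<open>singular_values\<close>: the
  multiplicities of the positive values add up to the sizes of the upper level sets, which determine
  the sequence.\<close>

lemma c0_star_eqI:
  assumes x: "\<xi> \<in> c0_star" and y: "\<eta> \<in> c0_star"
    and eq: "\<And>t. t > 0 \<Longrightarrow> card {n. \<xi> n = t} = card {n. \<eta> n = t}"
  shows "\<xi> = \<eta>"
proof
  fix n
  have card_eq: "card {n. t \<le> \<xi> n} = card {n. t \<le> \<eta> n}" if t: "t > 0" for t
  proof -
    \<comment> \<open>All values at least t that either sequence takes: a finite set over which both
      level sets can be counted by the same sum.\<close>
    define V where "V = \<xi> ` {n. t \<le> \<xi> n} \<union> \<eta> ` {n. t \<le> \<eta> n}"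
    have V: "finite V" "\<And>v. v \<in> V \<Longrightarrow> t \<le> v"
      using c0_star_finite_ge[OF x t] c0_star_finite_ge[OF y t] by (auto simp: V_def)
    have *: "card {n. t \<le> \<zeta> n} = (\<Sum>v\<in>V. card {n. \<zeta> n = v})"
      if z: "\<zeta> \<in> c0_star" and sub: "\<zeta> ` {n. t \<le> \<zeta> n} \<subseteq> V" for \<zeta>
    proof -
      have "{n. t \<le> \<zeta> n} = (\<Union>v\<in>V. {n. \<zeta> n = v})"
        using sub V(2) by auto
      moreover have "finite {n. \<zeta> n = v}" if "v \<in> V" for v
        by (rule finite_subset[OF _ c0_star_finite_ge[OF z t]]) (use V(2)[OF that] in auto)
      ultimately show ?thesis
        using V(1) by (simp add: card_UN_disjoint disjoint_iff)
    qed
    have "card {n. t \<le> \<xi> n} = (\<Sum>v\<in>V. card {n. \<xi> n = v})"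
      by (rule *[OF x]) (simp add: V_def)
    also have "\<dots> = (\<Sum>v\<in>V. card {n. \<eta> n = v})"
      using V(2) t by (intro sum.cong eq) force+
    also have "\<dots> = card {n. t \<le> \<eta> n}"
      by (rule *[OF y, symmetric]) (simp add: V_def)
    finally show ?thesis .
  qed
  have iff: "t \<le> \<xi> n \<longleftrightarrow> t \<le> \<eta> n" if "t > 0" for t
    by (metis c0_star_ge_iff[OF x that] c0_star_ge_iff[OF y that] card_eq[OF that])
  show "\<xi> n = \<eta> n"
  proof (rule antisym)
    show "\<xi> n \<le> \<eta> n"
      using iff[of "\<xi> n"] c0_star_nonneg[OF x, of n] c0_star_nonneg[OF y, of n]
      by (cases "\<xi> n = 0") auto
    show "\<eta> n \<le> \<xi> n"
      using iff[of "\<eta> n"] c0_star_nonneg[OF x, of n] c0_star_nonneg[OF y, of n]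
      by (cases "\<eta> n = 0") auto
  qed
qed

text \<open>Only uniqueness of the adjoint is at stake. It is applied to Schmidt operators, whose
  adjoint is explicit, so no representation theorem enters.\<close>

lemma adj_eqI:
  assumes "Y \<in> BH" "\<And>x y. cinner (blinfun_apply X x) y = cinner x (blinfun_apply Y y)"
  shows "adj X = Y"
  unfolding adj_def
proof (rule the_equality)
  fix Z
  assume Z: "Z \<in> BH \<and> (\<forall>x y. cinner (blinfun_apply X x) y = cinner x (blinfun_apply Z y))"
  show "Z = Y"
  proof (rule blinfun_eqI)
    fix y
    have "cinner (blinfun_apply Z y - blinfun_apply Y y) (blinfun_apply Z y - blinfun_apply Y y) = 0"
      using Z assms(2) by (metis cinner_diff(2) right_minus_eq)
    then show "blinfun_apply Z y = blinfun_apply Y y"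
      by (simp add: cinner_self_eq_0)
  qed
qed (use assms in auto)

lemma orthonormal_inj: "orthonormal f \<Longrightarrow> inj f"
  by (metis injI orthonormal_cinner zero_neq_one)

lemma orthonormal_independent:
  assumes "orthonormal f" "finite A"
  shows "complex_vector.independent (f ` A)"
proof -
  have "u (f k) = 0" if "(\<Sum>v\<in>f ` A. u v *\<^sub>C v) = 0" "k \<in> A" for u k
  proof -
    have "0 = cinner (\<Sum>n\<in>A. u (f n) *\<^sub>C f n) (f k)"
      using that(1) by (subst (asm) sum.reindex)
        (auto intro: inj_on_subset[OF orthonormal_inj[OF assms(1)]])
    also have "\<dots> = u (f k)"
      using that(2) assms(2)
      by (simp add: cinner_sum_left cinner_scaleC_left orthonormal_cinner[OF assms(1)]
          if_distrib sum.delta cong: if_cong)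
    finally show ?thesis
      by simp
  qed
  then show ?thesis
    using assms(2) by (subst complex_vector.dependent_finite) auto
qed

text \<open>Taking the coordinate along \<open>f m\<close> of the eigenvalue equation leaves only
  the \<open>f m\<close> with weight t. For t = 0 the eigenspace would also contain everything
  orthogonal to the system.\<close>

lemma schmidt_eigenspace:
  assumes f: "orthonormal f" and a: "\<forall>n. \<bar>a n\<bar> \<le> K" and t: "t \<noteq> 0" and fin: "finite {n. a n = t}"
  shows "{v. blinfun_apply (schmidt a f f) v = complex_of_real t *\<^sub>C v} =
      complex_vector.span (f ` {n. a n = t})"
proof (intro antisym subsetI)
  note of = orthonormal_imp_orthosys[OF f]
  fix v
  assume "v \<in> {v. blinfun_apply (schmidt a f f) v = complex_of_real t *\<^sub>C v}"
  then have v: "blinfun_apply (schmidt a f f) v = t *\<^sub>R v"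
    by (simp add: scaleC_of_real)
  have zero: "cinner v (f m) = 0" if "a m \<noteq> t" for m
  proof -
    have "t *\<^sub>R cinner v (f m) = a m *\<^sub>R cinner v (f m)"
      using schmidt_cinner_range[OF of of a, of v m] unfolding v
      by (simp add: orthonormal_norm[OF f] cinner_scaleR_left scaleR_conv_of_real)
    then show ?thesis
      using that by simp
  qed
  have "(\<lambda>n. a n *\<^sub>R (cinner v (f n) *\<^sub>C f n)) sums
      (\<Sum>n\<in>{n. a n = t}. a n *\<^sub>R (cinner v (f n) *\<^sub>C f n))"
    by (rule sums_finite[OF fin]) (use zero in auto)
  with schmidt_sums[OF of of a, of v]
  have "t *\<^sub>R v = (\<Sum>n\<in>{n. a n = t}. a n *\<^sub>R (cinner v (f n) *\<^sub>C f n))"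
    unfolding v by (rule sums_unique2)
  also have "\<dots> = t *\<^sub>R (\<Sum>n\<in>{n. a n = t}. cinner v (f n) *\<^sub>C f n)"
    by (simp add: scaleR_sum_right)
  finally have "v = (\<Sum>n\<in>{n. a n = t}. cinner v (f n) *\<^sub>C f n)"
    using t by simp
  also have "\<dots> \<in> complex_vector.span (f ` {n. a n = t})"
    by (intro complex_vector.span_sum complex_vector.span_scale complex_vector.span_base) auto
  finally show "v \<in> complex_vector.span (f ` {n. a n = t})" .
next
  note of = orthonormal_imp_orthosys[OF f]
  let ?E = "{v. blinfun_apply (schmidt a f f) v = complex_of_real t *\<^sub>C v}"
  fix v
  assume "v \<in> complex_vector.span (f ` {n. a n = t})"
  moreover have "complex_vector.span (f ` {n. a n = t}) \<subseteq> ?E"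
  proof (rule complex_vector.span_minimal)
    show "f ` {n. a n = t} \<subseteq> ?E"
      by (auto simp: schmidt_domain[OF of of a] orthonormal_norm[OF f] scaleC_of_real)
    show "complex_vector.subspace ?E"
      by (rule complex_vector.subspaceI)
        (auto simp: blinfun.zero_right blinfun.add_right scaleC_add_right BH_scaleC[OF schmidt_BH[OF of of a]]
          scaleC_scaleC mult.commute)
  qed
  ultimately show "v \<in> ?E"
    by blast
qed

section \<open>Singular values of a Schmidt operator\<close>

lemma singular_values_eqI:
  assumes "is_singular_values X s"
  shows "singular_values X = s"
  unfolding singular_values_def
proof (rule the_equality)
  show "is_singular_values X s"
    by (rule assms)
next
  fix s'
  assume "is_singular_values X s'"
  with assms show "s' = s"
    by (intro c0_star_eqI) (auto simp: is_singular_values_def)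
qed

text \<open>Adjoint times operator has weights \<open>(s n)\<^sup>2\<close> along \<open>f\<close>,
  so the eigenspace of \<open>t\<^sup>2\<close> is spanned by the \<open>f n\<close> with
  \<open>s n = t\<close>. The vectors \<open>g n\<close> must be unit vectors only where the weight
  is positive, as elsewhere the product of the weights is 0 anyway.\<close>

lemma singular_values_schmidt:
  assumes f: "orthonormal f" and g: "orthosys g" and s: "s \<in> c0_star"
    and g1: "\<And>n. s n > 0 \<Longrightarrow> norm (g n) = 1"
  shows "singular_values (schmidt s f g) = s"
proof (rule singular_values_eqI, unfold is_singular_values_def, intro conjI allI impI)
  show "s \<in> c0_star"
    by (rule s)
next
  fix t :: real
  assume t: "t > 0"
  note of = orthonormal_imp_orthosys[OF f] and sb = c0_star_abs_le[OF s]
  have adj: "adj (schmidt s f g) = schmidt s g f"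
    by (rule adj_eqI[OF schmidt_BH[OF g of sb]]) (rule schmidt_adjoint[OF of g sb])
  have comp: "schmidt s g f o\<^sub>L schmidt s f g = schmidt (\<lambda>n. (s n)\<^sup>2) f f"
    by (rule schmidt_compose[OF of g of sb sb])
      (use g1 c0_star_nonneg[OF s] in \<open>force simp: power2_eq_square le_less\<close>)
  have bd: "\<forall>n. \<bar>(s n)\<^sup>2\<bar> \<le> (s 0)\<^sup>2"
    using sb by (simp add: c0_star_nonneg[OF s] power_mono)
  have eq: "{n. (s n)\<^sup>2 = t\<^sup>2} = {n. s n = t}"
    using t c0_star_nonneg[OF s] by (auto simp: power2_eq_iff_nonneg)
  have fin: "finite {n. s n = t}"
    by (rule finite_subset[OF _ c0_star_finite_ge[OF s t]]) auto
  have "{v. blinfun_apply (adj (schmidt s f g) o\<^sub>L schmidt s f g) v = complex_of_real (t\<^sup>2) *\<^sub>C v} =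
      complex_vector.span (f ` {n. s n = t})"
    unfolding adj comp using schmidt_eigenspace[OF f bd, of "t\<^sup>2"] t fin unfolding eq by simp
  then show "card {n. s n = t} = complex_vector.dim
      {v. blinfun_apply (adj (schmidt s f g) o\<^sub>L schmidt s f g) v = complex_of_real (t\<^sup>2) *\<^sub>C v}"
    using orthonormal_independent[OF f fin] orthonormal_inj[OF f]
    by (simp add: complex_vector.dim_eq_card_independent card_image inj_on_subset)
qed

section \<open>Orthonormal bases\<close>

lemma orthonormal_basis_alt:
  "orthonormal_basis e \<longleftrightarrow> orthonormal e \<and> closure (complex_vector.span (range e)) = UNIV"
  by (simp add: orthonormal_basis_def orthonormal_def)

lemma orthogonal_closure_span:
  assumes "v \<in> closure (complex_vector.span B)" "\<And>b. b \<in> B \<Longrightarrow> cinner b (w::'h::complex_hilbert) = 0"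
  shows "cinner v w = 0"
proof -
  have "complex_vector.span B \<subseteq> {v. cinner v w = 0}"
    by (rule complex_vector.span_minimal)
      (use assms(2) in \<open>auto intro!: complex_vector.subspaceI simp: cinner_add_left cinner_scaleC_left\<close>)
  moreover have "closed {v. cinner v w = 0}"
    by (intro closed_Collect_eq linear_continuous_on bounded_linear_cinner_left continuous_on_const)
  ultimately have "closure (complex_vector.span B) \<subseteq> {v. cinner v w = 0}"
    by (rule closure_minimal)
  then show ?thesis
    using assms(1) by auto
qed

text \<open>The remainder of v after its expansion is orthogonal to a dense span, hence to
  itself.\<close>

lemma basis_sums:
  assumes e: "orthonormal_basis e"
  shows "(\<lambda>n. cinner v (e n) *\<^sub>C e n) sums v"
proof -
  have on: "orthonormal e" and dense: "closure (complex_vector.span (range e)) = UNIV"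
    using e by (auto simp: orthonormal_basis_alt)
  note os = orthonormal_imp_orthosys[OF on]
  have one: "\<forall>n::nat. \<bar>1::real\<bar> \<le> 1"
    by simp
  let ?P = "schmidt (\<lambda>_. 1) e e"
  have "cinner (v - blinfun_apply ?P v) (e n) = 0" for n
    using schmidt_cinner_range[OF os os one, of v n] by (simp add: cinner_diff orthonormal_norm[OF on])
  then have *: "cinner b (v - blinfun_apply ?P v) = 0" if "b \<in> range e" for b
    using that cinner_eq_0_commute by blast
  have "cinner (v - blinfun_apply ?P v) (v - blinfun_apply ?P v) = 0"
    by (rule orthogonal_closure_span[where B="range e"]) (simp_all add: dense *)
  then have "blinfun_apply ?P v = v"
    by (simp add: cinner_self_eq_0)
  with schmidt_sums[OF os os one, of v] show ?thesis
    by simp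
qed

lemma blinfun_eq_on_basis:
  assumes e: "orthonormal_basis e" and A: "A \<in> BH" and B: "B \<in> BH"
    and eq: "\<And>n. blinfun_apply A (e n) = blinfun_apply B (e n)"
  shows "A = B"
proof (rule blinfun_eqI)
  fix v
  have "(\<lambda>n. cinner v (e n) *\<^sub>C blinfun_apply A (e n)) sums blinfun_apply A v"
    using bounded_linear.sums[OF blinfun.bounded_linear_right basis_sums[OF e], of A v] unfolding BH_scaleC[OF A] .
  moreover have "(\<lambda>n. cinner v (e n) *\<^sub>C blinfun_apply A (e n)) sums blinfun_apply B v"
    using bounded_linear.sums[OF blinfun.bounded_linear_right basis_sums[OF e], of B v] unfolding BH_scaleC[OF B] eq .
  ultimately show "blinfun_apply A v = blinfun_apply B v"
    by (rule sums_unique2)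
qed

text \<open>A maximal orthonormal set is infinite and, by separability, countable.\<close>

lemma ex_orthonormal_basis:
  assumes separable: "\<exists>D :: 'h::complex_hilbert set. countable D \<and> closure D = UNIV"
    and infinite_dim: "\<not> (\<exists>B :: 'h set. finite B \<and> complex_vector.span B = UNIV)"
  shows "\<exists>e :: nat \<Rightarrow> 'h. orthonormal_basis e"
proof -
  define ons where "ons = {B :: 'h set. \<forall>x\<in>B. \<forall>y\<in>B. cinner x y = (if x = y then 1 else 0)}"
  have "\<exists>M\<in>ons. \<forall>X\<in>ons. M \<subseteq> X \<longrightarrow> X = M"
  proof (rule subset_Zorn_nonempty)
    show "ons \<noteq> {}"
      by (auto simp: ons_def intro!: exI[of _ "{}"])
    show "\<Union>\<C> \<in> ons" if "\<C> \<noteq> {}" "subset.chain ons \<C>" for \<C>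
      unfolding ons_def
    proof (intro CollectI ballI)
      fix x y
      assume "x \<in> \<Union>\<C>" "y \<in> \<Union>\<C>"
      then obtain X Y where "X \<in> \<C>" "Y \<in> \<C>" "x \<in> X" "y \<in> Y"
        by blast
      moreover have "X \<subseteq> Y \<or> Y \<subseteq> X"
        using that(2) \<open>X \<in> \<C>\<close> \<open>Y \<in> \<C>\<close> by (auto simp: subset.chain_def)
      ultimately obtain Z where "Z \<in> \<C>" "x \<in> Z" "y \<in> Z"
        by blast
      moreover have "Z \<in> ons"
        using that(2) \<open>Z \<in> \<C>\<close> by (auto simp: subset.chain_def)
      ultimately show "cinner x y = (if x = y then 1 else 0)"
        by (simp add: ons_def)
    qed
  qed
  then obtain M where M: "M \<in> ons" and max: "\<And>X. X \<in> ons \<Longrightarrow> M \<subseteq> X \<Longrightarrow> X = M"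
    by blast
  have Mcin: "cinner x y = (if x = y then 1 else 0)" if "x \<in> M" "y \<in> M" for x y
    using M that by (simp add: ons_def)
  have Mnorm: "norm x = 1" if "x \<in> M" for x
  proof -
    have "(norm x)\<^sup>2 = 1"
      using Mcin[OF that that] by (simp only: cinner_self) (simp only: if_True refl of_real_eq_1_iff)
    then show ?thesis
      by (metis norm_ge_zero one_power2 power2_eq_iff_nonneg zero_le_one)
  qed
  \<comment> \<open>Otherwise the normalised w could be adjoined to M, against maximality.\<close>
  have maxortho: "w = 0" if w: "\<And>x. x \<in> M \<Longrightarrow> cinner x w = 0" for w
  proof (rule ccontr)
    assume "w \<noteq> 0"
    define u where "u = (1 / norm w) *\<^sub>R w"
    have u: "cinner u u = 1"
      using \<open>w \<noteq> 0\<close> by (simp add: u_def cinner_scaleR_left cinner_scaleR_right cinner_self power2_eq_square)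
    have ux: "cinner x u = 0" "cinner u x = 0" if "x \<in> M" for x
      using w[OF that] cinner_eq_0_commute[of x w] by (auto simp: u_def cinner_scaleR_left cinner_scaleR_right)
    have "u \<notin> M"
      using ux(1)[of u] u by auto
    moreover have "insert u M \<in> ons"
      using u ux Mcin \<open>u \<notin> M\<close> by (auto simp: ons_def)
    ultimately show False
      using max[of "insert u M"] by blast
  qed
  have "infinite M"
  proof
    assume fin: "finite M"
    have "v \<in> complex_vector.span M" for v
    proof -
      let ?p = "\<Sum>x\<in>M. cinner v x *\<^sub>C x"
      have "cinner (v - ?p) x = 0" if "x \<in> M" for x
        using that fin by (simp add: cinner_diff cinner_sum_left cinner_scaleC_left Mcin
            if_distrib sum.delta cong: if_cong)
      then have "v - ?p = 0"
        by (intro maxortho) (simp add: cinner_eq_0_commute)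
      then have "v = ?p"
        by simp
      also have "\<dots> \<in> complex_vector.span M"
        by (intro complex_vector.span_sum complex_vector.span_scale complex_vector.span_base)
      finally show ?thesis .
    qed
    with fin infinite_dim show False
      by blast
  qed
  \<comment> \<open>Distinct members of M have distance sqrt 2, so points of the dense set within
    1/2 of them are distinct.\<close>
  have "countable M"
  proof -
    obtain D :: "'h set" where D: "countable D" "closure D = UNIV"
      using separable by blast
    have "\<exists>d\<in>D. dist d x < 1/2" for x
      using closure_approachable[THEN iffD1, rule_format, of x D "1/2"] D(2) by auto
    then obtain d where d: "\<And>x. d x \<in> D" "\<And>x. dist (d x) x < 1/2"
      by metis
    have "inj_on d M"
    proof (rule inj_onI, rule ccontr)
      fix x y
      assume xy: "x \<in> M" "y \<in> M" "d x = d y" "x \<noteq> y"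
      have "(norm (x - y))\<^sup>2 = 2"
        using xy by (subst norm_diff_orth) (auto simp: Mcin Mnorm)
      moreover have "norm (x - y) < 1"
        using d(2)[of x] d(2)[of y] xy(3) dist_triangle_half_r[of "d x" x 1 y]
        by (simp add: dist_norm)
      then have "(norm (x - y))\<^sup>2 \<le> 1"
        by (simp add: power_le_one)
      ultimately show False
        by simp
    qed
    moreover have "countable (d ` M)"
      by (rule countable_subset[OF _ D(1)]) (use d(1) in auto)
    ultimately show ?thesis
      by (rule countable_image_inj_on[rotated])
  qed
  with \<open>infinite M\<close> have bij: "bij_betw (from_nat_into M) UNIV M"
    by (simp add: bij_betw_from_nat_into)
  let ?e = "from_nat_into M"
  have inj: "inj ?e" and range: "range ?e = M"
    using bij by (auto simp: bij_betw_def)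
  have eM: "?e n \<in> M" for n
    using range by blast
  have on: "orthonormal ?e"
    unfolding orthonormal_def by (simp add: Mcin eM inj_eq[OF inj])
  have "v \<in> closure (complex_vector.span (range ?e))" for v
  proof -
    note os = orthonormal_imp_orthosys[OF on]
    have one: "\<forall>n::nat. \<bar>1::real\<bar> \<le> 1"
      by simp
    let ?P = "schmidt (\<lambda>_. 1) ?e ?e"
    have "cinner (v - blinfun_apply ?P v) (?e n) = 0" for n
      using schmidt_cinner_range[OF os os one, of v n] by (simp add: cinner_diff orthonormal_norm[OF on])
    then have "v - blinfun_apply ?P v = 0"
      by (intro maxortho) (metis range rangeE cinner_eq_0_commute)
    then have "(\<lambda>N. \<Sum>n<N. cinner v (?e n) *\<^sub>C ?e n) \<longlonglongrightarrow> v"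
      using schmidt_sums[OF os os one, of v] by (simp add: sums_def)
    moreover have "(\<Sum>n<N. cinner v (?e n) *\<^sub>C ?e n) \<in> complex_vector.span (range ?e)" for N
      by (intro complex_vector.span_sum complex_vector.span_scale complex_vector.span_base) auto
    ultimately show ?thesis
      by (auto simp: closure_sequential intro!: exI[of _ "\<lambda>N. \<Sum>n<N. cinner v (?e n) *\<^sub>C ?e n"])
  qed
  with on show ?thesis
    by (auto simp: orthonormal_basis_alt)
qed

lemma orthonormal_basis_std_basis:
  assumes "\<exists>D :: 'h::complex_hilbert set. countable D \<and> closure D = UNIV"
    and "\<not> (\<exists>B :: 'h set. finite B \<and> complex_vector.span B = UNIV)"
  shows "orthonormal_basis (std_basis :: nat \<Rightarrow> 'h)"
  unfolding std_basis_def using someI_ex[OF ex_orthonormal_basis[OF assms]] .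

section \<open>Schmidt decomposition of compact operators\<close>

text \<open>Gaussian elimination: an equation with a nonzero coefficient at p is solved for the
  unknown p and substituted into the others, which removes one equation and one unknown.\<close>

lemma underdetermined_system:
  fixes a :: "'i \<Rightarrow> 'j \<Rightarrow> 'a::field"
  assumes "finite I" "finite J" "card I < card J"
  shows "\<exists>c. (\<exists>j\<in>J. c j \<noteq> 0) \<and> (\<forall>i\<in>I. (\<Sum>j\<in>J. a i j * c j) = 0)"
  using assms
proof (induction I arbitrary: J a rule: finite_induct)
  case empty
  then have "J \<noteq> {}"
    by auto
  then show ?case
    by (intro exI[of _ "\<lambda>_. 1"]) auto
next
  case (insert i0 I)
  show ?case
  proof (cases "\<forall>j\<in>J. a i0 j = 0")
    case True
    obtain c where c: "\<exists>j\<in>J. c j \<noteq> 0" "\<forall>i\<in>I. (\<Sum>j\<in>J. a i j * c j) = 0"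
      using insert.IH[of J a] insert.prems insert.hyps by auto
    with True show ?thesis
      by (intro exI[of _ c]) auto
  next
    case False
    then obtain p where p: "p \<in> J" "a i0 p \<noteq> 0"
      by blast
    define J' where "J' = J - {p}"
    have J: "J = insert p J'" "p \<notin> J'" "finite J'"
      using p insert.prems by (auto simp: J'_def)
    have "card I < card J'"
      using insert.prems insert.hyps J by simp
    then obtain c where c: "\<exists>j\<in>J'. c j \<noteq> 0"
        "\<forall>i\<in>I. (\<Sum>j\<in>J'. (a i j - a i p * a i0 j / a i0 p) * c j) = 0"
      using insert.IH[of J' "\<lambda>i j. a i j - a i p * a i0 j / a i0 p"] J by auto
    \<comment> \<open>The value at p is the one that equation i0 dictates.\<close>
    define d where "d = (\<lambda>j. if j = p then - (\<Sum>j\<in>J'. a i0 j * c j) / a i0 p else c j)"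
    have sum: "(\<Sum>j\<in>J. a i j * d j) = (\<Sum>j\<in>J'. a i j * c j) - a i p * (\<Sum>j\<in>J'. a i0 j * c j) / a i0 p" for i
    proof -
      have "(\<Sum>j\<in>J'. a i j * d j) = (\<Sum>j\<in>J'. a i j * c j)"
        using J(2) by (intro sum.cong) (auto simp: d_def)
      then show ?thesis
        unfolding J(1) using J(2,3) by (simp add: d_def)
    qed
    have "(\<Sum>j\<in>J. a i j * d j) = 0" if "i \<in> insert i0 I" for i
    proof (cases "i = i0")
      case True
      then show ?thesis
        using p(2) by (simp add: sum)
    next
      case False
      then have "(\<Sum>j\<in>J'. (a i j - a i p * a i0 j / a i0 p) * c j) = 0"
        using that c(2) by blast
      then show ?thesis
        by (simp add: sum left_diff_distrib sum_subtractf sum_distrib_left sum_divide_distrib mult.assoc)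
    qed
    moreover have "\<exists>j\<in>J. d j \<noteq> 0"
      using c(1) J by (auto simp: d_def)
    ultimately show ?thesis
      by blast
  qed
qed

text \<open>There are n + 1 free coefficients and n linear conditions. With B the identity this
  yields unit vectors in the complement of n given vectors; with general B it is the dimension count
  behind the min-max estimate for singular values.\<close>

lemma ex_unit_combination_orthogonal:
  assumes u: "orthonormal u" and B: "B \<in> BH"
  shows "\<exists>c v. v = (\<Sum>j\<le>n. c j *\<^sub>C u j) \<and> norm v = 1 \<and>
    (\<forall>i<n. cinner (blinfun_apply B v) (h i) = 0)"
proof -
  obtain c where c: "\<exists>j\<le>n. c j \<noteq> 0"
      "\<forall>i<n. (\<Sum>j\<le>n. cinner (blinfun_apply B (u j)) (h i) * c j) = 0"
    using underdetermined_system[of "{..<n}" "{..n}" "\<lambda>i j. cinner (blinfun_apply B (u j)) (h i)"]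
    by auto
  define w where "w = (\<Sum>j\<le>n. c j *\<^sub>C u j)"
  have orth: "cinner (blinfun_apply B w) (h i) = 0" if "i < n" for i
    using c(2) that
    by (simp add: w_def blinfun.sum_right BH_scaleC[OF B] cinner_sum_left cinner_scaleC_left mult.commute)
  obtain k where k: "k \<le> n" "c k \<noteq> 0"
    using c(1) by blast
  have "cinner w (u k) = c k"
    using k(1) by (simp add: w_def cinner_sum_left cinner_scaleC_left orthonormal_cinner[OF u]
        if_distrib sum.delta cong: if_cong)
  then have w: "w \<noteq> 0"
    using k(2) by auto
  define r where "r = 1 / norm w"
  have "r *\<^sub>R w = (\<Sum>j\<le>n. (of_real r * c j) *\<^sub>C u j)"
    unfolding w_def scaleR_sum_right scaleC_scaleC[symmetric] scaleC_of_real ..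
  moreover have "norm (r *\<^sub>R w) = 1" "\<forall>i<n. cinner (blinfun_apply B (r *\<^sub>R w)) (h i) = 0"
    using w orth by (auto simp: blinfun.scaleR_right cinner_scaleR_left r_def)
  ultimately show ?thesis
    by (intro exI conjI)
qed

section \<open>Compactness and extremal vectors\<close>

lemma compact_ops_BH: "X \<in> compact_ops \<Longrightarrow> X \<in> BH"
  by (simp add: compact_ops_def)

lemma compact_ops_subseq:
  assumes "X \<in> compact_ops" "\<forall>n::nat. norm (v n) \<le> 1"
  shows "\<exists>r l. strict_mono r \<and> (\<lambda>n. blinfun_apply X (v (r n))) \<longlonglongrightarrow> l"
proof -
  have "seq_compact (closure (blinfun_apply X ` cball 0 1))"
    using assms(1) by (simp add: compact_ops_def compact_eq_seq_compact_metric)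
  moreover have "blinfun_apply X (v n) \<in> closure (blinfun_apply X ` cball 0 1)" for n
    using closure_subset assms(2) by fastforce
  ultimately show ?thesis
    using seq_compactE[of _ "\<lambda>n. blinfun_apply X (v n)"] unfolding comp_def by metis
qed

text \<open>Orthogonal images of norm at least c are at least c times sqrt 2 apart, so no
  subsequence of them could be Cauchy.\<close>

lemma compact_ops_orthogonal_images:
  assumes X: "X \<in> compact_ops" and v: "\<forall>n::nat. norm (v n) \<le> 1" and "c > 0"
    and orth: "\<And>m n. m \<noteq> n \<Longrightarrow> cinner (blinfun_apply X (v m)) (blinfun_apply X (v n)) = 0"
  shows "\<exists>n. norm (blinfun_apply X (v n)) < c"
proof (rule ccontr)
  assume "\<not> ?thesis"
  then have ge: "c \<le> norm (blinfun_apply X (v n))" for n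
    by (auto simp: not_less)
  obtain r l where r: "strict_mono r" "(\<lambda>n. blinfun_apply X (v (r n))) \<longlonglongrightarrow> l"
    using compact_ops_subseq[OF X v] by blast
  then have "Cauchy (\<lambda>n. blinfun_apply X (v (r n)))"
    by (auto intro: LIMSEQ_imp_Cauchy)
  then obtain N where N: "\<And>m n. m \<ge> N \<Longrightarrow> n \<ge> N \<Longrightarrow>
      norm (blinfun_apply X (v (r m)) - blinfun_apply X (v (r n))) < c"
    using \<open>c > 0\<close> unfolding Cauchy_iff by blast
  have "r N \<noteq> r (Suc N)"
    using strict_monoD[OF r(1), of N "Suc N"] by simp
  then have "(norm (blinfun_apply X (v (r N)) - blinfun_apply X (v (r (Suc N)))))\<^sup>2 \<ge> c\<^sup>2 + c\<^sup>2"
    unfolding norm_diff_orth[OF orth[OF \<open>r N \<noteq> r (Suc N)\<close>]]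
    using \<open>c > 0\<close> ge by (intro add_mono power_mono) auto
  moreover have "(norm (blinfun_apply X (v (r N)) - blinfun_apply X (v (r (Suc N)))))\<^sup>2 < c\<^sup>2"
    using N[of N "Suc N"] by (intro power_strict_mono) auto
  ultimately show False
    by (smt (verit) zero_le_power2)
qed

text \<open>By the parallelogram law, a maximising sequence whose images converge is itself Cauchy.\<close>

lemma compact_ops_attains_norm:
  fixes X :: "'h::complex_hilbert \<Rightarrow>\<^sub>L 'h"
  assumes X: "X \<in> compact_ops" and M: "closed M" "complex_vector.subspace M"
    and u: "u \<in> M" "norm u = 1"
  shows "\<exists>v\<in>M. norm v = 1 \<and> (\<forall>w\<in>M. norm (blinfun_apply X w) \<le> norm (blinfun_apply X v) * norm w)"
proof -
  let ?S = "(\<lambda>w. norm (blinfun_apply X w)) ` {w \<in> M. norm w = 1}"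
  define s where "s = Sup ?S"
  have bdd: "bdd_above ?S"
    by (rule bdd_aboveI2[of _ _ "norm X"]) (use norm_blinfun[of X] in \<open>metis (mono_tags, lifting) mem_Collect_eq mult.right_neutral\<close>)
  have ne: "?S \<noteq> {}"
    using u by auto
  have unit: "norm (blinfun_apply X w) \<le> s" if "w \<in> M" "norm w = 1" for w
    unfolding s_def by (rule cSup_upper[OF _ bdd]) (use that in auto)
  have le: "norm (blinfun_apply X w) \<le> s * norm w" if "w \<in> M" for w
  proof (cases "w = 0")
    case False
    have "of_real (1 / norm w) *\<^sub>C w \<in> M"
      using M(2) that by (rule complex_vector.subspace_scale)
    then have "norm (blinfun_apply X ((1 / norm w) *\<^sub>R w)) \<le> s"
      using False by (intro unit) (simp_all add: scaleC_of_real del: of_real_divide of_real_1)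
    then show ?thesis
      using False by (simp add: blinfun.scaleR_right field_simps)
  qed (simp add: blinfun.zero_right)
  have s0: "0 \<le> s"
    using unit[OF u] norm_ge_zero order_trans by blast
  have "\<exists>v\<in>M. norm v = 1 \<and> norm (blinfun_apply X v) = s"
  proof (cases "s = 0")
    case True
    then show ?thesis
      using u unit[OF u] by (intro bexI[of _ u]) auto
  next
    case False
    then have s: "s > 0"
      using s0 by simp
    have "\<exists>w\<in>M. norm w = 1 \<and> s - 1 / real (Suc n) < norm (blinfun_apply X w)" for n
      using less_cSup_iff[OF ne bdd, of "s - 1 / real (Suc n)"] by (auto simp: s_def[symmetric])
    then obtain w where w: "\<And>n. w n \<in> M" "\<And>n. norm (w n) = 1"
        "\<And>n. s - 1 / real (Suc n) < norm (blinfun_apply X (w n))"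
      by metis
    obtain r l where r: "strict_mono r" and l: "(\<lambda>n. blinfun_apply X (w (r n))) \<longlonglongrightarrow> l"
      using compact_ops_subseq[OF X, of w] w(2) by auto
    have lim: "(\<lambda>n. norm (blinfun_apply X (w n))) \<longlonglongrightarrow> s"
    proof (rule tendsto_sandwich[of "\<lambda>n. s - 1 / real (Suc n)" _ _ "\<lambda>_. s"])
      show "(\<lambda>n. s - 1 / real (Suc n)) \<longlonglongrightarrow> s"
        using tendsto_diff[OF tendsto_const[of s] LIMSEQ_inverse_real_of_nat] by (simp add: inverse_eq_divide)
    qed (use w unit in \<open>auto intro!: always_eventually less_imp_le\<close>)
    have "norm l = s"
      by (rule LIMSEQ_unique[OF tendsto_norm[OF l]]) (use LIMSEQ_subseq_LIMSEQ[OF lim r] in \<open>simp add: comp_def\<close>)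
    have "Cauchy (\<lambda>n. w (r n))"
      unfolding Cauchy_iff
    proof (intro allI impI)
      fix \<epsilon> :: real
      assume \<epsilon>: "\<epsilon> > 0"
      \<comment> \<open>From \<open>4 * s\<^sup>2 - (2 * (s - \<delta>))\<^sup>2\<close>, which is
        at most \<open>8 * (s * \<delta>)\<close>, the second bound makes half of
        \<open>s\<^sup>2 * \<epsilon>\<^sup>2\<close>. The first keeps \<open>s - \<delta>\<close>
        nonnegative, so that squaring is monotone.\<close>
      define \<delta> where "\<delta> = min s (s * \<epsilon>\<^sup>2 / 16)"
      have \<delta>: "\<delta> > 0" "\<delta> \<le> s" "\<delta> \<le> s * \<epsilon>\<^sup>2 / 16"
        using s \<epsilon> by (auto simp: \<delta>_def)
      obtain N where N: "\<And>n. n \<ge> N \<Longrightarrow> norm (blinfun_apply X (w (r n)) - l) < \<delta>"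
        using LIMSEQ_D[OF l \<delta>(1)] by blast
      show "\<exists>N. \<forall>m\<ge>N. \<forall>n\<ge>N. norm (w (r m) - w (r n)) < \<epsilon>"
      proof (intro exI[of _ N] allI impI)
        fix m n
        assume mn: "N \<le> m" "N \<le> n"
        let ?a = "w (r m)" and ?b = "w (r n)"
        \<comment> \<open>Both images are near l, so their sum has norm near 2 s. As X stretches by
          at most s on M, the sum of the two unit vectors has norm near 2 and their difference is
          small.\<close>
        have "2 * s = norm ((blinfun_apply X ?a + blinfun_apply X ?b) -
            ((blinfun_apply X ?a - l) + (blinfun_apply X ?b - l)))"
          using \<open>norm l = s\<close> by (simp add: scaleR_2[symmetric])
        also have "\<dots> \<le> norm (blinfun_apply X ?a + blinfun_apply X ?b) + (\<delta> + \<delta>)"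
          using N[OF mn(1)] N[OF mn(2)]
            norm_triangle_ineq4[of "blinfun_apply X ?a + blinfun_apply X ?b"
              "(blinfun_apply X ?a - l) + (blinfun_apply X ?b - l)"]
            norm_triangle_ineq[of "blinfun_apply X ?a - l" "blinfun_apply X ?b - l"] by linarith
        finally have "2 * (s - \<delta>) \<le> norm (blinfun_apply X (?a + ?b))"
          by (simp add: blinfun.add_right)
        also have "\<dots> \<le> s * norm (?a + ?b)"
          by (intro le complex_vector.subspace_add[OF M(2)] w)
        finally have "(2 * (s - \<delta>))\<^sup>2 \<le> (s * norm (?a + ?b))\<^sup>2"
          using \<delta> by (intro power_mono) auto
        then have "s\<^sup>2 * (norm (?a - ?b))\<^sup>2 \<le> 4 * s\<^sup>2 - (2 * (s - \<delta>))\<^sup>2"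
          by (simp add: parallelogram w(2) power_mult_distrib algebra_simps)
        also have "\<dots> \<le> 8 * (s * \<delta>)"
          by (simp add: power2_eq_square algebra_simps)
        also have "\<dots> \<le> 8 * (s * (s * \<epsilon>\<^sup>2 / 16))"
          using \<delta>(3) s by (intro mult_left_mono) auto
        also have "\<dots> < s\<^sup>2 * \<epsilon>\<^sup>2"
          using s \<epsilon> by (simp add: power2_eq_square)
        finally have "(norm (?a - ?b))\<^sup>2 < \<epsilon>\<^sup>2"
          using s by simp
        then show "norm (?a - ?b) < \<epsilon>"
          by (rule power2_less_imp_less) (use \<epsilon> in simp)
      qed
    qed
    then obtain v where v: "(\<lambda>n. w (r n)) \<longlonglongrightarrow> v"
      using Cauchy_convergent convergent_def by blast
    have "v \<in> M"
      by (rule closed_sequentially[OF M(1) _ v]) (use w in auto)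
    moreover have "norm v = 1"
      by (rule LIMSEQ_unique[OF tendsto_norm[OF v]]) (simp add: w)
    moreover have "blinfun_apply X v = l"
      by (rule LIMSEQ_unique[OF _ l]) (intro tendsto_intros v)
    ultimately show ?thesis
      using \<open>norm l = s\<close> by blast
  qed
  then show ?thesis
    using le by auto
qed

text \<open>The first variation of \<open>\<parallel>X w\<parallel> / \<parallel>w\<parallel>\<close> vanishes at a maximiser.\<close>

lemma attained_norm_orthogonal:
  assumes X: "X \<in> BH" and v: "norm v = 1" and uv: "cinner v u = 0"
    and max: "\<And>c. norm (blinfun_apply X (v + c *\<^sub>C u)) \<le> norm (blinfun_apply X v) * norm (v + c *\<^sub>C u)"
  shows "cinner (blinfun_apply X v) (blinfun_apply X u) = 0"
proof (rule ccontr)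
  let ?z = "cinner (blinfun_apply X v) (blinfun_apply X u)"
  assume z: "?z \<noteq> 0"
  define S where "S = (norm (blinfun_apply X v))\<^sup>2"
  \<comment> \<open>The perturbation \<open>v + c *\<^sub>C u\<close> uses c = \<epsilon> z: the
    phase of z makes the first order gain real and positive, and this \<epsilon> keeps the second
    order term below it.\<close>
  define \<epsilon> where "\<epsilon> = 1 / (1 + S * (norm u)\<^sup>2)"
  have S: "S \<ge> 0"
    by (simp add: S_def)
  then have pos: "1 + S * (norm u)\<^sup>2 > 0"
    by (smt (verit) mult_nonneg_nonneg zero_le_power2)
  then have \<epsilon>: "\<epsilon> > 0"
    by (simp add: \<epsilon>_def)
  let ?c = "of_real \<epsilon> * ?z"
  have "(norm (blinfun_apply X (v + ?c *\<^sub>C u)))\<^sup>2 \<le> S * (norm (v + ?c *\<^sub>C u))\<^sup>2"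
    unfolding S_def power_mult_distrib[symmetric] by (intro power_mono max) simp
  also have "(norm (v + ?c *\<^sub>C u))\<^sup>2 = 1 + (\<epsilon> * cmod ?z)\<^sup>2 * (norm u)\<^sup>2"
    using uv \<epsilon> v by (simp add: norm_add_orth cinner_scaleC_right norm_mult power_mult_distrib)
  also have "(norm (blinfun_apply X (v + ?c *\<^sub>C u)))\<^sup>2 =
      S + (\<epsilon> * cmod ?z)\<^sup>2 * (norm (blinfun_apply X u))\<^sup>2 + 2 * (\<epsilon> * (cmod ?z)\<^sup>2)"
  proof -
    have "cnj ?c * ?z = of_real (\<epsilon> * (cmod ?z)\<^sup>2)"
      by (simp add: mult.assoc complex_norm_square mult.commute[of "cnj ?z"] del: of_real_power)
    then have "Re (cnj ?c * ?z) = \<epsilon> * (cmod ?z)\<^sup>2"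
      by (metis Re_complex_of_real)
    then show ?thesis
      using \<epsilon> by (simp add: blinfun.add_right BH_scaleC[OF X] norm_add_square cinner_scaleC_right
          S_def norm_mult power_mult_distrib)
  qed
  finally have "2 * (\<epsilon> * (cmod ?z)\<^sup>2) \<le> S * ((\<epsilon> * cmod ?z)\<^sup>2 * (norm u)\<^sup>2)"
    by (simp add: distrib_left) (smt (verit) mult_nonneg_nonneg zero_le_power2)
  then have "(\<epsilon> * (cmod ?z)\<^sup>2) * 2 \<le> (\<epsilon> * (cmod ?z)\<^sup>2) * (\<epsilon> * (S * (norm u)\<^sup>2))"
    by (simp add: power2_eq_square algebra_simps)
  then have "2 \<le> \<epsilon> * (S * (norm u)\<^sup>2)"
    using \<epsilon> z by simp
  also have "\<dots> \<le> 1"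
    using pos by (simp add: \<epsilon>_def)
  finally show False
    by simp
qed

text \<open>Choose \<open>f n\<close> greedily as a unit maximiser of the norm of X on the
  complement of its predecessors. The sequence u guarantees that this complement always contains
  unit vectors, so the choice continues even when X vanishes there.\<close>

lemma compact_ops_schmidt:
  fixes X :: "'h::complex_hilbert \<Rightarrow>\<^sub>L 'h"
  assumes X: "X \<in> compact_ops" and u: "orthonormal (u :: nat \<Rightarrow> 'h)"
  shows "\<exists>s f g. s \<in> c0_star \<and> orthonormal f \<and> orthosys g \<and> (\<forall>n. s n > 0 \<longrightarrow> norm (g n) = 1) \<and>
    X = schmidt s f g"
proof -
  note XB = compact_ops_BH[OF X]
  define P where "P f n v \<longleftrightarrow> norm v = 1 \<and> (\<forall>i<n. cinner v (f i) = 0) \<and>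
      (\<forall>w. (\<forall>i<n. cinner w (f i) = 0) \<longrightarrow>
        norm (blinfun_apply X w) \<le> norm (blinfun_apply X v) * norm w)" for f :: "nat \<Rightarrow> 'h" and n :: nat and v
  have "\<exists>f. \<forall>n. P f n (f n)"
  proof (rule dependent_wellorder_choice)
    show "P f n r = P g n r" if "\<And>m. m < n \<Longrightarrow> f m = g m" for r f g n
      using that by (simp add: P_def)
    show "\<exists>r. P f n r" for n f
    proof -
      let ?M = "\<Inter>i<n. {v. cinner v (f i) = 0}"
      obtain v where "norm v = 1" "\<forall>i<n. cinner v (f i) = 0"
        using ex_unit_combination_orthogonal[OF u BH_id, of n f] by auto
      moreover have "closed ?M"
        by (intro closed_INT ballI closed_Collect_eq linear_continuous_on bounded_linear_cinner_left
            continuous_on_const)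
      moreover have "complex_vector.subspace ?M"
        by (rule complex_vector.subspaceI) (auto simp: cinner_add_left cinner_scaleC_left)
      ultimately obtain v where "v \<in> ?M" "norm v = 1"
          "\<forall>w\<in>?M. norm (blinfun_apply X w) \<le> norm (blinfun_apply X v) * norm w"
        using compact_ops_attains_norm[OF X, of ?M v] by auto
      then show ?thesis
        unfolding P_def by (intro exI[of _ v]) auto
    qed
  qed
  then obtain f :: "nat \<Rightarrow> 'h" where f1: "\<And>n. norm (f n) = 1" and f0: "\<And>n i. i < n \<Longrightarrow> cinner (f n) (f i) = 0"
    and fmax: "\<And>n w. (\<And>i. i < n \<Longrightarrow> cinner w (f i) = 0) \<Longrightarrow>
      norm (blinfun_apply X w) \<le> norm (blinfun_apply X (f n)) * norm w"
    unfolding P_def by blast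
  have f: "orthonormal f"
    unfolding orthonormal_def
  proof (intro allI)
    fix m n
    show "cinner (f m) (f n) = (if m = n then 1 else 0)"
      using f0[of m n] f0[of n m] f1[of m] cinner_eq_0_commute[of "f m" "f n"]
      by (cases m n rule: linorder_cases) (auto simp: cinner_self)
  qed
  note of = orthonormal_imp_orthosys[OF f]
  define s where "s n = norm (blinfun_apply X (f n))" for n
  have orthX: "cinner (blinfun_apply X (f m)) (blinfun_apply X (f n)) = 0" if "m < n" for m n
  proof (rule attained_norm_orthogonal[OF XB f1])
    show "cinner (f m) (f n) = 0"
      using that by (simp add: orthonormal_cinner[OF f])
    show "norm (blinfun_apply X (f m + c *\<^sub>C f n)) \<le>
        norm (blinfun_apply X (f m)) * norm (f m + c *\<^sub>C f n)" for c
      using that by (intro fmax) (simp add: cinner_add_left cinner_scaleC_left orthonormal_cinner[OF f])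
  qed
  have orthX: "cinner (blinfun_apply X (f m)) (blinfun_apply X (f n)) = 0" if "m \<noteq> n" for m n
    using that orthX[of m n] orthX[of n m]
      cinner_eq_0_commute[of "blinfun_apply X (f m)" "blinfun_apply X (f n)"]
    by (cases m n rule: linorder_cases) auto
  have dec: "s (Suc n) \<le> s n" for n
    using fmax[of n "f (Suc n)"] f0[of _ "Suc n"] by (simp add: s_def f1)
  then have "decseq s"
    by (rule decseq_SucI)
  have "s \<longlonglongrightarrow> 0"
  proof (rule LIMSEQ_I)
    fix t :: real
    assume "t > 0"
    then obtain N where "s N < t"
      using compact_ops_orthogonal_images[of X f, OF X _ _ orthX] f1 unfolding s_def by auto
    then show "\<exists>N. \<forall>n\<ge>N. norm (s n - 0) < t"
      using decseqD[OF \<open>decseq s\<close>] by (intro exI[of _ N]) (fastforce simp: s_def)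
  qed
  then have s: "s \<in> c0_star"
    using dec by (intro c0_starI) (auto simp: s_def)
  \<comment> \<open>Division by zero makes \<open>g n\<close> the zero vector when
    \<open>s n = 0\<close>; this is why g is an \<open>orthosys\<close> and not orthonormal.\<close>
  define g where "g n = (1 / s n) *\<^sub>R blinfun_apply X (f n)" for n
  have sg: "s n *\<^sub>R g n = blinfun_apply X (f n)" for n
    by (cases "s n = 0") (auto simp: g_def s_def)
  have g1: "norm (g n) = 1" if "s n > 0" for n
    using that by (simp add: g_def s_def)
  have g: "orthosys g"
    unfolding orthosys_def
    by (auto simp: g_def cinner_scaleR_left cinner_scaleR_right orthX s_def)
  have "X = schmidt s f g"
  proof (rule blinfun_eqI)
    fix v
    have one: "\<forall>n::nat. \<bar>1::real\<bar> \<le> 1"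
      by simp
    \<comment> \<open>The part of v orthogonal to every \<open>f n\<close> competes in all the
      maximisations, so its image is bounded by \<open>s n * norm w\<close> for every n and is
      therefore 0.\<close>
    let ?w = "v - blinfun_apply (schmidt (\<lambda>_. 1) f f) v"
    have "cinner ?w (f n) = 0" for n
      using schmidt_cinner_range[OF of of one, of v n] by (simp add: cinner_diff f1)
    then have "norm (blinfun_apply X ?w) \<le> s n * norm ?w" for n
      unfolding s_def by (intro fmax) simp
    moreover have "(\<lambda>n. s n * norm ?w) \<longlonglongrightarrow> 0"
      using tendsto_mult_left_zero[OF \<open>s \<longlonglongrightarrow> 0\<close>] .
    ultimately have "norm (blinfun_apply X ?w) \<le> 0"
      by (intro LIMSEQ_le_const[of _ 0]) auto
    then have "blinfun_apply X v = blinfun_apply X (blinfun_apply (schmidt (\<lambda>_. 1) f f) v)"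
      by (simp add: blinfun.diff_right)
    moreover have "(\<lambda>n. s n *\<^sub>R (cinner v (f n) *\<^sub>C g n)) sums
        blinfun_apply X (blinfun_apply (schmidt (\<lambda>_. 1) f f) v)"
      using bounded_linear.sums[OF blinfun.bounded_linear_right schmidt_sums[OF of of one], of X v]
      by (simp add: BH_scaleC[OF XB] scaleC_scaleR_commute[symmetric] sg)
    ultimately show "blinfun_apply X v = blinfun_apply (schmidt s f g) v"
      using schmidt_sums[OF of g c0_star_abs_le[OF s], of v] by (simp add: sums_unique2)
  qed
  with s f g g1 show ?thesis
    by blast
qed

text \<open>The singular values of a rank one projection. They belong to every nonzero ideal, serve
  to test matrix entries against the norm, and keep majorants nonzero.\<close>

definition \<delta>0 :: "nat \<Rightarrow> real" where
  "\<delta>0 n = (if n = 0 then 1 else 0)"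

lemma \<delta>0_c0: "\<delta>0 \<in> c0_star"
proof (rule c0_starI)
  show "\<delta>0 \<longlonglongrightarrow> 0"
    by (rule Lim_transform_eventually[OF tendsto_const])
      (auto simp: \<delta>0_def eventually_sequentially intro: exI[of _ 1])
qed (auto simp: \<delta>0_def)

section \<open>Diagonal operators and the ideals containing them\<close>

lemma ampliation_two_c0_star:
  assumes x: "\<xi> \<in> c0_star"
  shows "ampliation 2 \<xi> \<in> c0_star"
proof (rule c0_starI)
  show "0 \<le> ampliation 2 \<xi> n" for n
    by (simp add: ampliation_def c0_star_nonneg[OF x])
  show "ampliation 2 \<xi> (Suc n) \<le> ampliation 2 \<xi> n" for n
    unfolding ampliation_def by (intro c0_star_antimono[OF x] div_le_mono) simp
  have "filterlim (\<lambda>n::nat. n div 2) at_top sequentially"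
    by (rule filterlim_at_top_div_const_nat) simp
  then show "ampliation 2 \<xi> \<longlonglongrightarrow> 0"
    unfolding ampliation_def using x by (auto simp: c0_star_def intro: filterlim_compose)
qed

section \<open>Closure properties of operator ideals\<close>

lemma op_ideal_compact: "op_ideal I \<Longrightarrow> X \<in> I \<Longrightarrow> X \<in> compact_ops"
  by (auto simp: op_ideal_def)

lemma op_ideal_sandwich: "op_ideal I \<Longrightarrow> X \<in> I \<Longrightarrow> A \<in> BH \<Longrightarrow> B \<in> BH \<Longrightarrow> A o\<^sub>L X o\<^sub>L B \<in> I"
  by (simp add: op_ideal_def)

lemma op_ideal_add: "op_ideal I \<Longrightarrow> X \<in> I \<Longrightarrow> Y \<in> I \<Longrightarrow> X + Y \<in> I"
  by (simp add: op_ideal_def)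

lemma op_ideal_scaleR: "op_ideal I \<Longrightarrow> X \<in> I \<Longrightarrow> r *\<^sub>R X \<in> I"
  unfolding scalar_op_of_real[symmetric] by (simp add: op_ideal_def scalar_op_BH)

lemma op_ideal_sum: "op_ideal I \<Longrightarrow> (\<And>k. k \<in> A \<Longrightarrow> X k \<in> I) \<Longrightarrow> (\<Sum>k\<in>A. X k) \<in> I"
  by (induction A rule: infinite_finite_induct) (auto simp: op_ideal_add, simp_all add: op_ideal_def)

text \<open>The ambient ideal I is one of the sets in the intersection, so the intersection consists
  of compact operators.\<close>

lemma
  assumes "op_ideal I" "X \<in> I"
  shows op_ideal_ideal_gen: "op_ideal (ideal_gen X)"
    and ideal_gen_subset: "ideal_gen X \<subseteq> I"
    and ideal_gen_self: "X \<in> ideal_gen X"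
proof -
  show sub: "ideal_gen X \<subseteq> I"
    using assms by (auto simp: ideal_gen_def)
  show "X \<in> ideal_gen X"
    by (simp add: ideal_gen_def)
  have "ideal_gen X \<subseteq> compact_ops"
    using sub op_ideal_compact[OF assms(1)] by blast
  then show "op_ideal (ideal_gen X)"
    unfolding op_ideal_def by (auto simp: ideal_gen_def op_ideal_def)
qed

locale std_hilbert =
  fixes e :: "nat \<Rightarrow> 'h::complex_hilbert"
  assumes e_std: "e = std_basis" and basis: "orthonormal_basis e"
begin

section \<open>Diagonal operators in the fixed basis\<close>

lemma e_on: "orthonormal e"
  using basis by (simp add: orthonormal_basis_alt)

lemma e_os: "orthosys e"
  by (rule orthonormal_imp_orthosys[OF e_on])

lemma norm_e [simp]: "norm (e n) = 1"
  by (rule orthonormal_norm[OF e_on])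

lemma cinner_e: "cinner (e m) (e n) = (if m = n then 1 else 0)"
  by (rule orthonormal_cinner[OF e_on])

abbreviation D :: "(nat \<Rightarrow> real) \<Rightarrow> ('h \<Rightarrow>\<^sub>L 'h)" where
  "D \<equiv> diag"

lemma D_schmidt: "D a = schmidt a e e"
  by (simp add: diag_eq_schmidt e_std)

lemma D_e: "\<forall>n. \<bar>a n\<bar> \<le> K \<Longrightarrow> blinfun_apply (D a) (e m) = a m *\<^sub>R e m"
  using schmidt_domain[OF e_os e_os, of a K m] by (simp add: D_schmidt)

lemma D_BH: "\<forall>n. \<bar>a n\<bar> \<le> K \<Longrightarrow> D a \<in> BH"
  unfolding D_schmidt by (rule schmidt_BH[OF e_os e_os])

lemma D_norm: "\<forall>n. \<bar>a n\<bar> \<le> K \<Longrightarrow> norm (D a) \<le> K"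
  unfolding D_schmidt by (rule schmidt_norm_le[OF e_os e_os])

lemma eq_D_iff:
  assumes "A \<in> BH" "\<forall>n. \<bar>a n\<bar> \<le> K" "\<And>n. blinfun_apply A (e n) = a n *\<^sub>R e n"
  shows "A = D a"
  by (rule blinfun_eq_on_basis[OF basis assms(1) D_BH[OF assms(2)]]) (simp add: assms(3) D_e[OF assms(2)])

lemma D_mult:
  assumes "\<forall>n. \<bar>a n\<bar> \<le> K" "\<forall>n. \<bar>b n\<bar> \<le> K'"
  shows "D a o\<^sub>L D b = D (\<lambda>n. a n * b n)"
  unfolding D_schmidt by (rule schmidt_compose[OF e_os e_os e_os assms]) simp

lemma D_add:
  assumes "\<xi> \<in> c0_star" "\<eta> \<in> c0_star"
  shows "D (\<lambda>n. \<xi> n + \<eta> n) = D \<xi> + D \<eta>"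
proof (rule eq_D_iff[symmetric])
  note b = c0_star_abs_le[OF assms(1)] c0_star_abs_le[OF assms(2)]
  show "D \<xi> + D \<eta> \<in> BH"
    by (rule BH_add[OF D_BH[OF b(1)] D_BH[OF b(2)]])
  show "\<forall>n. \<bar>\<xi> n + \<eta> n\<bar> \<le> \<xi> 0 + \<eta> 0"
    using b by (auto intro: order_trans[OF abs_triangle_ineq] add_mono)
  show "blinfun_apply (D \<xi> + D \<eta>) (e n) = (\<xi> n + \<eta> n) *\<^sub>R e n" for n
    by (simp add: blinfun.add_left D_e[OF b(1)] D_e[OF b(2)] scaleR_add_left)
qed

lemma D_scale:
  assumes "\<xi> \<in> c0_star"
  shows "D (\<lambda>n. r * \<xi> n) = r *\<^sub>R D \<xi>"
proof (rule eq_D_iff[symmetric])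
  note b = c0_star_abs_le[OF assms]
  show "r *\<^sub>R D \<xi> \<in> BH"
    unfolding scalar_op_of_real[symmetric] by (rule BH_compose[OF scalar_op_BH D_BH[OF b]])
  show "\<forall>n. \<bar>r * \<xi> n\<bar> \<le> \<bar>r\<bar> * \<xi> 0"
    using b by (auto simp: abs_mult mult_left_mono)
  show "blinfun_apply (r *\<^sub>R D \<xi>) (e n) = (r * \<xi> n) *\<^sub>R e n" for n
    by (simp add: blinfun.scaleR_left D_e[OF b])
qed

text \<open>For injective \<phi> this is the isometry that moves \<open>e n\<close> to
  \<open>e (\<phi> n)\<close>. The operator \<open>W \<phi>\<close> below is its adjoint, which
  undoes the move and annihilates the basis vectors outside the range of \<phi>.\<close>

definition V :: "(nat \<Rightarrow> nat) \<Rightarrow> ('h \<Rightarrow>\<^sub>L 'h)" where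
  "V \<phi> = schmidt (\<lambda>_. 1) e (\<lambda>n. e (\<phi> n))"

definition W :: "(nat \<Rightarrow> nat) \<Rightarrow> ('h \<Rightarrow>\<^sub>L 'h)" where
  "W \<phi> = schmidt (\<lambda>_. 1) (\<lambda>n. e (\<phi> n)) e"

lemma one_bounded: "\<forall>n::nat. \<bar>1::real\<bar> \<le> 1"
  by simp

lemma e_comp_os: "inj \<phi> \<Longrightarrow> orthosys (\<lambda>n. e (\<phi> n))"
  by (rule orthonormal_imp_orthosys[OF orthonormal_comp[OF e_on]])

context
  fixes \<phi> :: "nat \<Rightarrow> nat"
  assumes \<phi>: "inj \<phi>"
begin

lemma V_BH: "V \<phi> \<in> BH"
  unfolding V_def by (rule schmidt_BH[OF e_os e_comp_os[OF \<phi>] one_bounded])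

lemma W_BH: "W \<phi> \<in> BH"
  unfolding W_def by (rule schmidt_BH[OF e_comp_os[OF \<phi>] e_os one_bounded])

lemma V_norm: "norm (V \<phi>) \<le> 1"
  unfolding V_def by (rule schmidt_norm_le[OF e_os e_comp_os[OF \<phi>] one_bounded])

lemma W_norm: "norm (W \<phi>) \<le> 1"
  unfolding W_def by (rule schmidt_norm_le[OF e_comp_os[OF \<phi>] e_os one_bounded])

lemma V_e: "blinfun_apply (V \<phi>) (e n) = e (\<phi> n)"
  using schmidt_domain[OF e_os e_comp_os[OF \<phi>] one_bounded, of n] by (simp add: V_def)

lemma W_e: "blinfun_apply (W \<phi>) (e (\<phi> n)) = e n"
  using schmidt_domain[OF e_comp_os[OF \<phi>] e_os one_bounded, of n] by (simp add: W_def)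

lemma W_e_zero:
  assumes "m \<notin> range \<phi>"
  shows "blinfun_apply (W \<phi>) (e m) = 0"
proof -
  have "m \<noteq> \<phi> n" for n
    using assms by blast
  then show ?thesis
    unfolding W_def schmidt_apply[OF e_comp_os[OF \<phi>] e_os one_bounded] by (simp add: cinner_e)
qed

lemma cinner_W_e: "cinner (blinfun_apply (W \<phi>) x) (e n) = cinner x (e (\<phi> n))"
  using schmidt_cinner_range[OF e_comp_os[OF \<phi>] e_os one_bounded, of x n] by (simp add: W_def)

end

text \<open>For i = 0 and i = 1 the ranges are the even and the odd indices: H is split into two
  copies of itself.\<close>

abbreviation dbl :: "nat \<Rightarrow> nat \<Rightarrow> nat" where
  "dbl i \<equiv> \<lambda>n. 2 * n + i"

lemma inj_dbl: "inj (dbl i)"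
  by (simp add: inj_def)

lemma W_dbl_e:
  assumes "i < 2"
  shows "blinfun_apply (W (dbl i)) (e m) = (if m mod 2 = i then e (m div 2) else 0)"
proof (cases "m mod 2 = i")
  case True
  then have "m = dbl i (m div 2)"
    using mult_div_mod_eq[of 2 m] by simp
  then show ?thesis
    using W_e[OF inj_dbl, of i "m div 2"] True by simp
next
  case False
  then have "m \<notin> range (dbl i)"
    using assms by auto
  then show ?thesis
    using W_e_zero[OF inj_dbl] False by simp
qed

text \<open>One copy of \<xi> is placed on the even and one on the odd indices; both give the entry
  \<open>\<xi> (n div 2)\<close> at n. Hence the sequences of any ideal are closed under
  D_2.\<close>

lemma D_ampliation:
  assumes "\<xi> \<in> c0_star"
  shows "D (ampliation 2 \<xi>) =
    (V (dbl 0) o\<^sub>L D \<xi> o\<^sub>L W (dbl 0)) + (V (dbl 1) o\<^sub>L D \<xi> o\<^sub>L W (dbl 1))"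
proof (rule eq_D_iff[symmetric])
  note b = c0_star_abs_le[OF assms]
  show "(V (dbl 0) o\<^sub>L D \<xi> o\<^sub>L W (dbl 0)) + (V (dbl 1) o\<^sub>L D \<xi> o\<^sub>L W (dbl 1)) \<in> BH"
    by (intro BH_add BH_compose V_BH W_BH D_BH[OF b] inj_dbl)
  show "\<forall>n. \<bar>ampliation 2 \<xi> n\<bar> \<le> \<xi> 0"
    using b by (simp add: ampliation_def)
  show "blinfun_apply ((V (dbl 0) o\<^sub>L D \<xi> o\<^sub>L W (dbl 0)) + (V (dbl 1) o\<^sub>L D \<xi> o\<^sub>L W (dbl 1))) (e n) =
      ampliation 2 \<xi> n *\<^sub>R e n" for n
  proof -
    have n: "n = dbl (n mod 2) (n div 2)"
      by simp
    have "n mod 2 = 0 \<or> n mod 2 = 1"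
      by auto
    then show ?thesis
    proof
      assume *: "n mod 2 = 0"
      then have "V (dbl 0) (e (n div 2)) = e n"
        using V_e[OF inj_dbl, of 0 "n div 2"] n by simp
      with * show ?thesis
        by (simp add: blinfun.add_left W_dbl_e[of 0, simplified] W_dbl_e[of 1, simplified] D_e[OF b]
            blinfun.zero_right blinfun.scaleR_right ampliation_def)
    next
      assume *: "n mod 2 = 1"
      then have "V (dbl 1) (e (n div 2)) = e n"
        using V_e[OF inj_dbl, of 1 "n div 2"] n by simp
      with * show ?thesis
        by (simp add: blinfun.add_left W_dbl_e[of 0, simplified] W_dbl_e[of 1, simplified] D_e[OF b]
            blinfun.zero_right blinfun.scaleR_right ampliation_def)
    qed
  qed
qed

text \<open>R is diagonal with the quotients as entries. Where \<xi> vanishes so does \<eta>, and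
  the convention that x / 0 = 0 gives a correct entry.\<close>

lemma D_ratio:
  assumes x: "\<xi> \<in> c0_star" and le: "\<And>n. \<bar>\<eta> n\<bar> \<le> C * \<xi> n"
  shows "\<exists>R\<in>BH. norm R \<le> \<bar>C\<bar> \<and> D \<eta> = R o\<^sub>L D \<xi>"
proof -
  let ?r = "\<lambda>n. \<eta> n / \<xi> n"
  have b: "\<forall>n. \<bar>?r n\<bar> \<le> \<bar>C\<bar>"
  proof
    fix n
    show "\<bar>?r n\<bar> \<le> \<bar>C\<bar>"
    proof (cases "\<xi> n = 0")
      case False
      then have "\<xi> n > 0"
        using c0_star_nonneg[OF x, of n] by simp
      then have "\<bar>?r n\<bar> \<le> C"
        using le[of n] by (simp add: field_simps)
      then show ?thesis
        by simp
    qed simp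
  qed
  have "?r n * \<xi> n = \<eta> n" for n
    using le[of n] by (cases "\<xi> n = 0") auto
  then have "D ?r o\<^sub>L D \<xi> = D \<eta>"
    by (simp add: D_mult[OF b c0_star_abs_le[OF x]])
  with D_BH[OF b] D_norm[OF b] show ?thesis
    by (intro bexI[of _ "D ?r"]) auto
qed

lemma D_dominated:
  assumes I: "op_ideal I" and D: "D \<xi> \<in> I" and x: "\<xi> \<in> c0_star" and le: "\<And>n. \<bar>\<eta> n\<bar> \<le> C * \<xi> n"
  shows "D \<eta> \<in> I"
  using D_ratio[OF x le] I D by (auto simp: op_ideal_def)

text \<open>The partial isometries between the basis and the two Schmidt systems turn X into the
  diagonal operator of its singular values and back, so both lie in the same ideals.\<close>

lemma compact_ops_factor:
  assumes X: "X \<in> compact_ops"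
  shows "singular_values X \<in> c0_star"
    and "\<exists>A\<in>BH. \<exists>B\<in>BH. X = A o\<^sub>L D (singular_values X) o\<^sub>L B"
    and "\<exists>A\<in>BH. \<exists>B\<in>BH. D (singular_values X) = A o\<^sub>L X o\<^sub>L B"
proof -
  obtain s f g where s: "s \<in> c0_star" and f: "orthonormal f" and g: "orthosys g"
    and g1: "\<And>n. s n > 0 \<Longrightarrow> norm (g n) = 1" and Xs: "X = schmidt s f g"
    using compact_ops_schmidt[OF X e_on] by metis
  note fo = orthonormal_imp_orthosys[OF f] and b = c0_star_abs_le[OF s]
  have sv: "singular_values X = s"
    unfolding Xs by (rule singular_values_schmidt[OF f g s g1])
  show "singular_values X \<in> c0_star"
    by (simp add: sv s)
  have "schmidt s e e o\<^sub>L schmidt (\<lambda>_. 1) f e = schmidt s f e"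
    by (rule schmidt_compose[OF fo e_os e_os b one_bounded]) simp
  moreover have "schmidt (\<lambda>_. 1) e g o\<^sub>L schmidt s f e = schmidt s f g"
    by (rule schmidt_compose[OF fo e_os g one_bounded b]) simp
  ultimately have "X = schmidt (\<lambda>_. 1) e g o\<^sub>L D s o\<^sub>L schmidt (\<lambda>_. 1) f e"
    by (simp add: Xs D_schmidt blinfun_compose_assoc)
  then show "\<exists>A\<in>BH. \<exists>B\<in>BH. X = A o\<^sub>L D (singular_values X) o\<^sub>L B"
    unfolding sv using schmidt_BH[OF e_os g one_bounded] schmidt_BH[OF fo e_os one_bounded] by blast
  have "schmidt s f g o\<^sub>L schmidt (\<lambda>_. 1) e f = schmidt s e g"
    by (rule schmidt_compose[OF e_os fo g b one_bounded]) (simp add: orthonormal_norm[OF f])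
  \<comment> \<open>Here the middle system g may contain zero vectors, but only at indices where
    \<open>s n = 0\<close>.\<close>
  moreover have "schmidt (\<lambda>_. 1) g e o\<^sub>L schmidt s e g = schmidt s e e"
    by (rule schmidt_compose[OF e_os g e_os one_bounded b])
      (use g1 c0_star_nonneg[OF s] in \<open>force simp: le_less\<close>)
  ultimately have "D s = schmidt (\<lambda>_. 1) g e o\<^sub>L X o\<^sub>L schmidt (\<lambda>_. 1) e f"
    by (simp add: Xs D_schmidt blinfun_compose_assoc)
  then show "\<exists>A\<in>BH. \<exists>B\<in>BH. D (singular_values X) = A o\<^sub>L X o\<^sub>L B"
    unfolding sv using schmidt_BH[OF g e_os one_bounded] schmidt_BH[OF e_os fo one_bounded] by blast
qed

section \<open>Ideals and their sequences\<close>

lemma D_singular_values_in_ideal_iff: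
  assumes "op_ideal I" "X \<in> compact_ops"
  shows "D (singular_values X) \<in> I \<longleftrightarrow> X \<in> I"
  using compact_ops_factor(2,3)[OF assms(2)] op_ideal_sandwich[OF assms(1)] by metis

lemma singular_values_D: "\<xi> \<in> c0_star \<Longrightarrow> singular_values (D \<xi>) = \<xi>"
  unfolding D_schmidt by (rule singular_values_schmidt[OF e_on e_os]) simp_all

lemma Sigma_ideal_eq:
  fixes I :: "('h \<Rightarrow>\<^sub>L 'h) set"
  assumes "op_ideal I"
  shows "Sigma_ideal I = {\<xi> \<in> c0_star. D \<xi> \<in> I}"
proof (intro antisym subsetI)
  fix \<xi>
  assume "\<xi> \<in> Sigma_ideal I"
  then obtain X where "X \<in> I" "\<xi> = singular_values X"
    by (auto simp: Sigma_ideal_def)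
  then show "\<xi> \<in> {\<xi> \<in> c0_star. D \<xi> \<in> I}"
    using compact_ops_factor(1) D_singular_values_in_ideal_iff[OF assms] op_ideal_compact[OF assms] by auto
next
  fix \<xi>
  assume "\<xi> \<in> {\<xi> \<in> c0_star. D \<xi> \<in> I}"
  then show "\<xi> \<in> Sigma_ideal I"
    using singular_values_D unfolding Sigma_ideal_def by force
qed

lemma Sigma_ideal_dominated:
  fixes I :: "('h \<Rightarrow>\<^sub>L 'h) set"
  assumes I: "op_ideal I" and x: "\<xi> \<in> Sigma_ideal I" and h: "\<eta> \<in> c0_star" and le: "\<And>n. \<eta> n \<le> C * \<xi> n"
  shows "\<eta> \<in> Sigma_ideal I"
  using D_dominated[OF I, of \<xi> \<eta> C] x h le c0_star_nonneg[OF h] by (simp add: Sigma_ideal_eq[OF I])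

lemma Sigma_ideal_add:
  fixes I :: "('h \<Rightarrow>\<^sub>L 'h) set"
  assumes I: "op_ideal I" and "\<xi> \<in> Sigma_ideal I" "\<eta> \<in> Sigma_ideal I"
  shows "(\<lambda>n. \<xi> n + \<eta> n) \<in> Sigma_ideal I"
proof -
  have x: "\<xi> \<in> c0_star" "D \<xi> \<in> I" and y: "\<eta> \<in> c0_star" "D \<eta> \<in> I"
    using assms by (auto simp: Sigma_ideal_eq)
  have "(\<lambda>n. \<xi> n + \<eta> n) \<longlonglongrightarrow> 0 + 0"
    using x(1) y(1) by (intro tendsto_add) (auto simp: c0_star_def)
  then have "(\<lambda>n. \<xi> n + \<eta> n) \<in> c0_star"
    using x(1) y(1) by (intro c0_starI) (auto simp: c0_star_nonneg add_mono c0_star_antimono)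
  moreover have "D (\<lambda>n. \<xi> n + \<eta> n) \<in> I"
    unfolding D_add[OF x(1) y(1)] by (rule op_ideal_add[OF I x(2) y(2)])
  ultimately show ?thesis
    by (simp add: Sigma_ideal_eq[OF I])
qed

lemma Sigma_ideal_scale:
  fixes I :: "('h \<Rightarrow>\<^sub>L 'h) set"
  assumes I: "op_ideal I" and x: "\<xi> \<in> Sigma_ideal I" and r: "r \<ge> 0"
  shows "(\<lambda>n. r * \<xi> n) \<in> Sigma_ideal I"
proof -
  have x': "\<xi> \<in> c0_star"
    using x by (simp add: Sigma_ideal_eq[OF I])
  have "(\<lambda>n. r * \<xi> n) \<longlonglongrightarrow> r * 0"
    using x' by (intro tendsto_mult_left) (auto simp: c0_star_def)
  then have "(\<lambda>n. r * \<xi> n) \<in> c0_star"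
    using x' r by (intro c0_starI) (auto simp: c0_star_nonneg mult_left_mono c0_star_antimono)
  then show ?thesis
    by (rule Sigma_ideal_dominated[OF I x, where C=r]) simp
qed

lemma Sigma_ideal_ampliation:
  fixes I :: "('h \<Rightarrow>\<^sub>L 'h) set"
  assumes I: "op_ideal I" and x: "\<xi> \<in> Sigma_ideal I"
  shows "ampliation 2 \<xi> \<in> Sigma_ideal I"
proof -
  have x': "\<xi> \<in> c0_star" "D \<xi> \<in> I"
    using x by (auto simp: Sigma_ideal_eq[OF I])
  show ?thesis
    unfolding Sigma_ideal_eq[OF I] mem_Collect_eq D_ampliation[OF x'(1)]
    by (intro conjI ampliation_two_c0_star x' op_ideal_add[OF I] op_ideal_sandwich[OF I] V_BH W_BH inj_dbl)
qed

end

section \<open>Principal ideals\<close>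

context std_hilbert
begin

text \<open>On vectors without the first n coordinates the first n weights can be replaced by 0, and
  the remaining ones are at most \<open>\<xi> n\<close>.\<close>

lemma norm_D_apply_le:
  assumes x: "\<xi> \<in> c0_star" and y: "\<And>i. i < n \<Longrightarrow> cinner y (e i) = 0"
  shows "norm (blinfun_apply (D \<xi>) y) \<le> \<xi> n * norm y"
proof -
  let ?z = "\<lambda>i. if i < n then 0 else \<xi> i"
  have b: "\<forall>i. \<bar>?z i\<bar> \<le> \<xi> n"
    by (auto simp: c0_star_nonneg[OF x] c0_star_antimono[OF x])
  have "blinfun_apply (D \<xi>) y = blinfun_apply (D ?z) y"
    unfolding D_schmidt schmidt_apply[OF e_os e_os c0_star_abs_le[OF x]] schmidt_apply[OF e_os e_os b]
    by (intro suminf_cong) (simp add: y)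
  also have "norm \<dots> \<le> norm (D ?z) * norm y"
    by (rule norm_blinfun)
  also have "\<dots> \<le> \<xi> n * norm y"
    by (intro mult_right_mono D_norm[OF b]) simp
  finally show ?thesis .
qed

text \<open>A min-max argument: the span of the first n + 1 Schmidt vectors of X contains a unit
  vector v with \<open>B v\<close> orthogonal to the first n basis vectors. X stretches v by at
  least its singular value at n, while the factorisation stretches it by at most the right-hand
  side.\<close>

lemma singular_values_factor_le:
  assumes X: "X \<in> compact_ops" and A: "A \<in> BH" and B: "B \<in> BH" and x: "\<xi> \<in> c0_star"
    and eq: "X = A o\<^sub>L D \<xi> o\<^sub>L B"
  shows "singular_values X n \<le> norm A * norm B * \<xi> n"
proof -
  obtain s f g where s: "s \<in> c0_star" and f: "orthonormal f" and g: "orthosys g"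
    and g1: "\<And>n. s n > 0 \<Longrightarrow> norm (g n) = 1" and Xs: "X = schmidt s f g"
    using compact_ops_schmidt[OF X e_on] by metis
  note fo = orthonormal_imp_orthosys[OF f] and b = c0_star_abs_le[OF s]
  have sv: "singular_values X = s"
    unfolding Xs by (rule singular_values_schmidt[OF f g s g1])
  obtain c v where v: "v = (\<Sum>j\<le>n. c j *\<^sub>C f j)" and v1: "norm v = 1"
    and orth: "\<And>i. i < n \<Longrightarrow> cinner (blinfun_apply B v) (e i) = 0"
    using ex_unit_combination_orthogonal[OF f B, of n e] by blast
  have "norm (blinfun_apply X v) \<le> norm A * norm (blinfun_apply (D \<xi>) (blinfun_apply B v))"
    unfolding eq blinfun_apply_blinfun_compose by (rule norm_blinfun)
  also have "\<dots> \<le> norm A * (\<xi> n * norm (blinfun_apply B v))"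
    by (rule mult_left_mono[OF norm_D_apply_le[OF x]]) (simp_all add: orth)
  also have "\<dots> \<le> norm A * (\<xi> n * (norm B * norm v))"
    by (intro mult_left_mono norm_blinfun c0_star_nonneg[OF x] norm_ge_zero)
  finally have upper: "norm (blinfun_apply X v) \<le> norm A * norm B * \<xi> n"
    by (simp add: v1 mult.assoc mult.commute[of "\<xi> n"])
  have lower: "s n \<le> norm (blinfun_apply X v)"
  proof (cases "s n = 0")
    case False
    then have pos: "s n > 0"
      using c0_star_nonneg[OF s, of n] by simp
    have "blinfun_apply X v = (\<Sum>j\<le>n. (of_real (s j) * c j) *\<^sub>C g j)"
      unfolding v Xs blinfun.sum_right BH_scaleC[OF schmidt_BH[OF fo g b]] schmidt_domain[OF fo g b]
      by (simp add: orthonormal_norm[OF f] scaleC_scaleC mult.commute flip: scaleC_of_real)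
    then have "(norm (blinfun_apply X v))\<^sup>2 = (\<Sum>j\<le>n. (cmod (of_real (s j) * c j))\<^sup>2 * (norm (g j))\<^sup>2)"
      by (simp only: norm_sum_orthosys[OF g] finite_atMost)
    \<comment> \<open>For j at most n the weight \<open>s j\<close> is at least \<open>s n\<close>,
      hence positive, so that \<open>g j\<close> is a unit vector.\<close>
    also have "\<dots> \<ge> (\<Sum>j\<le>n. (s n)\<^sup>2 * ((cmod (c j))\<^sup>2 * (norm (f j))\<^sup>2))"
    proof (rule sum_mono)
      fix j
      assume "j \<in> {..n}"
      then have le: "s n \<le> s j"
        by (intro c0_star_antimono[OF s]) simp
      then have "(s n)\<^sup>2 \<le> (s j)\<^sup>2"
        using pos by (intro power_mono) auto
      moreover have "norm (g j) = 1"
        using g1 pos le by simp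
      ultimately show "(s n)\<^sup>2 * ((cmod (c j))\<^sup>2 * (norm (f j))\<^sup>2) \<le>
          (cmod (of_real (s j) * c j))\<^sup>2 * (norm (g j))\<^sup>2"
        by (simp add: norm_mult power_mult_distrib orthonormal_norm[OF f] mult_right_mono)
    qed
    also have "(\<Sum>j\<le>n. (s n)\<^sup>2 * ((cmod (c j))\<^sup>2 * (norm (f j))\<^sup>2)) = (s n)\<^sup>2 * (norm v)\<^sup>2"
      unfolding v norm_sum_orthosys[OF fo finite_atMost] sum_distrib_left ..
    finally have "(s n)\<^sup>2 \<le> (norm (blinfun_apply X v))\<^sup>2"
      by (simp add: v1)
    then show ?thesis
      by (rule power2_le_imp_le) simp
  qed simp
  show ?thesis
    unfolding sv using lower upper by (rule order_trans)
qed

text \<open>The point is closure under addition. Two products are run side by side on the even and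
  odd halves of the basis, which gives one product with D_2 \<xi> in the middle; the hypothesis on
  D_2 turns this back into \<xi>. The ambient ideal I supplies compactness.\<close>

lemma op_ideal_factors:
  assumes I: "op_ideal I" and DI: "D \<xi> \<in> I" and x: "\<xi> \<in> c0_star"
    and amp: "\<And>n. ampliation 2 \<xi> n \<le> C * \<xi> n"
  shows "op_ideal {A o\<^sub>L D \<xi> o\<^sub>L B |A B. A \<in> BH \<and> B \<in> BH}" (is "op_ideal ?L")
  unfolding op_ideal_def
proof (intro conjI ballI)
  note b = c0_star_abs_le[OF x]
  have "?L \<subseteq> I"
    using op_ideal_sandwich[OF I DI] by blast
  then show "?L \<subseteq> compact_ops"
    using op_ideal_compact[OF I] by blast
  have "(0 :: 'h \<Rightarrow>\<^sub>L 'h) \<in> BH"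
    by (rule BH_intro) simp
  then show "0 \<in> ?L"
    by (intro CollectI exI[of _ 0] conjI) (auto intro!: blinfun_eqI simp: blinfun.zero_left blinfun.zero_right)
  fix X
  assume "X \<in> ?L"
  then obtain A1 B1 where 1: "A1 \<in> BH" "B1 \<in> BH" "X = A1 o\<^sub>L D \<xi> o\<^sub>L B1"
    by blast
  show "A o\<^sub>L X \<in> ?L" if "A \<in> BH" for A
    unfolding 1 using BH_compose[OF that 1(1)] 1(2) by (metis (mono_tags, lifting) blinfun_compose_assoc mem_Collect_eq)
  show "X o\<^sub>L A \<in> ?L" if "A \<in> BH" for A
    unfolding 1 using BH_compose[OF 1(2) that] 1(1) by (metis (mono_tags, lifting) blinfun_compose_assoc mem_Collect_eq)
  show "X + Y \<in> ?L" if "Y \<in> ?L" for Y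
  proof -
    obtain A2 B2 where 2: "A2 \<in> BH" "B2 \<in> BH" "Y = A2 o\<^sub>L D \<xi> o\<^sub>L B2"
      using \<open>Y \<in> ?L\<close> by blast
    let ?a = "ampliation 2 \<xi>"
    note ac = ampliation_two_c0_star[OF x]
    note ab = c0_star_abs_le[OF ac]
    \<comment> \<open>The cross terms vanish because \<open>V (dbl j)\<close> maps into the span of
      indices of parity j, which the other W annihilates.\<close>
    have W_V: "W (dbl i) o\<^sub>L D ?a o\<^sub>L V (dbl j) = (if i = j then D \<xi> else 0)"
      if "i < 2" "j < 2" for i j
    proof -
      have "W (dbl i) o\<^sub>L D ?a o\<^sub>L V (dbl j) = D (if i = j then \<xi> else (\<lambda>_. 0))"
      proof (rule eq_D_iff)
        show "W (dbl i) o\<^sub>L D ?a o\<^sub>L V (dbl j) \<in> BH"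
          by (intro BH_compose W_BH V_BH inj_dbl) (rule D_BH[OF ab])
        show "\<forall>n. \<bar>(if i = j then \<xi> else (\<lambda>_. 0)) n\<bar> \<le> \<xi> 0"
          using b c0_star_nonneg[OF x] by auto
        have "(2 * n + j) mod 2 = j" "(2 * n + j) div 2 = n" "?a (2 * n + j) = \<xi> n" for n
          using that by (auto simp: ampliation_def)
        then show "blinfun_apply (W (dbl i) o\<^sub>L D ?a o\<^sub>L V (dbl j)) (e n) =
            (if i = j then \<xi> else (\<lambda>_. 0)) n *\<^sub>R e n" for n
          using that(1) by (simp add: V_e[OF inj_dbl] D_e[OF ab] W_dbl_e[OF that(1)] blinfun.scaleR_right)
      qed
      moreover have "D (\<lambda>_. 0) = 0"
        using D_scale[OF x, of 0] by simp
      ultimately show ?thesis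
        by simp
    qed
    let ?A = "(A1 o\<^sub>L W (dbl 0)) + (A2 o\<^sub>L W (dbl 1))"
    let ?B = "(V (dbl 0) o\<^sub>L B1) + (V (dbl 1) o\<^sub>L B2)"
    have "?A o\<^sub>L D ?a o\<^sub>L ?B = X + Y"
    proof (rule blinfun_eqI)
      fix v
      have WV: "blinfun_apply (W (dbl i)) (blinfun_apply (D ?a) (blinfun_apply (V (dbl j)) w)) =
          (if i = j then blinfun_apply (D \<xi>) w else 0)" if "i < 2" "j < 2" for i j w
        using arg_cong[OF W_V[OF that], of "\<lambda>T. blinfun_apply T w"] by auto
      show "blinfun_apply (?A o\<^sub>L D ?a o\<^sub>L ?B) v = blinfun_apply (X + Y) v"
        using WV[of 0 0] WV[of 0 1] WV[of 1 0] WV[of 1 1]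
        by (simp add: 1(3) 2(3) blinfun.add_left blinfun.add_right blinfun.zero_right)
    qed
    moreover obtain R where R: "R \<in> BH" "D ?a = R o\<^sub>L D \<xi>"
      using D_ratio[OF x, of ?a C] amp c0_star_nonneg[OF ac] by auto
    ultimately have "X + Y = (?A o\<^sub>L R) o\<^sub>L D \<xi> o\<^sub>L ?B"
      by (simp add: blinfun_compose_assoc)
    moreover have "?A o\<^sub>L R \<in> BH" "?B \<in> BH"
      by (intro BH_compose BH_add W_BH V_BH inj_dbl R 1 2)+
    ultimately show ?thesis
      by blast
  qed
qed

text \<open>In general ampliations of \<xi> of every order would be needed as bounds; here they are
  absorbed into the constant. One inclusion is the estimate for factorisations, the other is
  heredity under domination.\<close>

lemma Sigma_ideal_gen:
  assumes I: "op_ideal I" and DI: "D \<xi> \<in> I" and x: "\<xi> \<in> c0_star"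
    and amp: "\<And>n. ampliation 2 \<xi> n \<le> C * \<xi> n"
  shows "Sigma_ideal (ideal_gen (D \<xi>)) = {\<eta> \<in> c0_star. \<exists>K. \<forall>n. \<eta> n \<le> K * \<xi> n}"
proof (intro antisym subsetI)
  let ?L = "{A o\<^sub>L D \<xi> o\<^sub>L B |A B. A \<in> BH \<and> B \<in> BH}"
  fix \<eta>
  assume "\<eta> \<in> Sigma_ideal (ideal_gen (D \<xi>))"
  moreover have "D \<xi> \<in> ?L"
    using BH_id by (intro CollectI exI[of _ id_blinfun]) (auto intro: blinfun_eqI)
  then have "ideal_gen (D \<xi>) \<subseteq> ?L"
    by (rule ideal_gen_subset[OF op_ideal_factors[OF I DI x amp]])
  ultimately obtain X A B where "X \<in> ideal_gen (D \<xi>)" "\<eta> = singular_values X"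
      "X = A o\<^sub>L D \<xi> o\<^sub>L B" "A \<in> BH" "B \<in> BH"
    unfolding Sigma_ideal_def by blast
  moreover have "X \<in> compact_ops"
    using \<open>X \<in> ideal_gen (D \<xi>)\<close> op_ideal_compact[OF op_ideal_ideal_gen[OF I DI]] by blast
  ultimately show "\<eta> \<in> {\<eta> \<in> c0_star. \<exists>K. \<forall>n. \<eta> n \<le> K * \<xi> n}"
    using compact_ops_factor(1) singular_values_factor_le[OF _ _ _ x] by blast
next
  note L = op_ideal_ideal_gen[OF I DI] ideal_gen_self[OF I DI]
  fix \<eta>
  assume "\<eta> \<in> {\<eta> \<in> c0_star. \<exists>K. \<forall>n. \<eta> n \<le> K * \<xi> n}"
  then show "\<eta> \<in> Sigma_ideal (ideal_gen (D \<xi>))"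
    using Sigma_ideal_dominated[OF L(1), of \<xi>] L(2) x by (auto simp: Sigma_ideal_eq[OF L(1)])
qed

end

section \<open>Banach ideals\<close>

locale normed_ideal = std_hilbert e for e :: "nat \<Rightarrow> 'h::complex_hilbert" +
  fixes I :: "('h \<Rightarrow>\<^sub>L 'h) set" and N :: "('h \<Rightarrow>\<^sub>L 'h) \<Rightarrow> real"
  assumes I: "op_ideal I" and I_nonzero: "I \<noteq> {0}"
    and N: "symmetric_norm_on I N" and complete: "complete_on I N"
begin

abbreviation S :: "(nat \<Rightarrow> real) set" where
  "S \<equiv> Sigma_ideal I"

section \<open>The symmetric norm on diagonal operators\<close>

lemma S_c0: "\<xi> \<in> S \<Longrightarrow> \<xi> \<in> c0_star" and S_D: "\<xi> \<in> S \<Longrightarrow> D \<xi> \<in> I"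
  by (auto simp: Sigma_ideal_eq[OF I])

lemma zero_in_I: "0 \<in> I"
  using I by (simp add: op_ideal_def)

lemma N_eq_0: "X \<in> I \<Longrightarrow> N X = 0 \<longleftrightarrow> X = 0"
  using N by (simp add: symmetric_norm_on_def)

lemma N_zero: "N 0 = 0"
  by (simp add: N_eq_0[OF zero_in_I])

lemma N_add: "X \<in> I \<Longrightarrow> Y \<in> I \<Longrightarrow> N (X + Y) \<le> N X + N Y"
  using N by (simp add: symmetric_norm_on_def)

lemma N_scaleR: "X \<in> I \<Longrightarrow> N (r *\<^sub>R X) = \<bar>r\<bar> * N X"
  using N unfolding scalar_op_of_real[symmetric] by (simp add: symmetric_norm_on_def)

lemma N_minus: "X \<in> I \<Longrightarrow> N (- X) = N X"
  using N_scaleR[of X "-1"] by simp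

lemma N_nonneg: "X \<in> I \<Longrightarrow> 0 \<le> N X"
  using N_add[of X "- X"] N_minus[of X] N_eq_0[OF zero_in_I] op_ideal_scaleR[OF I, of X "-1"] by simp

lemma N_sandwich:
  assumes "X \<in> I" "A \<in> BH" "B \<in> BH" "norm A \<le> a" "norm B \<le> b"
  shows "N (A o\<^sub>L X o\<^sub>L B) \<le> a * N X * b"
proof -
  have "N (A o\<^sub>L X o\<^sub>L B) \<le> norm A * N X * norm B"
    using N assms(1-3) by (simp add: symmetric_norm_on_def)
  also have "\<dots> \<le> a * N X * b"
    using assms(4,5) N_nonneg[OF assms(1)] norm_ge_zero[of A] norm_ge_zero[of B]
    by (intro mult_mono mult_nonneg_nonneg) linarith+
  finally show ?thesis .
qed

lemma N_sum:
  assumes "finite K" "\<And>k. k \<in> K \<Longrightarrow> X k \<in> I"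
  shows "N (\<Sum>k\<in>K. X k) \<le> (\<Sum>k\<in>K. N (X k))"
  using assms
proof (induction K rule: finite_induct)
  case (insert x K)
  then have "N (X x + (\<Sum>k\<in>K. X k)) \<le> N (X x) + N (\<Sum>k\<in>K. X k)"
    by (intro N_add op_ideal_sum[OF I]) auto
  with insert show ?case
    by simp
qed (simp add: N_zero)

text \<open>The smaller diagonal is a contraction times the larger one.\<close>

lemma N_D_mono:
  assumes "\<xi> \<in> S" "\<eta> \<in> S" "\<And>n. \<eta> n \<le> \<xi> n"
  shows "N (D \<eta>) \<le> N (D \<xi>)"
proof -
  have "\<bar>\<eta> n\<bar> \<le> 1 * \<xi> n" for n
    using assms(3) c0_star_nonneg[OF S_c0[OF assms(2)]] by simp
  then obtain R where R: "R \<in> BH" "norm R \<le> 1" "D \<eta> = R o\<^sub>L D \<xi>"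
    using D_ratio[OF S_c0[OF assms(1)], of \<eta> 1] by auto
  have "D \<eta> = R o\<^sub>L D \<xi> o\<^sub>L id_blinfun"
    unfolding R(3) by (rule blinfun_eqI) simp
  then show ?thesis
    using N_sandwich[OF S_D[OF assms(1)] R(1) BH_id R(2), of 1] by (simp add: norm_blinfun_id_le)
qed

lemma D_eq_0: "\<xi> \<in> S \<Longrightarrow> D \<xi> = 0 \<Longrightarrow> \<xi> n = 0"
  using D_e[OF c0_star_abs_le[OF S_c0], of \<xi> n] norm_e[of n]
  by (metis blinfun.zero_left norm_zero scaleR_eq_0_iff zero_neq_one)

text \<open>If the first singular value of a nonzero X were 0, all would be, and the factorisation
  of X through its singular values would give X = 0. So a multiple of them dominates
  \<open>\<delta>0\<close>.\<close>

lemma \<delta>0_S: "\<delta>0 \<in> S"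
proof -
  obtain X where X: "X \<in> I" "X \<noteq> 0"
    using I_nonzero zero_in_I by blast
  let ?s = "singular_values X"
  note Xc = op_ideal_compact[OF I X(1)]
  have s: "?s \<in> S"
    using X(1) by (simp add: Sigma_ideal_def)
  have "?s 0 \<noteq> 0"
  proof
    assume "?s 0 = 0"
    then have "?s n = 0" for n
      using c0_star_antimono[OF S_c0[OF s], of 0 n] c0_star_nonneg[OF S_c0[OF s], of n] by simp
    then have "?s = (\<lambda>n. 0 * ?s n)"
      by auto
    then have "D ?s = 0"
      using D_scale[OF S_c0[OF s], of 0] by simp
    then have "X = 0"
      using compact_ops_factor(2)[OF Xc] by (auto intro!: blinfun_eqI simp: blinfun.zero_left blinfun.zero_right)
    with X show False
      by blast
  qed
  then show ?thesis
    by (intro Sigma_ideal_dominated[OF I s \<delta>0_c0, where C="1 / ?s 0"])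
      (auto simp: \<delta>0_def c0_star_nonneg[OF S_c0[OF s]])
qed

text \<open>Compressing X to the rank one block between \<open>e i\<close> and \<open>e j\<close>
  leaves the entry times \<open>D \<delta>0\<close>, and a symmetric norm does not grow under
  compression. This makes \<open>N\<close>-limits visible entrywise.\<close>

lemma cinner_le_N:
  assumes X: "X \<in> I"
  shows "cmod (cinner (blinfun_apply X (e i)) (e j)) * N (D \<delta>0) \<le> N X"
proof -
  let ?x = "cinner (blinfun_apply X (e i)) (e j)"
  have b: "\<forall>n. \<bar>\<delta>0 n\<bar> \<le> 1"
    by (simp add: \<delta>0_def)
  have inj: "inj (\<lambda>n. n + k)" for k :: nat
    by (simp add: inj_def)
  note XB = compact_ops_BH[OF op_ideal_compact[OF I X]]
  have D\<delta>: "blinfun_apply (D \<delta>0) v = cinner v (e 0) *\<^sub>C e 0" for v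
  proof -
    have "(\<lambda>n. \<delta>0 n *\<^sub>R (cinner v (e n) *\<^sub>C e n)) sums (cinner v (e 0) *\<^sub>C e 0)"
      using sums_finite[of "{0}" "\<lambda>n. \<delta>0 n *\<^sub>R (cinner v (e n) *\<^sub>C e n)"] by (simp add: \<delta>0_def)
    with schmidt_sums[OF e_os e_os b, of v] show ?thesis
      unfolding D_schmidt by (rule sums_unique2)
  qed
  \<comment> \<open>B sends \<open>e 0\<close> to \<open>e i\<close>, and A sends \<open>e j\<close>
    back to \<open>e 0\<close>.\<close>
  let ?A = "D \<delta>0 o\<^sub>L W (\<lambda>n. n + j)" and ?B = "V (\<lambda>n. n + i) o\<^sub>L D \<delta>0"
  have "?A o\<^sub>L X o\<^sub>L ?B = scalar_op ?x o\<^sub>L D \<delta>0"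
  proof (rule blinfun_eqI)
    fix v
    show "blinfun_apply (?A o\<^sub>L X o\<^sub>L ?B) v = blinfun_apply (scalar_op ?x o\<^sub>L D \<delta>0) v"
      by (simp add: D\<delta> BH_scaleC[OF V_BH[OF inj]] BH_scaleC[OF XB] V_e[OF inj] cinner_W_e[OF inj]
          cinner_scaleC_left scaleC_scaleC mult.commute)
  qed
  then have "cmod ?x * N (D \<delta>0) = N (?A o\<^sub>L X o\<^sub>L ?B)"
    using N S_D[OF \<delta>0_S] by (simp add: symmetric_norm_on_def)
  also have "\<dots> \<le> 1 * N X * 1"
  proof (rule N_sandwich[OF X])
    show "?A \<in> BH" "?B \<in> BH"
      by (intro BH_compose D_BH[OF b] W_BH V_BH inj)+
    have "norm (D \<delta>0) * norm (W (\<lambda>n. n + j)) \<le> 1 * 1" "norm (V (\<lambda>n. n + i)) * norm (D \<delta>0) \<le> 1 * 1"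
      by (intro mult_mono D_norm[OF b] W_norm V_norm inj norm_ge_zero zero_le_one)+
    then show "norm ?A \<le> 1" "norm ?B \<le> 1"
      using norm_blinfun_compose order_trans by (metis mult_1)+
  qed
  finally show ?thesis
    by simp
qed

lemma N_D\<delta>0: "N (D \<delta>0) > 0"
proof -
  have "D \<delta>0 \<noteq> 0"
    using D_eq_0[OF \<delta>0_S, of 0] by (auto simp: \<delta>0_def)
  then show ?thesis
    using N_eq_0[OF S_D[OF \<delta>0_S]] N_nonneg[OF S_D[OF \<delta>0_S]] by simp
qed

text \<open>Completeness supplies an operator limit of the partial sums. Its matrix entries are the
  limits of theirs, so it is diagonal with the entrywise sums on the diagonal.\<close>

lemma S_series:
  assumes h: "\<And>k. \<eta> k \<in> S" and le: "\<And>k. N (D (\<eta> k)) \<le> C * (1/2) ^ k"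
  shows "\<exists>\<zeta>\<in>S. \<forall>m. (\<lambda>k. \<eta> k m) sums \<zeta> m"
proof -
  define X where "X n = (\<Sum>k<n. D (\<eta> k))" for n
  have X: "X n \<in> I" for n
    unfolding X_def by (rule op_ideal_sum[OF I]) (rule S_D[OF h])
  have Xdiff: "X m - X n \<in> I" for m n
    using op_ideal_add[OF I X[of m] op_ideal_scaleR[OF I X[of n], of "-1"]] by simp
  have C: "C \<ge> 0"
    using le[of 0] N_nonneg[OF S_D[OF h[of 0]]] by simp
  have tail: "N (X m - X n) \<le> 2 * C * (1/2) ^ n" if "n \<le> m" for m n
  proof -
    have "X m - X n = (\<Sum>k=n..<m. D (\<eta> k))"
      using sum_diff_nat_ivl[of 0 n m "\<lambda>k. D (\<eta> k)"] that by (simp add: X_def lessThan_atLeast0)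
    then have "N (X m - X n) \<le> (\<Sum>k=n..<m. N (D (\<eta> k)))"
      using N_sum[of "{n..<m}" "\<lambda>k. D (\<eta> k)"] S_D[OF h] by simp
    also have "\<dots> \<le> (\<Sum>k=n..<m. C * (1/2) ^ k)"
      by (intro sum_mono le)
    also have "\<dots> = 2 * C * ((1/2) ^ n - (1/2) ^ m)"
      using that by (induction m rule: dec_induct) (auto simp: algebra_simps)
    also have "\<dots> \<le> 2 * C * (1/2) ^ n"
      using C by (intro mult_left_mono) auto
    finally show ?thesis .
  qed
  have "\<exists>M. \<forall>m\<ge>M. \<forall>n\<ge>M. N (X m - X n) < \<epsilon>" if "\<epsilon> > 0" for \<epsilon>
  proof -
    have "(\<lambda>n. 2 * C * (1/2) ^ n) \<longlonglongrightarrow> 0"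
      using tendsto_mult_right_zero[OF LIMSEQ_power_zero[of "1/2::real"], of "2 * C"] by simp
    then have "\<forall>\<^sub>F n in sequentially. 2 * C * (1/2) ^ n < \<epsilon>"
      by (rule order_tendstoD) (rule that)
    then obtain M where M: "\<And>n. n \<ge> M \<Longrightarrow> 2 * C * (1/2) ^ n < \<epsilon>"
      unfolding eventually_sequentially by blast
    have "N (X m - X n) < \<epsilon>" if mn: "m \<ge> M" "n \<ge> M" for m n
    proof (cases "n \<le> m")
      case True
      then show ?thesis
        using tail[OF True] M[OF mn(2)] by simp
    next
      case False
      then show ?thesis
        using tail[of m n] M[OF mn(1)] N_minus[OF Xdiff, of n m] by simp
    qed
    then show ?thesis
      by blast
  qed
  then obtain Y where Y: "Y \<in> I" and lim: "(\<lambda>n. N (X n - Y)) \<longlonglongrightarrow> 0"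
    using complete X unfolding complete_on_def by blast
  have XY: "X n - Y \<in> I" for n
    using op_ideal_add[OF I X[of n] op_ideal_scaleR[OF I Y, of "-1"]] by simp
  have XD: "blinfun_apply (X n) (e i) = (\<Sum>k<n. \<eta> k i) *\<^sub>R e i" for n i
    by (simp add: X_def blinfun.sum_left D_e[OF c0_star_abs_le[OF S_c0[OF h]]] scaleR_sum_left)
  have "(\<lambda>n. cinner (blinfun_apply (X n - Y) (e i)) (e j)) \<longlonglongrightarrow> 0" for i j
  proof (rule Lim_null_comparison)
    show "\<forall>\<^sub>F n in sequentially. norm (cinner (blinfun_apply (X n - Y) (e i)) (e j)) \<le> N (X n - Y) / N (D \<delta>0)"
      using cinner_le_N[OF XY, where i=i and j=j] N_D\<delta>0 by (auto simp: field_simps)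
    show "(\<lambda>n. N (X n - Y) / N (D \<delta>0)) \<longlonglongrightarrow> 0"
      using tendsto_divide[OF lim tendsto_const[of "N (D \<delta>0)"]] N_D\<delta>0 by simp
  qed
  then have ent: "(\<lambda>n. of_real (\<Sum>k<n. \<eta> k i) * cinner (e i) (e j)) \<longlonglongrightarrow> cinner (blinfun_apply Y (e i)) (e j)" for i j
    using LIM_zero_cancel[of "\<lambda>n. of_real (\<Sum>k<n. \<eta> k i) * cinner (e i) (e j)"
        "cinner (blinfun_apply Y (e i)) (e j)" sequentially]
    by (simp only: blinfun.diff_left cinner_diff XD cinner_scaleR_left)
  define \<zeta> where "\<zeta> i = Re (cinner (blinfun_apply Y (e i)) (e i))" for i
  have sums: "(\<lambda>k. \<eta> k i) sums \<zeta> i" for i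
    using tendsto_Re[OF ent[of i i]] by (simp add: sums_def \<zeta>_def cinner_e)
  have off: "cinner (blinfun_apply Y (e i)) (e j) = 0" if "i \<noteq> j" for i j
    using ent[of i j] that by (simp add: cinner_e LIMSEQ_const_iff)
  have diag: "cinner (blinfun_apply Y (e i)) (e i) = of_real (\<zeta> i)" for i
  proof (rule LIMSEQ_unique)
    show "(\<lambda>n. complex_of_real (\<Sum>k<n. \<eta> k i)) \<longlonglongrightarrow> cinner (blinfun_apply Y (e i)) (e i)"
      using ent[of i i] by (simp add: cinner_e)
    show "(\<lambda>n. complex_of_real (\<Sum>k<n. \<eta> k i)) \<longlonglongrightarrow> of_real (\<zeta> i)"
      using sums[of i] unfolding sums_def by (rule tendsto_of_real)
  qed
  have Ye: "blinfun_apply Y (e i) = \<zeta> i *\<^sub>R e i" for i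
  proof -
    have "(\<lambda>n. cinner (blinfun_apply Y (e i)) (e n) *\<^sub>C e n) sums (\<zeta> i *\<^sub>R e i)"
      using sums_finite[of "{i}" "\<lambda>n. cinner (blinfun_apply Y (e i)) (e n) *\<^sub>C e n"]
      by (simp add: off diag scaleC_of_real)
    with basis_sums[OF basis] show ?thesis
      by (rule sums_unique2)
  qed
  note Yc = op_ideal_compact[OF I Y]
  have "\<forall>i. \<bar>\<zeta> i\<bar> \<le> norm Y"
    using norm_blinfun[of Y "e _"] by (simp add: Ye)
  then have YD: "Y = D \<zeta>"
    by (rule eq_D_iff[OF compact_ops_BH[OF Yc]]) (rule Ye)
  have z0: "0 \<le> \<zeta> i" for i
    using sums_le[OF _ sums_zero sums[of i]] c0_star_nonneg[OF S_c0[OF h]] by simp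
  have dec: "\<zeta> (Suc i) \<le> \<zeta> i" for i
    by (rule sums_le[OF _ sums sums]) (intro c0_star_antimono S_c0 h, simp)
  have "decseq \<zeta>"
    by (rule decseq_SucI) (rule dec)
  \<comment> \<open>Entrywise convergence alone would not give this. It comes from compactness of
    the limit, which sends the basis to orthogonal vectors of norms
    \<open>\<zeta> n\<close>.\<close>
  have "\<zeta> \<longlonglongrightarrow> 0"
  proof (rule LIMSEQ_I)
    fix t :: real
    assume "t > 0"
    have "\<exists>n. norm (blinfun_apply Y (e n)) < t"
      by (rule compact_ops_orthogonal_images[OF Yc _ \<open>t > 0\<close>])
        (auto simp: Ye cinner_scaleR_left cinner_scaleR_right cinner_e)
    then obtain M where "\<zeta> M < t"
      by (auto simp: Ye z0)
    then show "\<exists>M. \<forall>n\<ge>M. norm (\<zeta> n - 0) < t"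
      using decseqD[OF \<open>decseq \<zeta>\<close>] z0 by (intro exI[of _ M]) (fastforce intro: le_less_trans)
  qed
  then have "\<zeta> \<in> c0_star"
    using z0 dec by (intro c0_starI)
  then have "\<zeta> \<in> S"
    using Y by (simp add: Sigma_ideal_eq[OF I] YD)
  with sums show ?thesis
    by blast
qed

end

section \<open>Monotone operations on the sequences of a Banach ideal\<close>

text \<open>Everything is restricted to S since \<open>arith_mean_inf\<close> behaves well only on
  summable sequences. The last clause is countable subadditivity, stated just for series whose sum
  lies in S and whose images are summable, the only case that the majorant needs.\<close>

definition monotone_sublinear ::
    "(nat \<Rightarrow> real) set \<Rightarrow> ((nat \<Rightarrow> real) \<Rightarrow> (nat \<Rightarrow> real)) \<Rightarrow> bool" where
  "monotone_sublinear S T \<longleftrightarrow>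
     (\<forall>\<eta>\<in>S. T \<eta> \<in> S) \<and>
     (\<forall>\<eta>\<in>S. \<forall>\<zeta>\<in>S. (\<forall>n. \<eta> n \<le> \<zeta> n) \<longrightarrow> (\<forall>n. T \<eta> n \<le> T \<zeta> n)) \<and>
     (\<forall>\<eta>\<in>S. \<forall>r\<ge>0. T (\<lambda>n. r * \<eta> n) = (\<lambda>n. r * T \<eta> n)) \<and>
     (\<forall>\<eta> \<zeta>. (\<forall>k::nat. \<eta> k \<in> S) \<and> \<zeta> \<in> S \<and> (\<forall>m. (\<lambda>k. \<eta> k m) sums \<zeta> m) \<and>
        (\<forall>m. summable (\<lambda>k. T (\<eta> k) m)) \<longrightarrow> (\<forall>m. T \<zeta> m \<le> (\<Sum>k. T (\<eta> k) m)))"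

lemma monotone_sublinearI:
  assumes "\<And>\<eta>. \<eta> \<in> S \<Longrightarrow> T \<eta> \<in> S"
    and "\<And>\<eta> \<zeta> n. \<eta> \<in> S \<Longrightarrow> \<zeta> \<in> S \<Longrightarrow> (\<And>n. \<eta> n \<le> \<zeta> n) \<Longrightarrow> T \<eta> n \<le> T \<zeta> n"
    and "\<And>\<eta> r n. \<eta> \<in> S \<Longrightarrow> r \<ge> 0 \<Longrightarrow> T (\<lambda>n. r * \<eta> n) n = r * T \<eta> n"
    and "\<And>\<eta> \<zeta> m. (\<And>k::nat. \<eta> k \<in> S) \<Longrightarrow> \<zeta> \<in> S \<Longrightarrow> (\<And>m. (\<lambda>k. \<eta> k m) sums \<zeta> m) \<Longrightarrow>
      (\<And>m. summable (\<lambda>k. T (\<eta> k) m)) \<Longrightarrow> T \<zeta> m \<le> (\<Sum>k. T (\<eta> k) m)"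
  shows "monotone_sublinear S T"
  unfolding monotone_sublinear_def using assms by (intro conjI allI ballI impI) (auto intro!: ext)

lemma
  assumes "monotone_sublinear S T"
  shows monotone_sublinear_closed: "\<eta> \<in> S \<Longrightarrow> T \<eta> \<in> S"
    and monotone_sublinear_mono: "\<eta> \<in> S \<Longrightarrow> \<zeta> \<in> S \<Longrightarrow> (\<And>n. \<eta> n \<le> \<zeta> n) \<Longrightarrow> T \<eta> n \<le> T \<zeta> n"
    and monotone_sublinear_scale: "\<eta> \<in> S \<Longrightarrow> r \<ge> 0 \<Longrightarrow> T (\<lambda>n. r * \<eta> n) = (\<lambda>n. r * T \<eta> n)"
    and monotone_sublinear_suminf: "(\<And>k. \<eta>' k \<in> S) \<Longrightarrow> \<zeta> \<in> S \<Longrightarrow> (\<And>m. (\<lambda>k. \<eta>' k m) sums \<zeta> m) \<Longrightarrow>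
      (\<And>m. summable (\<lambda>k. T (\<eta>' k) m)) \<Longrightarrow> T \<zeta> m \<le> (\<Sum>k. T (\<eta>' k) m)"
  using assms by (simp_all add: monotone_sublinear_def)

context normed_ideal
begin

lemma N_D_scale: "\<xi> \<in> S \<Longrightarrow> r \<ge> 0 \<Longrightarrow> N (D (\<lambda>n. r * \<xi> n)) = r * N (D \<xi>)"
  by (simp add: D_scale[OF S_c0] N_scaleR[OF S_D])

text \<open>If the bound failed, a series of bad sequences of norm \<open>2\<^sup>-\<^sup>k\<close> would sum to a member of the
  ideal whose image dominates all their images.\<close>

lemma monotone_sublinear_bounded:
  assumes T: "monotone_sublinear S T"
  shows "\<exists>C>0. \<forall>\<eta>\<in>S. N (D (T \<eta>)) \<le> C * N (D \<eta>)"
proof (rule ccontr)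
  assume neg: "\<not> ?thesis"
  \<comment> \<open>The factor 2^k is used up in scaling the bad sequences to norm 2^-k, which makes
    their sum converge; the factor k + 1 remains as a lower bound for the images.\<close>
  have "\<exists>\<eta>\<in>S. real (Suc k) * 2 ^ k * N (D \<eta>) < N (D (T \<eta>))" for k
  proof -
    have "real (Suc k) * 2 ^ k > 0"
      by simp
    then show ?thesis
      using neg not_le by blast
  qed
  then obtain \<eta> where h: "\<And>k. \<eta> k \<in> S"
    and bad: "\<And>k. real (Suc k) * 2 ^ k * N (D (\<eta> k)) < N (D (T (\<eta> k)))"
    by metis
  \<comment> \<open>A bad sequence of norm 0 would be zero, and so would its image, by homogeneity
    at r = 0. The scaling is therefore possible.\<close>
  have pos: "N (D (\<eta> k)) > 0" for k
  proof -
    have "N (D (\<eta> k)) \<noteq> 0"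
    proof
      assume zero: "N (D (\<eta> k)) = 0"
      then have "\<eta> k n = 0" for n
        using D_eq_0[OF h] N_eq_0[OF S_D[OF h]] by blast
      then have "\<eta> k = (\<lambda>n. 0 * \<eta> k n)"
        by auto
      then have "T (\<eta> k) = (\<lambda>n. 0 * T (\<eta> k) n)"
        using monotone_sublinear_scale[OF T h, of 0 k] by simp
      then have "N (D (T (\<eta> k))) = 0"
        using N_D_scale[OF monotone_sublinear_closed[OF T h], of 0 k] by simp
      with bad[of k] zero show False
        by simp
    qed
    then show ?thesis
      using N_nonneg[OF S_D[OF h]] by (simp add: less_le)
  qed
  define r where "r k = 1 / (2 ^ k * N (D (\<eta> k)))" for k
  have r: "r k > 0" for k
    using pos by (simp add: r_def)
  define \<theta> where "\<theta> k = (\<lambda>n. r k * \<eta> k n)" for k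
  have th: "\<theta> k \<in> S" for k
    unfolding \<theta>_def using r[of k] by (intro Sigma_ideal_scale[OF I h]) simp
  have "N (D (\<theta> k)) \<le> 1 * (1/2) ^ k" for k
  proof -
    have "N (D (\<theta> k)) = r k * N (D (\<eta> k))"
      unfolding \<theta>_def using r[of k] by (intro N_D_scale h) simp
    then show ?thesis
      using pos[of k] by (simp add: r_def power_one_over)
  qed
  then obtain \<zeta> where z: "\<zeta> \<in> S" and sums: "\<And>m. (\<lambda>k. \<theta> k m) sums \<zeta> m"
    using S_series[of \<theta>, OF th] by blast
  have big: "real (Suc k) < N (D (T \<zeta>))" for k
  proof -
    have "\<theta> k n \<le> \<zeta> n" for n
      using sum_le_suminf[OF sums_summable[OF sums[of n]], of "{k}"]
        sums_unique[OF sums[of n]] c0_star_nonneg[OF S_c0[OF th]] by auto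
    then have "N (D (T (\<theta> k))) \<le> N (D (T \<zeta>))"
      by (intro N_D_mono monotone_sublinear_closed[OF T] monotone_sublinear_mono[OF T] z th)
    moreover have "N (D (T (\<theta> k))) = r k * N (D (T (\<eta> k)))"
      unfolding \<theta>_def using r[of k]
      by (simp add: monotone_sublinear_scale[OF T h] N_D_scale[OF monotone_sublinear_closed[OF T h]])
    moreover have "r k * N (D (T (\<eta> k))) > r k * (real (Suc k) * 2 ^ k * N (D (\<eta> k)))"
      using bad r by (intro mult_strict_left_mono)
    moreover have "r k * (real (Suc k) * 2 ^ k * N (D (\<eta> k))) = real (Suc k)"
      using pos[of k] by (simp add: r_def)
    ultimately show ?thesis
      by linarith
  qed
  obtain k where "N (D (T \<zeta>)) \<le> real k"
    using real_arch_simple by blast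
  with big[of k] show False
    by simp
qed

text \<open>T maps each term of the series to 2 C times the next one, so the image of the sum is at
  most 2 C times the series without its first term. Of the 2 C, the C compensates the bound of T and
  the 2 makes the norms decay geometrically.\<close>

lemma ex_invariant_majorant:
  assumes T: "monotone_sublinear S T" and h: "\<eta> \<in> S"
  shows "\<exists>\<xi>\<in>S. \<exists>C. (\<forall>n. \<eta> n \<le> \<xi> n) \<and> (\<forall>n. T \<xi> n \<le> C * \<xi> n)"
proof -
  obtain C where C: "C > 0" and bd: "\<And>\<eta>. \<eta> \<in> S \<Longrightarrow> N (D (T \<eta>)) \<le> C * N (D \<eta>)"
    using monotone_sublinear_bounded[OF T] by blast
  define \<theta> where "\<theta> k = (\<lambda>n. (1 / (2 * C)) ^ k * (T ^^ k) \<eta> n)" for k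
  have Tk: "(T ^^ k) \<eta> \<in> S" for k
    by (induction k) (auto simp: h monotone_sublinear_closed[OF T])
  have pos: "0 \<le> (1 / (2 * C)) ^ k" for k
    using C by simp
  have th: "\<theta> k \<in> S" for k
    unfolding \<theta>_def by (rule Sigma_ideal_scale[OF I Tk pos])
  have Tth: "T (\<theta> k) = (\<lambda>n. 2 * C * \<theta> (Suc k) n)" for k
    unfolding \<theta>_def monotone_sublinear_scale[OF T Tk pos] using C by (auto simp: field_simps)
  have "N (D (\<theta> k)) \<le> N (D \<eta>) * (1/2) ^ k" for k
  proof (induction k)
    case (Suc k)
    have "2 * C * N (D (\<theta> (Suc k))) = N (D (T (\<theta> k)))"
      using C by (simp add: Tth N_D_scale[OF th])
    also have "\<dots> \<le> C * N (D (\<theta> k))"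
      by (rule bd[OF th])
    finally have "2 * N (D (\<theta> (Suc k))) \<le> N (D (\<theta> k))"
      using C by simp
    with Suc show ?case
      by simp
  qed (simp add: \<theta>_def)
  then obtain \<xi> where x: "\<xi> \<in> S" and sums: "\<And>m. (\<lambda>k. \<theta> k m) sums \<xi> m"
    using S_series[of \<theta>, OF th] by blast
  have sm: "summable (\<lambda>k. \<theta> k n)" for n
    using sums by (rule sums_summable)
  have nn: "0 \<le> \<theta> k n" for k n
    by (rule c0_star_nonneg[OF S_c0[OF th]])
  have head: "\<xi> n = \<eta> n + (\<Sum>k. \<theta> (Suc k) n)" for n
    using suminf_split_head[OF sm, of n] sums_unique[OF sums[of n]] by (simp add: \<theta>_def)
  have smS: "summable (\<lambda>k. \<theta> (Suc k) n)" for n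
    using sm[of n] by (subst summable_Suc_iff)
  have "\<eta> n \<le> \<xi> n" for n
    using suminf_nonneg[OF smS nn, of n] head[of n] by simp
  moreover have "T \<xi> n \<le> 2 * C * \<xi> n" for n
  proof -
    have "T \<xi> n \<le> (\<Sum>k. T (\<theta> k) n)"
      by (rule monotone_sublinear_suminf[OF T th x sums]) (simp add: Tth summable_mult smS)
    also have "\<dots> = 2 * C * (\<Sum>k. \<theta> (Suc k) n)"
      by (simp add: Tth suminf_mult[OF smS])
    also have "\<dots> \<le> 2 * C * \<xi> n"
      using head[of n] C c0_star_nonneg[OF S_c0[OF h], of n] by simp
    finally show ?thesis .
  qed
  ultimately show ?thesis
    using x by blast
qed

section \<open>The concrete monotone operations\<close>

lemma monotone_sublinear_ampliation: "monotone_sublinear S (ampliation 2)"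
proof (rule monotone_sublinearI)
  show "\<eta> \<in> S \<Longrightarrow> ampliation 2 \<eta> \<in> S" for \<eta>
    by (rule Sigma_ideal_ampliation[OF I])
qed (simp_all add: ampliation_def sums_iff)

lemma monotone_sublinear_add:
  assumes T: "monotone_sublinear S T" and U: "monotone_sublinear S U"
  shows "monotone_sublinear S (\<lambda>\<eta> n. T \<eta> n + U \<eta> n)"
proof (rule monotone_sublinearI)
  show "(\<lambda>n. T \<eta> n + U \<eta> n) \<in> S" if "\<eta> \<in> S" for \<eta>
    using that by (intro Sigma_ideal_add[OF I] monotone_sublinear_closed[OF T] monotone_sublinear_closed[OF U])
  show "T \<eta> n + U \<eta> n \<le> T \<zeta> n + U \<zeta> n" if "\<eta> \<in> S" "\<zeta> \<in> S" "\<And>n. \<eta> n \<le> \<zeta> n" for \<eta> \<zeta> n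
    by (intro add_mono monotone_sublinear_mono[OF T] monotone_sublinear_mono[OF U] that)
  show "T (\<lambda>n. r * \<eta> n) n + U (\<lambda>n. r * \<eta> n) n = r * (T \<eta> n + U \<eta> n)" if "\<eta> \<in> S" "r \<ge> 0" for \<eta> r n
    using that by (simp add: monotone_sublinear_scale[OF T] monotone_sublinear_scale[OF U] distrib_left)
  fix \<eta> :: "nat \<Rightarrow> nat \<Rightarrow> real" and \<zeta> m
  assume h: "\<And>k. \<eta> k \<in> S" "\<zeta> \<in> S" "\<And>m. (\<lambda>k. \<eta> k m) sums \<zeta> m"
    and sm: "\<And>m. summable (\<lambda>k. T (\<eta> k) m + U (\<eta> k) m)"
  have nn: "0 \<le> T (\<eta> k) m" "0 \<le> U (\<eta> k) m" for k m
    using c0_star_nonneg S_c0 monotone_sublinear_closed[OF T] monotone_sublinear_closed[OF U] h(1) by blast+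
  \<comment> \<open>Nonnegativity lets summability of the combined images pass to each
    summand.\<close>
  have smT: "summable (\<lambda>k. T (\<eta> k) m)" for m
    by (rule summable_comparison_test'[OF sm[of m], of 0]) (simp add: nn)
  have smU: "summable (\<lambda>k. U (\<eta> k) m)" for m
    by (rule summable_comparison_test'[OF sm[of m], of 0]) (simp add: nn)
  show "T \<zeta> m + U \<zeta> m \<le> (\<Sum>k. T (\<eta> k) m + U (\<eta> k) m)"
    unfolding suminf_add[OF smT smU, symmetric]
    by (intro add_mono monotone_sublinear_suminf[OF T h smT] monotone_sublinear_suminf[OF U h smU])
qed

lemma monotone_sublinear_arith_mean:
  assumes "\<And>\<xi>. \<xi> \<in> S \<Longrightarrow> arith_mean \<xi> \<in> S"
  shows "monotone_sublinear S arith_mean"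
proof (rule monotone_sublinearI)
  show "arith_mean \<eta> n \<le> arith_mean \<zeta> n" if "\<And>n. \<eta> n \<le> \<zeta> n" for \<eta> \<zeta> n
    unfolding arith_mean_def by (intro divide_right_mono sum_mono that) simp
  show "arith_mean (\<lambda>n. r * \<eta> n) n = r * arith_mean \<eta> n" for r \<eta> n
    by (simp add: arith_mean_def sum_distrib_left)
  fix \<eta> :: "nat \<Rightarrow> nat \<Rightarrow> real" and \<zeta> m
  assume sums: "\<And>m. (\<lambda>k. \<eta> k m) sums \<zeta> m"
  have "(\<lambda>k. arith_mean (\<eta> k) m) sums arith_mean \<zeta> m"
    unfolding arith_mean_def by (intro sums_divide sums_sum sums)
  then show "arith_mean \<zeta> m \<le> (\<Sum>k. arith_mean (\<eta> k) m)"
    by (simp add: sums_iff)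
qed (rule assms)

text \<open>An inequality suffices, so the two infinite sums need not be interchanged: each finite
  part of the tail of \<zeta> is exchanged with the series and bounded by the full tails.\<close>

lemma monotone_sublinear_arith_mean_inf:
  assumes cl: "\<And>\<xi>. \<xi> \<in> S \<Longrightarrow> arith_mean_inf \<xi> \<in> S" and l1: "\<And>\<xi>. \<xi> \<in> S \<Longrightarrow> summable \<xi>"
  shows "monotone_sublinear S arith_mean_inf"
proof (rule monotone_sublinearI)
  have sm: "summable (\<lambda>j. \<eta> (j + k))" if "\<eta> \<in> S" for \<eta> and k :: nat
    using l1[OF that] by (rule summable_ignore_initial_segment)
  show "arith_mean_inf \<eta> n \<le> arith_mean_inf \<zeta> n" if "\<eta> \<in> S" "\<zeta> \<in> S" "\<And>n. \<eta> n \<le> \<zeta> n" for \<eta> \<zeta> n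
    unfolding arith_mean_inf_def by (intro divide_right_mono suminf_le sm that) simp
  show "arith_mean_inf (\<lambda>n. r * \<eta> n) n = r * arith_mean_inf \<eta> n" if "\<eta> \<in> S" for r \<eta> n
    by (simp only: arith_mean_inf_def suminf_mult[OF sm[OF that]] times_divide_eq_right)
  fix \<eta> :: "nat \<Rightarrow> nat \<Rightarrow> real" and \<zeta> m
  assume h: "\<And>k. \<eta> k \<in> S" "\<zeta> \<in> S" and sums: "\<And>m. (\<lambda>k. \<eta> k m) sums \<zeta> m"
    and sa: "\<And>m. summable (\<lambda>k. arith_mean_inf (\<eta> k) m)"
  have nn: "0 \<le> \<eta> k n" for k n
    by (rule c0_star_nonneg[OF S_c0[OF h(1)]])
  have "(\<Sum>j. \<zeta> (j + (m + 1))) \<le> real (m + 1) * (\<Sum>k. arith_mean_inf (\<eta> k) m)"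
  proof (rule suminf_le_const[OF sm[OF h(2)]])
    fix J
    have "(\<lambda>k. \<Sum>j<J. \<eta> k (j + (m + 1))) sums (\<Sum>j<J. \<zeta> (j + (m + 1)))"
      by (intro sums_sum sums)
    moreover have "(\<lambda>k. real (m + 1) * arith_mean_inf (\<eta> k) m) sums
        (real (m + 1) * (\<Sum>k. arith_mean_inf (\<eta> k) m))"
      by (intro sums_mult summable_sums sa)
    moreover have "(\<Sum>j<J. \<eta> k (j + (m + 1))) \<le> real (m + 1) * arith_mean_inf (\<eta> k) m" for k
      using sum_le_suminf[OF sm[OF h(1)[of k]], of "{..<J}" "m + 1"] nn by (simp add: arith_mean_inf_def)
    ultimately show "(\<Sum>j<J. \<zeta> (j + (m + 1))) \<le> real (m + 1) * (\<Sum>k. arith_mean_inf (\<eta> k) m)"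
      by (rule sums_le[rotated])
  qed
  then show "arith_mean_inf \<zeta> m \<le> (\<Sum>k. arith_mean_inf (\<eta> k) m)"
    unfolding arith_mean_inf_def[of \<zeta>] by (simp add: field_simps)
qed (rule cl)

end

section \<open>Arithmetic means and stability\<close>

lemma arith_mean_antimono:
  assumes x: "\<xi> \<in> c0_star"
  shows "arith_mean \<xi> (Suc k) \<le> arith_mean \<xi> k"
proof -
  have "real (k + 1) * \<xi> (Suc k) = (\<Sum>j\<le>k. \<xi> (Suc k))"
    by simp
  also have "\<dots> \<le> (\<Sum>j\<le>k. \<xi> j)"
    by (intro sum_mono c0_star_antimono[OF x]) simp
  finally show ?thesis
    by (simp add: arith_mean_def field_simps)
qed

lemma le_arith_mean:
  assumes x: "\<xi> \<in> c0_star"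
  shows "\<xi> k \<le> arith_mean \<xi> k"
proof -
  have "real (k + 1) * \<xi> k = (\<Sum>j\<le>k. \<xi> k)"
    by simp
  also have "\<dots> \<le> (\<Sum>j\<le>k. \<xi> j)"
    by (intro sum_mono c0_star_antimono[OF x]) simp
  finally show ?thesis
    by (simp add: arith_mean_def field_simps)
qed

lemma arith_mean_inf_nonneg:
  assumes "\<xi> \<in> l1_star"
  shows "0 \<le> arith_mean_inf \<xi> k"
  unfolding arith_mean_inf_def
  using assms by (intro divide_nonneg_nonneg suminf_nonneg summable_ignore_initial_segment)
    (auto simp: l1_star_def c0_star_nonneg)

lemma arith_mean_inf_antimono:
  assumes x: "\<xi> \<in> l1_star"
  shows "arith_mean_inf \<xi> (Suc k) \<le> arith_mean_inf \<xi> k"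
proof -
  have c: "\<xi> \<in> c0_star" and sm: "\<And>k. summable (\<lambda>j. \<xi> (j + k))"
    using x by (auto simp: l1_star_def intro: summable_ignore_initial_segment)
  have "(\<Sum>j. \<xi> (j + (Suc k + 1))) \<le> (\<Sum>j. \<xi> (j + (k + 1)))"
    by (intro suminf_le sm c0_star_antimono[OF c]) simp
  moreover have "0 \<le> (\<Sum>j. \<xi> (j + (k + 1)))"
    by (intro suminf_nonneg sm c0_star_nonneg[OF c])
  ultimately show ?thesis
    unfolding arith_mean_inf_def by (intro frac_le) auto
qed

text \<open>With q the quotient of k by 4, the q + 1 indices from q + 1 to 2 q + 1 occur in the tail
  and are at most k, provided k is positive. A single halving fails for positive even k. Index 0
  never occurs in a tail, so \<open>\<xi> 0\<close> cannot be controlled this way.\<close>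

lemma le_arith_mean_inf:
  assumes x: "\<xi> \<in> l1_star" and k: "k > 0"
  shows "\<xi> k \<le> arith_mean_inf \<xi> (k div 2 div 2)"
proof -
  have c: "\<xi> \<in> c0_star" and sm: "\<And>k. summable (\<lambda>j. \<xi> (j + k))"
    using x by (auto simp: l1_star_def intro: summable_ignore_initial_segment)
  let ?q = "k div 2 div 2"
  have "real (?q + 1) * \<xi> k = (\<Sum>j<?q + 1. \<xi> k)"
    by simp
  also have "\<dots> \<le> (\<Sum>j<?q + 1. \<xi> (j + (?q + 1)))"
    using k by (intro sum_mono c0_star_antimono[OF c]) auto
  also have "\<dots> \<le> (\<Sum>j. \<xi> (j + (?q + 1)))"
    by (intro sum_le_suminf sm) (auto simp: c0_star_nonneg[OF c])
  finally show ?thesis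
    by (simp add: arith_mean_inf_def field_simps)
qed

lemma c0_star_dominated_null:
  assumes "\<xi> \<in> c0_star" "\<And>n. 0 \<le> \<eta> n" "\<And>n. \<eta> n \<le> K * \<xi> n"
  shows "\<eta> \<longlonglongrightarrow> 0"
proof (rule tendsto_sandwich[of "\<lambda>_. 0"])
  show "(\<lambda>n. K * \<xi> n) \<longlonglongrightarrow> 0"
    using assms(1) by (intro tendsto_mult_right_zero) (simp add: c0_star_def)
qed (use assms in auto)

context normed_ideal
begin

text \<open>Majorising \<open>\<delta>0\<close> as well forces a positive first entry, so the
  principal ideal of \<xi> is nonzero even for X = 0.\<close>

lemma ex_majorant:
  assumes T: "monotone_sublinear S T" and X: "X \<in> I"
  shows "\<exists>\<xi>\<in>S. \<exists>C. \<xi> 0 > 0 \<and> (\<forall>n. singular_values X n \<le> \<xi> n) \<and> (\<forall>n. T \<xi> n \<le> C * \<xi> n)"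
proof -
  have s: "singular_values X \<in> S"
    using X by (simp add: Sigma_ideal_def)
  then have "(\<lambda>n. singular_values X n + \<delta>0 n) \<in> S"
    by (rule Sigma_ideal_add[OF I _ \<delta>0_S])
  from ex_invariant_majorant[OF T this] obtain \<xi> C where x: "\<xi> \<in> S"
      "\<And>n. singular_values X n + \<delta>0 n \<le> \<xi> n" "\<And>n. T \<xi> n \<le> C * \<xi> n"
    by blast
  have "0 \<le> \<delta>0 n" for n
    by (simp add: \<delta>0_def)
  then have "singular_values X n \<le> \<xi> n" for n
    using x(2)[of n] by (smt (verit))
  moreover have "\<xi> 0 > 0"
    using x(2)[of 0] c0_star_nonneg[OF S_c0[OF s], of 0] by (simp add: \<delta>0_def)
  ultimately show ?thesis
    using x by blast
qed

end

section \<open>Stability of ideals and of their principal subideals\<close>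

context std_hilbert
begin

lemma D_nonzero:
  assumes "\<xi> \<in> c0_star" "\<xi> 0 > 0"
  shows "D \<xi> \<noteq> 0"
proof
  assume "D \<xi> = 0"
  then have "\<xi> 0 *\<^sub>R e 0 = 0"
    using D_e[OF c0_star_abs_le[OF assms(1)], of 0] by (simp add: blinfun.zero_left)
  then show False
    using norm_e[of 0] assms(2) by (metis less_irrefl norm_zero scaleR_eq_0_iff zero_neq_one)
qed

lemma ideal_gen_nonzero:
  "\<xi> \<in> c0_star \<Longrightarrow> \<xi> 0 > 0 \<Longrightarrow> ideal_gen (D \<xi>) \<noteq> {0}"
  using D_nonzero by (auto simp: ideal_gen_def)

lemma in_ideal_gen_D:
  assumes I: "op_ideal I" and X: "X \<in> I" and x: "\<xi> \<in> Sigma_ideal I"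
    and le: "\<And>n. singular_values X n \<le> \<xi> n"
  shows "X \<in> ideal_gen (D \<xi>)"
proof -
  have x': "\<xi> \<in> c0_star" "D \<xi> \<in> I"
    using x by (auto simp: Sigma_ideal_eq[OF I])
  note Xc = op_ideal_compact[OF I X] and L = op_ideal_ideal_gen[OF I x'(2)]
  have "\<xi> \<in> Sigma_ideal (ideal_gen (D \<xi>))"
    using x' ideal_gen_self[OF I x'(2)] by (simp add: Sigma_ideal_eq[OF L])
  then have "singular_values X \<in> Sigma_ideal (ideal_gen (D \<xi>))"
    by (rule Sigma_ideal_dominated[OF L _ compact_ops_factor(1)[OF Xc], where C=1]) (simp add: le)
  then show ?thesis
    using D_singular_values_in_ideal_iff[OF L Xc] by (simp add: Sigma_ideal_eq[OF L])
qed

text \<open>The reverse inclusion is automatic, since a decreasing sequence is dominated by its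
  arithmetic mean.\<close>

lemma am_stable_iff:
  fixes I :: "('h \<Rightarrow>\<^sub>L 'h) set"
  assumes I: "op_ideal I"
  shows "am_stable I \<longleftrightarrow> (\<forall>\<xi>\<in>Sigma_ideal I. arith_mean \<xi> \<in> Sigma_ideal I)"
proof -
  have "\<xi> \<in> Sigma_ideal I" if "\<xi> \<in> c0_star" "arith_mean \<xi> \<in> Sigma_ideal I" for \<xi>
    using Sigma_ideal_dominated[OF I that(2,1), of 1] le_arith_mean[OF that(1)] by simp
  then show ?thesis
    unfolding am_stable_def is_ideal_with_Sigma_def using I by (auto simp: Sigma_ideal_eq[OF I])
qed

text \<open>The mean at infinity does not dominate \<xi>. Ampliated twice it does, except at index
  0, which the mean never sees; the multiple of \<delta> that equals \<open>\<xi> 0\<close> at 0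
  repairs this.\<close>

lemma Sigma_ideal_arith_mean_inf:
  fixes I :: "('h \<Rightarrow>\<^sub>L 'h) set"
  assumes I: "op_ideal I" and d: "\<delta> \<in> Sigma_ideal I" "\<delta> 0 > 0"
    and x: "\<xi> \<in> l1_star" "arith_mean_inf \<xi> \<in> Sigma_ideal I"
  shows "\<xi> \<in> Sigma_ideal I"
proof -
  let ?a = "ampliation 2 (ampliation 2 (arith_mean_inf \<xi>))"
  let ?d = "\<lambda>n. \<xi> 0 / \<delta> 0 * \<delta> n"
  have c: "\<xi> \<in> c0_star"
    using x by (simp add: l1_star_def)
  have dc: "\<delta> \<in> c0_star"
    using d(1) by (simp add: Sigma_ideal_eq[OF I])
  have "(\<lambda>n. ?d n + ?a n) \<in> Sigma_ideal I"
    by (intro Sigma_ideal_add[OF I] Sigma_ideal_scale[OF I] Sigma_ideal_ampliation[OF I] d x)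
      (simp add: c0_star_nonneg[OF c] c0_star_nonneg[OF dc])
  moreover have "\<xi> n \<le> 1 * (?d n + ?a n)" for n
  proof (cases "n = 0")
    case True
    then show ?thesis
      using d(2) arith_mean_inf_nonneg[OF x(1)] by (simp add: ampliation_def)
  next
    case False
    moreover have "0 \<le> ?d n"
      by (intro mult_nonneg_nonneg divide_nonneg_nonneg c0_star_nonneg[OF c] c0_star_nonneg[OF dc])
    ultimately show ?thesis
      using le_arith_mean_inf[OF x(1), of n] by (simp add: ampliation_def)
  qed
  ultimately show ?thesis
    by (rule Sigma_ideal_dominated[OF I _ c])
qed

lemma am_inf_stable_iff:
  fixes I :: "('h \<Rightarrow>\<^sub>L 'h) set"
  assumes I: "op_ideal I" and d: "\<delta> \<in> Sigma_ideal I" "\<delta> 0 > 0"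
  shows "am_inf_stable I \<longleftrightarrow> (\<forall>\<xi>\<in>Sigma_ideal I. summable \<xi> \<and> arith_mean_inf \<xi> \<in> Sigma_ideal I)"
proof -
  have "Sigma_ideal I \<subseteq> c0_star"
    by (auto simp: Sigma_ideal_eq[OF I])
  then show ?thesis
    unfolding am_inf_stable_def is_ideal_with_Sigma_def
    using I Sigma_ideal_arith_mean_inf[OF I d] by (auto simp: l1_star_def)
qed

text \<open>The ampliation bound reduces membership to \<eta> \<le> K \<xi>; the mean, being
  monotone, is then at most K C \<xi>.\<close>

lemma SPL_ideal_gen:
  fixes I :: "('h \<Rightarrow>\<^sub>L 'h) set"
  assumes I: "op_ideal I" and x: "\<xi> \<in> Sigma_ideal I" "\<xi> 0 > 0"
    and le: "\<And>n. ampliation 2 \<xi> n + arith_mean \<xi> n \<le> C * \<xi> n"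
  shows "ideal_gen (D \<xi>) \<in> SPL"
proof -
  have x': "\<xi> \<in> c0_star" "D \<xi> \<in> I"
    using x by (auto simp: Sigma_ideal_eq[OF I])
  note L = op_ideal_ideal_gen[OF I x'(2)]
  have "0 \<le> arith_mean \<xi> n" "0 \<le> ampliation 2 \<xi> n" for n
    by (auto simp: arith_mean_def ampliation_def c0_star_nonneg[OF x'(1)] intro!: divide_nonneg_nonneg sum_nonneg)
  then have amp: "ampliation 2 \<xi> n \<le> C * \<xi> n" and am: "arith_mean \<xi> n \<le> C * \<xi> n" for n
    using le[of n] by (smt (verit))+
  note Sig = Sigma_ideal_gen[OF I x'(2,1) amp]
  have "arith_mean \<eta> \<in> Sigma_ideal (ideal_gen (D \<xi>))" if eta: "\<eta> \<in> Sigma_ideal (ideal_gen (D \<xi>))" for \<eta>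
  proof -
    obtain K where h: "\<eta> \<in> c0_star" and K: "\<And>n. \<eta> n \<le> K * \<xi> n"
      using eta unfolding Sig by blast
    \<comment> \<open>Evaluation at 0, where \<xi> is positive, settles the sign of K.\<close>
    have "K * \<xi> 0 \<ge> 0"
      using K[of 0] c0_star_nonneg[OF h, of 0] by linarith
    then have K0: "K \<ge> 0"
      using x(2) by (simp add: zero_le_mult_iff)
    have "arith_mean \<eta> n \<le> (K * C) * \<xi> n" for n
    proof -
      have "arith_mean \<eta> n \<le> K * arith_mean \<xi> n"
        unfolding arith_mean_def times_divide_eq_right sum_distrib_left by (intro divide_right_mono sum_mono K) simp
      also have "\<dots> \<le> K * (C * \<xi> n)"
        by (intro mult_left_mono am K0)
      finally show ?thesis
        by (simp add: mult.assoc)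
    qed
    moreover have nn: "0 \<le> arith_mean \<eta> n" for n
      by (auto simp: arith_mean_def c0_star_nonneg[OF h] intro!: divide_nonneg_nonneg sum_nonneg)
    ultimately have "arith_mean \<eta> \<in> c0_star"
      by (intro c0_starI arith_mean_antimono[OF h] c0_star_dominated_null[OF x'(1)])
    then show ?thesis
      unfolding Sig using \<open>\<And>n. arith_mean \<eta> n \<le> (K * C) * \<xi> n\<close> by blast
  qed
  then have "am_stable (ideal_gen (D \<xi>))"
    by (simp add: am_stable_iff[OF L])
  moreover have "principal_ideal (ideal_gen (D \<xi>))"
    unfolding principal_ideal_def using op_ideal_compact[OF I x'(2)] by blast
  ultimately show ?thesis
    using ideal_gen_nonzero[OF x'(1) x(2)] by (simp add: SPL_def)
qed

text \<open>As for the arithmetic mean, with summability inherited from \<xi> by comparison. The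
  generator itself, with its positive first entry, plays the part of \<delta> in the criterion for
  stability.\<close>

lemma S_inf_PL_ideal_gen:
  fixes I :: "('h \<Rightarrow>\<^sub>L 'h) set"
  assumes I: "op_ideal I" and x: "\<xi> \<in> Sigma_ideal I" "\<xi> 0 > 0" and sm: "summable \<xi>"
    and le: "\<And>n. ampliation 2 \<xi> n + arith_mean_inf \<xi> n \<le> C * \<xi> n"
  shows "ideal_gen (D \<xi>) \<in> S_inf_PL"
proof -
  have x': "\<xi> \<in> c0_star" "D \<xi> \<in> I"
    using x by (auto simp: Sigma_ideal_eq[OF I])
  have xl: "\<xi> \<in> l1_star"
    using x'(1) sm by (simp add: l1_star_def)
  note L = op_ideal_ideal_gen[OF I x'(2)]
  have "0 \<le> arith_mean_inf \<xi> n" "0 \<le> ampliation 2 \<xi> n" for n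
    by (auto simp: ampliation_def c0_star_nonneg[OF x'(1)] arith_mean_inf_nonneg[OF xl])
  then have amp: "ampliation 2 \<xi> n \<le> C * \<xi> n" and am: "arith_mean_inf \<xi> n \<le> C * \<xi> n" for n
    using le[of n] by (smt (verit))+
  note Sig = Sigma_ideal_gen[OF I x'(2,1) amp]
  have xL: "\<xi> \<in> Sigma_ideal (ideal_gen (D \<xi>))"
    using x' ideal_gen_self[OF I x'(2)] by (simp add: Sigma_ideal_eq[OF L])
  have "summable \<eta> \<and> arith_mean_inf \<eta> \<in> Sigma_ideal (ideal_gen (D \<xi>))"
    if eta: "\<eta> \<in> Sigma_ideal (ideal_gen (D \<xi>))" for \<eta>
  proof -
    obtain K where h: "\<eta> \<in> c0_star" and K: "\<And>n. \<eta> n \<le> K * \<xi> n"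
      using eta unfolding Sig by blast
    have "K * \<xi> 0 \<ge> 0"
      using K[of 0] c0_star_nonneg[OF h, of 0] by linarith
    then have K0: "K \<ge> 0"
      using x(2) by (simp add: zero_le_mult_iff)
    have smh: "summable \<eta>"
      by (rule summable_comparison_test'[OF summable_mult[OF sm, of K], of 0])
        (simp add: c0_star_nonneg[OF h] K)
    have hl: "\<eta> \<in> l1_star"
      using h smh by (simp add: l1_star_def)
    have bd: "arith_mean_inf \<eta> n \<le> (K * C) * \<xi> n" for n
    proof -
      have sx: "summable (\<lambda>j. \<xi> (j + (n + 1)))"
        using sm by (rule summable_ignore_initial_segment)
      have "(\<Sum>j. \<eta> (j + (n + 1))) \<le> (\<Sum>j. K * \<xi> (j + (n + 1)))"
        by (intro suminf_le K summable_mult sx summable_ignore_initial_segment smh)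
      then have "arith_mean_inf \<eta> n \<le> K * arith_mean_inf \<xi> n"
        unfolding arith_mean_inf_def times_divide_eq_right suminf_mult[OF sx] by (rule divide_right_mono) simp
      also have "\<dots> \<le> K * (C * \<xi> n)"
        by (intro mult_left_mono am K0)
      finally show ?thesis
        by (simp add: mult.assoc)
    qed
    have "arith_mean_inf \<eta> \<in> c0_star"
      by (intro c0_starI arith_mean_inf_antimono[OF hl] arith_mean_inf_nonneg[OF hl]
          c0_star_dominated_null[OF x'(1) _ bd])
    then show ?thesis
      unfolding Sig using bd smh by blast
  qed
  then have "am_inf_stable (ideal_gen (D \<xi>))"
    unfolding am_inf_stable_iff[OF L xL x(2)] by blast
  moreover have "principal_ideal (ideal_gen (D \<xi>))"
    unfolding principal_ideal_def using op_ideal_compact[OF I x'(2)] by blast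
  ultimately show ?thesis
    using ideal_gen_nonzero[OF x'(1) x(2)] by (simp add: S_inf_PL_def)
qed

end

section \<open>The three equivalences with unions of principal ideals\<close>

context normed_ideal
begin

text \<open>The p-th root of the singular values is majorised inside I, where the norm lives.
  Termwise powers commute with ampliation and preserve order, so the power of the majorant works in
  K, with constant \<open>C powr p\<close>.\<close>

lemma powr_ideal_eq_Union:
  assumes p: "p > 0" and K: "is_ideal_power K I p"
  shows "K = \<Union>{L \<in> Delta_half_PL. L \<subseteq> K}"
proof (intro antisym subsetI)
  have K_id: "op_ideal K" and K_Sig: "Sigma_ideal K = (\<lambda>\<xi> n. \<xi> n powr p) ` S"
    using K by (auto simp: is_ideal_power_def is_ideal_with_Sigma_def)
  fix X
  assume X: "X \<in> K"
  then have "singular_values X \<in> Sigma_ideal K"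
    by (simp add: Sigma_ideal_def)
  then obtain \<eta> where h: "\<eta> \<in> S" and Xh: "singular_values X = (\<lambda>n. \<eta> n powr p)"
    unfolding K_Sig by blast
  then obtain Y where Y: "Y \<in> I" "\<eta> = singular_values Y"
    by (auto simp: Sigma_ideal_def)
  obtain \<xi> C where x: "\<xi> \<in> S" "\<xi> 0 > 0" "\<And>n. \<eta> n \<le> \<xi> n" "\<And>n. ampliation 2 \<xi> n \<le> C * \<xi> n"
    using ex_majorant[OF monotone_sublinear_ampliation Y(1)] unfolding Y(2) by blast
  let ?x = "\<lambda>n. \<xi> n powr p"
  have xK: "?x \<in> Sigma_ideal K"
    unfolding K_Sig using x(1) by blast
  have xc: "?x \<in> c0_star" and xD: "D ?x \<in> K"
    using xK by (auto simp: Sigma_ideal_eq[OF K_id])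
  have nn: "0 \<le> \<xi> n" for n
    by (rule c0_star_nonneg[OF S_c0[OF x(1)]])
  have "C * \<xi> 0 \<ge> 0"
    using x(4)[of 0] nn[of "0 div 2"] unfolding ampliation_def by linarith
  then have C: "C \<ge> 0"
    using x(2) by (simp add: zero_le_mult_iff)
  have "norm (ampliation 2 ?x n) \<le> C powr p * norm (?x n)" for n
  proof -
    have "ampliation 2 \<xi> n powr p \<le> (C * \<xi> n) powr p"
      using p nn by (intro powr_mono2 x(4)) (auto simp: ampliation_def)
    then show ?thesis
      by (simp add: ampliation_def powr_mult)
  qed
  then have "ampliation 2 ?x \<in> O(?x)"
    by (intro bigoI[where c="C powr p"] always_eventually allI)
  moreover have "ideal_gen (D ?x) \<noteq> {0}"
    using x(2) by (intro ideal_gen_nonzero xc) simp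
  ultimately have "ideal_gen (D ?x) \<in> Delta_half_PL"
    unfolding Delta_half_PL_def using xc by blast
  moreover have "ideal_gen (D ?x) \<subseteq> K"
    by (rule ideal_gen_subset[OF K_id xD])
  moreover have "X \<in> ideal_gen (D ?x)"
    by (rule in_ideal_gen_D[OF K_id X xK])
      (use p x(3) c0_star_nonneg[OF S_c0[OF h]] in \<open>auto simp: Xh intro!: powr_mono2\<close>)
  ultimately show "X \<in> \<Union>{L \<in> Delta_half_PL. L \<subseteq> K}"
    by blast
qed auto

lemma am_stable_iff_Union: "am_stable I \<longleftrightarrow> I = \<Union>{L \<in> SPL. L \<subseteq> I}"
proof
  assume "am_stable I"
  then have cl: "arith_mean \<xi> \<in> S" if "\<xi> \<in> S" for \<xi>
    using that by (simp add: am_stable_iff[OF I])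
  note T = monotone_sublinear_add[OF monotone_sublinear_ampliation monotone_sublinear_arith_mean[OF cl]]
  show "I = \<Union>{L \<in> SPL. L \<subseteq> I}"
  proof (intro antisym subsetI)
    fix X
    assume X: "X \<in> I"
    obtain \<xi> C where x: "\<xi> \<in> S" "\<xi> 0 > 0" "\<And>n. singular_values X n \<le> \<xi> n"
        "\<And>n. ampliation 2 \<xi> n + arith_mean \<xi> n \<le> C * \<xi> n"
      using ex_majorant[OF T X] by blast
    show "X \<in> \<Union>{L \<in> SPL. L \<subseteq> I}"
      using SPL_ideal_gen[OF I x(1,2,4)] ideal_gen_subset[OF I S_D[OF x(1)]] in_ideal_gen_D[OF I X x(1,3)]
      by blast
  qed auto
next
  assume eq: "I = \<Union>{L \<in> SPL. L \<subseteq> I}"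
  show "am_stable I"
    unfolding am_stable_iff[OF I]
  proof
    fix \<xi>
    assume x: "\<xi> \<in> S"
    \<comment> \<open>A single member of the union contains \<open>D \<xi>\<close>; its own
      stability yields the mean, and inclusion carries the mean into I.\<close>
    obtain L where L: "L \<in> SPL" "L \<subseteq> I" "D \<xi> \<in> L"
      using S_D[OF x] eq by blast
    then have st: "am_stable L" and L_id: "op_ideal L"
      by (auto simp: SPL_def am_stable_def is_ideal_with_Sigma_def)
    then have "arith_mean \<xi> \<in> Sigma_ideal L"
      using L(3) S_c0[OF x] by (simp add: am_stable_iff[OF L_id] Sigma_ideal_eq[OF L_id])
    then show "arith_mean \<xi> \<in> S"
      using L(2) by (auto simp: Sigma_ideal_def)
  qed
qed

lemma am_inf_stable_iff_Union: "am_inf_stable I \<longleftrightarrow> I = \<Union>{L \<in> S_inf_PL. L \<subseteq> I}"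
proof -
  have d: "\<delta>0 0 > 0"
    by (simp add: \<delta>0_def)
  note iff = am_inf_stable_iff[OF I \<delta>0_S d]
  show ?thesis
  proof
    assume st: "am_inf_stable I"
    have cl: "arith_mean_inf \<xi> \<in> S" and l1: "summable \<xi>" if "\<xi> \<in> S" for \<xi>
      using that st unfolding iff by auto
    note T = monotone_sublinear_add[OF monotone_sublinear_ampliation monotone_sublinear_arith_mean_inf[OF cl l1]]
    show "I = \<Union>{L \<in> S_inf_PL. L \<subseteq> I}"
    proof (intro antisym subsetI)
      fix X
      assume X: "X \<in> I"
      obtain \<xi> C where x: "\<xi> \<in> S" "\<xi> 0 > 0" "\<And>n. singular_values X n \<le> \<xi> n"
          "\<And>n. ampliation 2 \<xi> n + arith_mean_inf \<xi> n \<le> C * \<xi> n"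
        using ex_majorant[OF T X] by blast
      show "X \<in> \<Union>{L \<in> S_inf_PL. L \<subseteq> I}"
        using S_inf_PL_ideal_gen[OF I x(1,2) l1[OF x(1)] x(4)] ideal_gen_subset[OF I S_D[OF x(1)]]
          in_ideal_gen_D[OF I X x(1,3)]
        by blast
    qed auto
  next
    assume eq: "I = \<Union>{L \<in> S_inf_PL. L \<subseteq> I}"
    show "am_inf_stable I"
      unfolding iff
    proof
      fix \<xi>
      assume x: "\<xi> \<in> S"
      \<comment> \<open>Stability of the one L containing \<open>D \<xi>\<close> yields both
        summability of \<xi> and membership of its mean.\<close>
      obtain L where L: "L \<in> S_inf_PL" "L \<subseteq> I" "D \<xi> \<in> L"
        using S_D[OF x] eq by blast
      then have L_id: "op_ideal L"
        and Sig: "Sigma_ideal L = {\<xi> \<in> l1_star. arith_mean_inf \<xi> \<in> Sigma_ideal L}"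
        by (auto simp: S_inf_PL_def am_inf_stable_def is_ideal_with_Sigma_def)
      have "\<xi> \<in> Sigma_ideal L"
        using L(3) S_c0[OF x] by (simp add: Sigma_ideal_eq[OF L_id])
      then have "\<xi> \<in> {\<xi> \<in> l1_star. arith_mean_inf \<xi> \<in> Sigma_ideal L}"
        by (rule equalityD1[OF Sig, THEN subsetD])
      then have "summable \<xi>" "arith_mean_inf \<xi> \<in> Sigma_ideal L"
        by (auto simp: l1_star_def)
      then show "summable \<xi> \<and> arith_mean_inf \<xi> \<in> S"
        using L(2) by (auto simp: Sigma_ideal_def)
    qed
  qed
qed

end

theorem proposition4p3:
  assumes separable: "\<exists>D :: 'h::complex_hilbert set. countable D \<and> closure D = UNIV"
    and infinite_dim: "\<not> (\<exists>B :: 'h set. finite B \<and> complex_vector.span B = UNIV)"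
  shows
    "(\<forall>(I :: ('h \<Rightarrow>\<^sub>L 'h) set) J p. p > 0 \<and> banach_ideal J \<and> J \<noteq> {0} \<and> is_ideal_power I J p \<longrightarrow>
        I = \<Union>{L \<in> Delta_half_PL. L \<subseteq> I}) \<and>
     (\<forall>I :: ('h \<Rightarrow>\<^sub>L 'h) set. banach_ideal I \<and> I \<noteq> {0} \<longrightarrow>
        (am_stable I \<longleftrightarrow> I = \<Union>{L \<in> SPL. L \<subseteq> I})) \<and>
     (\<forall>I :: ('h \<Rightarrow>\<^sub>L 'h) set. banach_ideal I \<and> I \<noteq> {0} \<longrightarrow>
        (am_inf_stable I \<longleftrightarrow> I = \<Union>{L \<in> S_inf_PL. L \<subseteq> I}))"
proof -
  have ex_norm: "\<exists>N. normed_ideal (std_basis :: nat \<Rightarrow> 'h) I N"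
    if "banach_ideal I" "I \<noteq> {0}" for I :: "('h \<Rightarrow>\<^sub>L 'h) set"
    using that orthonormal_basis_std_basis[OF separable infinite_dim]
    by (auto simp: banach_ideal_def normed_ideal_def normed_ideal_axioms_def std_hilbert_def)
  show ?thesis
  proof (intro conjI allI impI)
    fix I J :: "('h \<Rightarrow>\<^sub>L 'h) set" and p :: real
    assume *: "p > 0 \<and> banach_ideal J \<and> J \<noteq> {0} \<and> is_ideal_power I J p"
    then obtain N where "normed_ideal (std_basis :: nat \<Rightarrow> 'h) J N"
      using ex_norm by blast
    with * show "I = \<Union>{L \<in> Delta_half_PL. L \<subseteq> I}"
      using normed_ideal.powr_ideal_eq_Union by blast
  next
    fix I :: "('h \<Rightarrow>\<^sub>L 'h) set"
    assume "banach_ideal I \<and> I \<noteq> {0}"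
    then obtain N where N: "normed_ideal (std_basis :: nat \<Rightarrow> 'h) I N"
      using ex_norm by blast
    show "am_stable I \<longleftrightarrow> I = \<Union>{L \<in> SPL. L \<subseteq> I}"
      by (rule normed_ideal.am_stable_iff_Union[OF N])
    show "am_inf_stable I \<longleftrightarrow> I = \<Union>{L \<in> S_inf_PL. L \<subseteq> I}"
      by (rule normed_ideal.am_inf_stable_iff_Union[OF N])
  qed
qed

end
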